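(* Let $K$ be a field of characteristic $0$ and let $n\geq 2$, $d\geq 4$ be integers. For every integer $t$ with $2\leq t\leq d-2$, the ideal $I_3(\mathrm{Cat}(t,d-t;n))\subset S=K[z_\gamma : |\gamma|=d]$ is the ideal of the secant line variety of the $d$-th Veronese embedding of $\mathbb{P}_K^{n-1}$, i.e. the ideal of all polynomials in $S$ vanishing on that variety.
   Context: Let $K$ be a field of characteristic $0$ and let $n,d$ be positive integers. Multisets $\gamma$ of size $d$ with elements in $\{1,\dots,n\}$ are identified with multiindices $(\gamma_1,\dots,\gamma_n)\in\mathbb{Z}_{\geq 0}^n$ with $|\gamma|=\gamma_1+\cdots+\gamma_n=d$, where $\gamma_i$ is the number of occurrences of $i$ in $\gamma$. The union $\alpha\cup\beta$ of two multisets is taken with multiplicities added, i.e. it corresponds to the sum of multiindices. Let $S=K[z_\gamma : |\gamma|=d]$ be the polynomial ring with one variable $z_\gamma$ for each multiset $\gamma$ of size $d$ with elements in $\{1,\dots,n\}$. For integers $a,b>0$ with $a+b=d$, the generic catalecticant matrix $\mathrm{Cat}(a,b;n)$ is the matrix with entries in $S$ whose rows are indexed by the multisets $\alpha$ of size $a$ and whose columns are indexed by the multisets $\beta$ of size $b$ (with elements in $\{1,\dots,n\}$), and whose entry in position $(\alpha,\beta)$ is $z_{\alpha\cup\beta}$. $I_k(\mathrm{Cat}(a,b;n))\subset S$ denotes the ideal generated by all $k\times k$ minors of $\mathrm{Cat}(a,b;n)$. Let $V$ be an $n$-dimensional $K$-vector space, and let $e_1,\dots,e_n$ be a basis of the dual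 space $V^*$. For a vector space $U$, $\mathbb{P}U$ denotes the projective space of lines in $U$, and $[u]$ is the line spanned by $0\neq u\in U$. The $d$-th symmetric power $\mathrm{Sym}^d V^*$ has the basis of divided power monomials $e^{(\gamma)}=\prod_i e_i^{\gamma_i}/\prod_i \gamma_i!$, $|\gamma|=d$, and the $z_\gamma$ are identified with the dual basis of $\mathrm{Sym}^d V$ (dual to $\mathrm{Sym}^dV^*$), so that $S=\mathrm{Sym}(\mathrm{Sym}^d V)$ is the homogeneous coordinate ring of $\mathbb{P}(\mathrm{Sym}^d V^* )$. The $d$-th Veronese embedding of $\mathbb{P}^{n-1}_K=\mathbb{P}(V^* )$ is the map $\mathbb{P}(V^* )\to\mathbb{P}(\mathrm{Sym}^d V^* )$, $[e]\mapsto[e^{(d)}]$ with $e^{(d)}=e^d/d!$; in coordinates, $[c_1:\cdots:c_n]\mapsto[c_1^{\gamma_1}\cdots c_n^{\gamma_n}]_{|\gamma|=d}$. Its secant line variety is the Zariski closure in $\mathbb{P}(\mathrm{Sym}^d V^* )$ of the union of the linear subspaces spanned by collections of $2$ points in the image of the Veronese embedding. *)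

theory Defs
  imports
    "HOL-Library.Multiset_Order"
    "HOL-Library.Poly_Mapping"
    "HOL-Library.Function_Algebras"
    "HOL-Algebra.Ideal"
    "Jordan_Normal_Form.Determinant"
begin

section \<open>Polynomials\<close>

text \<open>A monomial in variables of type \<open>'x\<close> is the multiset of its variable factors, so that
  multiplication of monomials is addition of multisets and the product of \<^typ>\<open>'x multiset \<Rightarrow>\<^sub>0 'k\<close>
  provided by \<open>Poly_Mapping\<close> is the product of polynomials.\<close>

type_synonym ('x, 'k) mpoly = "'x multiset \<Rightarrow>\<^sub>0 'k"

definition mvar :: "'x \<Rightarrow> ('x, 'k::comm_ring_1) mpoly" where
  "mvar x = Poly_Mapping.single {#x#} 1"

definition mpoly_eval :: "('x \<Rightarrow> 'k) \<Rightarrow> ('x, 'k::comm_ring_1) mpoly \<Rightarrow> 'k" where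
  "mpoly_eval u p =
     (\<Sum>m\<in>Poly_Mapping.keys p. Poly_Mapping.lookup p m * (\<Prod>x\<in>#m. u x))"

definition homogeneous :: "('x, 'k::comm_ring_1) mpoly \<Rightarrow> bool" where
  "homogeneous p \<longleftrightarrow> (\<exists>e. \<forall>m\<in>Poly_Mapping.keys p. size m = e)"

text \<open>The polynomial ring with set of variables \<open>X\<close>.\<close>

definition mpoly_ring :: "'x set \<Rightarrow> ('x, 'k::comm_ring_1) mpoly ring" where
  "mpoly_ring X =
     \<lparr>carrier = {p. \<forall>m\<in>Poly_Mapping.keys p. set_mset m \<subseteq> X},
      mult = (*), one = 1, zero = 0, add = (+)\<rparr>"

lemma cring_mpoly_ring: "cring (mpoly_ring X :: ('x, 'k::comm_ring_1) mpoly ring)"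
proof (rule cringI)
  show "abelian_group (mpoly_ring X :: ('x, 'k) mpoly ring)"
  proof (rule abelian_groupI)
    fix p :: "('x, 'k) mpoly"
    assume "p \<in> carrier (mpoly_ring X)"
    then show "\<exists>q\<in>carrier (mpoly_ring X). q \<oplus>\<^bsub>mpoly_ring X\<^esub> p = \<zero>\<^bsub>mpoly_ring X\<^esub>"
      by (intro bexI[of _ "- p"]) (auto simp: mpoly_ring_def)
  qed (use Poly_Mapping.keys_add in \<open>fastforce simp: mpoly_ring_def algebra_simps\<close>)+
  show "comm_monoid (mpoly_ring X :: ('x, 'k) mpoly ring)"
  proof (rule comm_monoidI)
    fix p q :: "('x, 'k) mpoly"
    assume "p \<in> carrier (mpoly_ring X)" "q \<in> carrier (mpoly_ring X)"
    then show "p \<otimes>\<^bsub>mpoly_ring X\<^esub> q \<in> carrier (mpoly_ring X)"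
      using keys_mult[of p q] by (fastforce simp: mpoly_ring_def)
  qed (auto simp: mpoly_ring_def algebra_simps split: if_splits)
qed (auto simp: mpoly_ring_def algebra_simps)


section \<open>Catalecticant matrices and their minors\<close>

definition msets :: "nat \<Rightarrow> nat \<Rightarrow> nat multiset set" where
  "msets n d = {\<gamma>. set_mset \<gamma> \<subseteq> {1..n} \<and> size \<gamma> = d}"

text \<open>The entry \<open>z\<^bsub>\<alpha>\<union>\<beta>\<^esub>\<close> of the generic catalecticant matrix. The union of multisets adds
  multiplicities, hence is \<open>+\<close> and not \<open>\<union>#\<close>.\<close>

definition cat :: "nat multiset \<Rightarrow> nat multiset \<Rightarrow> (nat multiset, 'k::comm_ring_1) mpoly" where
  "cat \<alpha> \<beta> = mvar (\<alpha> + \<beta>)"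

text \<open>The \<open>k \<times> k\<close> minors of a matrix \<open>M\<close> with rows indexed by \<open>R\<close> and columns indexed by \<open>C\<close>.
  No ordering of \<open>R\<close> and \<open>C\<close> is fixed; every minor occurs with both signs (if \<open>k \<ge> 2\<close>).\<close>

definition minors :: "nat \<Rightarrow> 'r set \<Rightarrow> 'c set \<Rightarrow> ('r \<Rightarrow> 'c \<Rightarrow> 'a::comm_ring_1) \<Rightarrow> 'a set" where
  "minors k R C M =
     {det (mat k k (\<lambda>(i, j). M (r i) (c j))) | r c.
        inj_on r {..<k} \<and> r ` {..<k} \<subseteq> R \<and> inj_on c {..<k} \<and> c ` {..<k} \<subseteq> C}"

definition cat_ideal :: "nat \<Rightarrow> nat \<Rightarrow> nat \<Rightarrow> nat \<Rightarrow> (nat multiset, 'k::comm_ring_1) mpoly set" where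
  "cat_ideal k a b n =
     Idl\<^bsub>mpoly_ring (msets n (a + b))\<^esub> (minors k (msets n a) (msets n b) cat)"


section \<open>Projective space and Zariski closure\<close>

definition fscale :: "'k::field \<Rightarrow> ('x \<Rightarrow> 'k) \<Rightarrow> 'x \<Rightarrow> 'k" where
  "fscale c u = (\<lambda>x. c * u x)"

interpretation fvs: vector_space "fscale :: 'k::field \<Rightarrow> ('x \<Rightarrow> 'k) \<Rightarrow> 'x \<Rightarrow> 'k"
  by unfold_locales (auto simp: fscale_def fun_eq_iff algebra_simps)

text \<open>The coordinate space \<open>K\<^sup>X\<close>, as functions that vanish outside \<open>X\<close>.\<close>

definition coord_space :: "'x set \<Rightarrow> ('x \<Rightarrow> 'k::field) set" where
  "coord_space X = {u. \<forall>x. x \<notin> X \<longrightarrow> u x = 0}"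

text \<open>Points of \<open>\<bbbP>(K\<^sup>X)\<close> are the lines in \<open>K\<^sup>X\<close>.\<close>

definition proj_space :: "'x set \<Rightarrow> ('x \<Rightarrow> 'k::field) set set" where
  "proj_space X = {fvs.span {u} | u. u \<in> coord_space X \<and> u \<noteq> 0}"

text \<open>The linear subspace of \<open>\<bbbP>(K\<^sup>X)\<close> spanned by a set of points.\<close>

definition proj_span :: "'x set \<Rightarrow> ('x \<Rightarrow> 'k::field) set set \<Rightarrow> ('x \<Rightarrow> 'k) set set" where
  "proj_span X T = {L \<in> proj_space X. L \<subseteq> fvs.span (\<Union>T)}"

text \<open>A polynomial vanishes at a point if it vanishes at all vectors of homogeneous coordinates
  representing that point.\<close>

definition vanishes_at :: "('x, 'k::field) mpoly \<Rightarrow> ('x \<Rightarrow> 'k) set \<Rightarrow> bool" where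
  "vanishes_at p L \<longleftrightarrow> (\<forall>u\<in>L - {0}. mpoly_eval u p = 0)"

definition zariski_closed :: "'x set \<Rightarrow> ('x \<Rightarrow> 'k::field) set set \<Rightarrow> bool" where
  "zariski_closed X Z \<longleftrightarrow>
     (\<exists>F. F \<subseteq> carrier (mpoly_ring X) \<and> (\<forall>p\<in>F. homogeneous p) \<and>
          Z = {L \<in> proj_space X. \<forall>p\<in>F. vanishes_at p L})"

definition zariski_closure :: "'x set \<Rightarrow> ('x \<Rightarrow> 'k::field) set set \<Rightarrow> ('x \<Rightarrow> 'k) set set" where
  "zariski_closure X Y = \<Inter>{Z. zariski_closed X Z \<and> Y \<subseteq> Z}"

definition vanishing_ideal :: "'x set \<Rightarrow> ('x \<Rightarrow> 'k::field) set set \<Rightarrow> ('x, 'k) mpoly set" where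
  "vanishing_ideal X Y = {p \<in> carrier (mpoly_ring X). \<forall>L\<in>Y. vanishes_at p L}"


section \<open>The secant line variety of the Veronese embedding\<close>

text \<open>An element \<open>e = c\<^sub>1 e\<^sub>1 + \<dots> + c\<^sub>n e\<^sub>n\<close> of \<open>V\<^sup>*\<close> is given by its coordinates \<open>c\<close>, and
  an element of \<open>Sym\<^sup>d V\<^sup>*\<close> by its coordinates in the basis of divided power monomials. By the
  multinomial theorem \<open>e\<^sup>d / d!\<close> has the coordinates below.\<close>

definition veronese_vec :: "nat \<Rightarrow> nat \<Rightarrow> (nat \<Rightarrow> 'k::field) \<Rightarrow> nat multiset \<Rightarrow> 'k" where
  "veronese_vec n d c =
     (\<lambda>\<gamma>. if \<gamma> \<in> msets n d then \<Prod>i=1..n. c i ^ count \<gamma> i else 0)"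

definition veronese_image :: "nat \<Rightarrow> nat \<Rightarrow> (nat multiset \<Rightarrow> 'k::field) set set" where
  "veronese_image n d =
     {fvs.span {veronese_vec n d c} | c. c \<in> coord_space {1..n} \<and> c \<noteq> 0}"

lemma veronese_image_subset_proj_space:
  "(veronese_image n d :: (nat multiset \<Rightarrow> 'k::field) set set) \<subseteq> proj_space (msets n d)"
proof -
  have "veronese_vec n d c \<noteq> 0" if "c \<in> coord_space {1..n}" "c \<noteq> 0" for c :: "nat \<Rightarrow> 'k"
  proof -
    obtain i where i: "c i \<noteq> 0" "i \<in> {1..n}"
    proof -
      obtain i where "c i \<noteq> 0"
        using \<open>c \<noteq> 0\<close> by (auto simp: fun_eq_iff)
      then show ?thesis
        using \<open>c \<in> coord_space {1..n}\<close> that by (auto simp: coord_space_def)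
    qed
    have "replicate_mset d i \<in> msets n d"
      using i by (auto simp: msets_def)
    moreover have "(\<Prod>j=1..n. c j ^ count (replicate_mset d i) j) \<noteq> 0"
      using i by (auto simp: count_replicate_mset)
    ultimately have "veronese_vec n d c (replicate_mset d i) \<noteq> 0"
      by (simp add: veronese_vec_def)
    then show ?thesis by auto
  qed
  moreover have "veronese_vec n d c \<in> coord_space (msets n d)" for c :: "nat \<Rightarrow> 'k"
    by (auto simp: veronese_vec_def coord_space_def)
  ultimately show ?thesis
    unfolding veronese_image_def proj_space_def by blast
qed

definition secant_line_variety :: "nat \<Rightarrow> nat \<Rightarrow> (nat multiset \<Rightarrow> 'k::field) set set" where
  "secant_line_variety n d =
     zariski_closure (msets n d)
       (\<Union>T\<in>{T. T \<subseteq> veronese_image n d \<and> card T = 2}. proj_span (msets n d) T)"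

end

theory Submission
  imports Defs
begin

text \<open>
  Let \<open>X\<close> be the set of multisets of size \<open>d\<close>, so that \<open>S = K[z\<^sub>\<gamma> | \<gamma> \<in> X]\<close>, and let \<open>I\<close> be the ideal of
  the \<open>3 \<times> 3\<close> minors of \<open>Cat(t, d - t)\<close>. Over the infinite field \<open>K\<close>, a polynomial vanishes on the
  secant variety iff it vanishes at every point \<open>s a\<^sup>\<gamma> + t b\<^sup>\<gamma>\<close>; call the ideal of these
  polynomials \<open>J\<close> (\<open>sec_ideal\<close>). At such a point the catalecticant matrix has rank at most two,
  whence \<open>I \<subseteq> J\<close>. The reverse inclusion combines three facts.

  \<^item> The minors of \<open>Cat(1, d - 1)\<close> lie in \<open>I\<close> (\<open>linear_minors_in_ideal\<close>). Read a product of three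
  variables as a polynomial of degree \<open>d\<close> in each of three points of \<open>V\<^sup>*\<close>. A minor of \<open>Cat(a, b)\<close>
  becomes a product of two alternating polynomials, of degrees \<open>a\<close> and \<open>b\<close> in each point. The
  claim then follows if every alternating polynomial of degree \<open>d - 1\<close> is a sum of products of
  symmetric ones of degree \<open>t - 1\<close> with alternating ones of degree \<open>d - t\<close>, and this holds because
  \<open>d - t \<ge> 2\<close> (\<open>alternating_form_vanishes\<close>).

  \<^item> The Lie algebra \<open>gl\<^sub>n\<close> acts on \<open>S\<close> by derivations \<open>E\<^sub>i\<^sub>j\<close> (\<open>polarize i j\<close>) which extend
  \<open>a\<^sub>i \<partial>/\<partial>a\<^sub>j\<close> on monomials \<open>a\<^sup>\<gamma>\<close> and preserve both \<open>I\<close> and \<open>J\<close>. If \<open>J\<close> were not contained in \<open>I\<close>,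
  some weight vector \<open>f \<in> J\<close> outside \<open>I\<close> would be sent into \<open>I\<close> by every \<open>E\<^sub>i\<^sub>j\<close> with \<open>i < j\<close>. The
  Capelli determinant of the letters \<open>1, 2, k\<close> acts on such an \<open>f\<close> modulo \<open>I\<close> as the scalar
  \<open>(\<nu>\<^sub>1 + 2)(\<nu>\<^sub>2 + 1) \<nu>\<^sub>k\<close>, where \<open>\<nu>\<close> is the weight; by Capelli's identity it also maps \<open>S\<close> into the
  ideal of minors of \<open>Cat(1, d - 1)\<close>, hence into \<open>I\<close>. In characteristic zero this forces \<open>\<nu>\<^sub>k = 0\<close>
  for all \<open>k \<ge> 3\<close>, so \<open>f\<close> involves only variables indexed by multisets of ones and twos
  (\<open>sec_ideal_subset\<close>).

  \<^item> For two letters the catalecticant is a Hankel matrix in \<open>z\<^sub>0, \<dots>, z\<^sub>d\<close>. The main diagonals of its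
  minors are the products \<open>z\<^sub>x z\<^sub>y z\<^sub>z\<close> with \<open>x + 2 \<le> y\<close> and \<open>y + 2 \<le> z\<close>, whatever \<open>t\<close> is. Straightening
  leaves the monomials divisible by no such product (\<open>reducible_monomial\<close>), and these are linearly
  independent as functions on the secant lines of the rational normal curve
  (\<open>clustered_independent\<close>).
\<close>

section \<open>Polynomial rings, ideals and three by three determinants\<close>

abbreviation polys :: "'x set \<Rightarrow> ('x, 'k::comm_ring_1) mpoly set" where
  "polys X \<equiv> carrier (mpoly_ring X)"

definition const :: "'k::comm_ring_1 \<Rightarrow> ('x, 'k) mpoly" where
  "const c = Poly_Mapping.single {#} c"

lemma polys_iff: "p \<in> polys X \<longleftrightarrow> (\<forall>m\<in>Poly_Mapping.keys p. set_mset m \<subseteq> X)"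
  by (simp add: mpoly_ring_def)

lemma mpoly_ring_simps [simp]:
  "mult (mpoly_ring X) = (*)" "one (mpoly_ring X) = 1" "zero (mpoly_ring X) = 0" "add (mpoly_ring X) = (+)"
  by (simp_all add: mpoly_ring_def)

lemma polys_0: "0 \<in> polys X"
  and polys_1: "1 \<in> polys X"
  and polys_const: "const c \<in> polys X"
  by (auto simp: polys_iff const_def)

lemma polys_mvar: "x \<in> X \<Longrightarrow> mvar x \<in> polys X"
  by (auto simp: polys_iff mvar_def)

lemma polys_single: "set_mset m \<subseteq> X \<Longrightarrow> Poly_Mapping.single m c \<in> polys X"
  by (auto simp: polys_iff)

lemma polys_add: "p \<in> polys X \<Longrightarrow> q \<in> polys X \<Longrightarrow> p + q \<in> polys X"
  using Poly_Mapping.keys_add by (fastforce simp: polys_iff)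

lemma polys_uminus: "p \<in> polys X \<Longrightarrow> - p \<in> polys X"
  by (auto simp: polys_iff)

lemma polys_diff: "p \<in> polys X \<Longrightarrow> q \<in> polys X \<Longrightarrow> p - q \<in> polys X"
  using polys_add[of p X "- q"] polys_uminus[of q X] by simp

lemma polys_mult: "p \<in> polys X \<Longrightarrow> q \<in> polys X \<Longrightarrow> p * q \<in> polys X"
  using keys_mult[of p q] by (fastforce simp: polys_iff)

lemmas polys_intros = polys_0 polys_1 polys_const polys_mvar polys_add polys_uminus polys_diff polys_mult

lemma single_eq_const_mult: "Poly_Mapping.single m c = const c * Poly_Mapping.single m 1"
  by (simp add: const_def mult_single)

lemma single_add_mset: "Poly_Mapping.single (add_mset x m) c = mvar x * Poly_Mapping.single m c"
  by (simp add: mvar_def mult_single)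

lemma const_simps [simp]: "const 0 = 0" "const 1 = 1"
  by (simp_all add: const_def)

lemma const_add: "const (a + b) = const a + const b"
  and const_mult: "const (a * b) = const a * const b"
  and const_diff: "const (a - b) = const a - const b"
  by (simp_all add: const_def single_add single_diff mult_single)

lemma const_uminus: "const (- a) = - const a"
  by (simp add: const_def single_uminus)

lemma const_of_nat: "const (of_nat n) = of_nat n"
  by (simp add: const_def)

text \<open>Induction by linear extension from the terms with exponents in \<open>B\<close>.\<close>

lemma poly_mapping_induct_in [consumes 1, case_names zero single add]:
  assumes "Poly_Mapping.keys p \<subseteq> B"
    and "P 0" and "\<And>m c. m \<in> B \<Longrightarrow> P (Poly_Mapping.single m c)"
    and "\<And>p q. \<lbrakk>Poly_Mapping.keys p \<subseteq> B; Poly_Mapping.keys q \<subseteq> B; P p; P q\<rbrakk> \<Longrightarrow> P (p + q)"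
  shows "P (p :: 'm \<Rightarrow>\<^sub>0 'b::comm_monoid_add)"
  using assms(1)
proof (induction p rule: update_induct)
  case const
  show ?case by fact
next
  case (update p m c)
  have eq: "Poly_Mapping.update m c p = p + Poly_Mapping.single m c"
    using update(1) by (intro poly_mapping_eqI) (auto simp: lookup_update lookup_add lookup_single in_keys_iff when_def)
  have "Poly_Mapping.keys p \<subseteq> B" "m \<in> B"
    using update by (auto simp: keys_update split: if_splits)
  then show ?case
    unfolding eq using update.IH assms(3) by (intro assms(4)) auto
qed

lemma polys_induct [consumes 1, case_names const mvar_mult add]:
  assumes "p \<in> polys X"
    and const: "\<And>c. P (const c)"
    and var: "\<And>x p. \<lbrakk>x \<in> X; p \<in> polys X; P p\<rbrakk> \<Longrightarrow> P (mvar x * p)"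
    and add: "\<And>p q. \<lbrakk>p \<in> polys X; q \<in> polys X; P p; P q\<rbrakk> \<Longrightarrow> P (p + q)"
  shows "P p"
proof -
  have "Poly_Mapping.keys p \<subseteq> {m. set_mset m \<subseteq> X}"
    using assms(1) by (auto simp: polys_iff)
  then show ?thesis
  proof (induction p rule: poly_mapping_induct_in)
    case zero
    show ?case using const[of 0] by simp
  next
    case (single m c)
    then show ?case
    proof (induction m)
      case empty
      then show ?case using const[of c] by (simp add: const_def)
    next
      case (add x m)
      then show ?case
        by (auto simp: single_add_mset intro!: var polys_single)
    qed
  next
    case (add p q)
    then show ?case
      by (intro assms(4)) (auto simp: polys_iff)
  qed
qed

lemma mpoly_eval_single: "mpoly_eval u (Poly_Mapping.single m c) = c * (\<Prod>x\<in>#m. u x)"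
  by (simp add: mpoly_eval_def)

lemma mpoly_eval_simps [simp]:
  "mpoly_eval u 0 = 0" "mpoly_eval u 1 = 1" "mpoly_eval u (const c) = c" "mpoly_eval u (mvar x) = u x"
  by (simp_all add: mpoly_eval_single const_def mvar_def flip: single_one)
     (simp_all add: mpoly_eval_def)

lemma mpoly_eval_add [simp]: "mpoly_eval u (p + q) = mpoly_eval u p + mpoly_eval u q"
  unfolding mpoly_eval_def by (rule setsum_keys_plus_distrib) (simp_all add: distrib_right)

lemma mpoly_eval_uminus [simp]: "mpoly_eval u (- p) = - mpoly_eval u p"
  using mpoly_eval_add[of u p "- p"] by (simp add: eq_neg_iff_add_eq_0 add.commute del: mpoly_eval_add)

lemma mpoly_eval_diff [simp]: "mpoly_eval u (p - q) = mpoly_eval u p - mpoly_eval u q"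
  using mpoly_eval_add[of u p "- q"] by simp

lemma mpoly_eval_mult [simp]: "mpoly_eval u (p * q) = mpoly_eval u p * mpoly_eval u q"
proof -
  have var: "mpoly_eval u (mvar x * q) = u x * mpoly_eval u q" for x q
  proof (induction q rule: poly_mapping_induct_in[OF subset_UNIV, case_names zero single add])
    case (single m c)
    then show ?case
      by (simp add: mpoly_eval_single flip: single_add_mset)
  qed (auto simp: distrib_left)
  have cst: "mpoly_eval u (const c * q) = c * mpoly_eval u q" for c q
  proof (induction q rule: poly_mapping_induct_in[OF subset_UNIV, case_names zero single add])
    case (single m c)
    then show ?case
      by (simp add: mpoly_eval_single const_def mult_single)
  qed (auto simp: distrib_left)
  have "p \<in> polys UNIV"
    by (simp add: polys_iff)
  then show ?thesis
    by (induction p rule: polys_induct) (simp_all add: cst var mult.assoc distrib_right)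
qed

lemma mpoly_eval_cong:
  "p \<in> polys X \<Longrightarrow> (\<And>x. x \<in> X \<Longrightarrow> u x = v x) \<Longrightarrow> mpoly_eval u p = mpoly_eval v p"
  by (induction p rule: polys_induct) auto

text \<open>Sarrus' rule, with the rows and columns as arguments: the identities between minors needed below
  move single rows and columns and let them coincide.\<close>

definition det3 :: "('r \<Rightarrow> 'c \<Rightarrow> 'a::comm_ring_1) \<Rightarrow> 'r \<Rightarrow> 'r \<Rightarrow> 'r \<Rightarrow> 'c \<Rightarrow> 'c \<Rightarrow> 'c \<Rightarrow> 'a" where
  "det3 M r1 r2 r3 c1 c2 c3 =
     M r1 c1 * M r2 c2 * M r3 c3 + M r1 c2 * M r2 c3 * M r3 c1 + M r1 c3 * M r2 c1 * M r3 c2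
     - M r1 c1 * M r2 c3 * M r3 c2 - M r1 c2 * M r2 c1 * M r3 c3 - M r1 c3 * M r2 c2 * M r3 c1"

lemma det_mat2:
  assumes "A \<in> carrier_mat 2 2"
  shows "det A = A $$ (0, 0) * A $$ (1, 1) - A $$ (0, 1) * A $$ (1, 0)"
proof -
  have lt: "{..<2::nat} = {0, 1}"
    by auto
  have "det (mat_delete A 0 j) = mat_delete A 0 j $$ (0, 0)" for j
    using assms by (intro det_single) (auto simp: mat_delete_def)
  then show ?thesis
    using assms by (subst laplace_expansion_row[OF assms, of 0]) (auto simp: lt cofactor_def mat_delete_def)
qed

lemma det_mat3: "det (mat 3 3 (\<lambda>(i, j). M i j)) = det3 M (0::nat) 1 2 (0::nat) 1 2"
proof -
  let ?A = "mat 3 3 (\<lambda>(i, j). M i j)"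
  have A: "?A \<in> carrier_mat 3 3"
    by simp
  have lt: "{..<3::nat} = {0, 1, 2}"
    by auto
  have "mat_delete ?A 0 j \<in> carrier_mat 2 2" for j
    by (simp add: mat_delete_def)
  note minor = det_mat2[OF this]
  have two: "Suc (Suc 0) = 2"
    by simp
  show ?thesis
    by (subst laplace_expansion_row[OF A, of 0], simp)
      (simp add: lt cofactor_def minor, simp add: mat_delete_def det3_def two, simp add: algebra_simps)
qed

lemma minors_3E:
  assumes "p \<in> minors 3 R C M"
  obtains r1 r2 r3 c1 c2 c3 where "p = det3 M r1 r2 r3 c1 c2 c3"
     "{r1, r2, r3} \<subseteq> R" "{c1, c2, c3} \<subseteq> C"
proof -
  obtain r c where p: "p = det (mat 3 3 (\<lambda>(i, j). M (r i) (c j)))"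
    and rc: "r ` {..<3} \<subseteq> R" "c ` {..<3} \<subseteq> C"
    using assms unfolding minors_def by auto
  have "p = det3 M (r 0) (r 1) (r 2) (c 0) (c 1) (c 2)"
    unfolding p det_mat3 by (simp add: det3_def)
  moreover have "{r 0, r 1, r 2} \<subseteq> R" "{c 0, c 1, c 2} \<subseteq> C"
    using rc by auto
  ultimately show ?thesis
    using that by metis
qed

lemma minors_3I:
  assumes "distinct [r1, r2, r3]" "{r1, r2, r3} \<subseteq> R" "distinct [c1, c2, c3]" "{c1, c2, c3} \<subseteq> C"
  shows "det3 M r1 r2 r3 c1 c2 c3 \<in> minors 3 R C M"
proof -
  have lt3: "{..<3::nat} = {0, 1, 2}"
    by auto
  define r where "r = (\<lambda>i::nat. if i = 0 then r1 else if i = 1 then r2 else r3)"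
  define c where "c = (\<lambda>i::nat. if i = 0 then c1 else if i = 1 then c2 else c3)"
  have r: "r 0 = r1" "r 1 = r2" "r 2 = r3" and c: "c 0 = c1" "c 1 = c2" "c 2 = c3"
    by (simp_all add: r_def c_def)
  have "det3 M r1 r2 r3 c1 c2 c3 = det (mat 3 3 (\<lambda>(i, j). M (r i) (c j)))"
    unfolding det_mat3 det3_def r c ..
  moreover have "inj_on r {..<3}" "inj_on c {..<3}"
    unfolding lt3 using assms r c by (auto simp: inj_on_def)
  moreover have "r ` {..<3} \<subseteq> R" "c ` {..<3} \<subseteq> C"
    unfolding lt3 using assms r c by simp_all
  ultimately show ?thesis
    unfolding minors_def by blast
qed

lemma det3_repeated [simp]:
  "det3 M r r s c1 c2 c3 = 0" "det3 M r s r c1 c2 c3 = 0" "det3 M s r r c1 c2 c3 = 0"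
  "det3 M r1 r2 r3 c c d = 0" "det3 M r1 r2 r3 c d c = 0" "det3 M r1 r2 r3 d c c = 0"
  by (simp_all add: det3_def mult_ac)

locale mpoly_ideal =
  fixes X :: "'x set" and I :: "('x, 'k::field_char_0) mpoly set"
  assumes ideal: "ideal I (mpoly_ring X)"
begin

lemma subset_polys: "p \<in> I \<Longrightarrow> p \<in> polys X"
  using ideal by (metis additive_subgroup.a_Hcarr ideal_def)

lemma zero_in: "0 \<in> I"
  using additive_subgroup.zero_closed[OF ideal.axioms(1)[OF ideal]] by simp

lemma add_in: "p \<in> I \<Longrightarrow> q \<in> I \<Longrightarrow> p + q \<in> I"
  using additive_subgroup.a_closed[OF ideal.axioms(1)[OF ideal], of p q] by simp

lemma mult_in: "p \<in> polys X \<Longrightarrow> q \<in> I \<Longrightarrow> p * q \<in> I"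
  using ideal.I_l_closed[OF ideal, of q p] by simp

lemma const_mult_in: "q \<in> I \<Longrightarrow> const c * q \<in> I"
  by (rule mult_in[OF polys_const])

lemma uminus_in: "p \<in> I \<Longrightarrow> - p \<in> I"
  using const_mult_in[of p "- 1"] by (simp add: const_uminus)

lemma diff_in: "p \<in> I \<Longrightarrow> q \<in> I \<Longrightarrow> p - q \<in> I"
  using add_in[of p "- q"] uminus_in[of q] by simp

lemma const_mult_in_iff: "c \<noteq> 0 \<Longrightarrow> const c * p \<in> I \<longleftrightarrow> p \<in> I"
  using const_mult_in[of "const c * p" "inverse c"] const_mult_in[of p c]
  by (auto simp: const_mult[symmetric] mult.assoc[symmetric])

lemma of_nat_mult_in_iff: "n \<noteq> 0 \<Longrightarrow> of_nat n * p \<in> I \<longleftrightarrow> p \<in> I"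
  using const_mult_in_iff[of "of_nat n" p] by (simp add: const_of_nat)

lemma add_in_iff: "p \<in> I \<Longrightarrow> p + q \<in> I \<longleftrightarrow> q \<in> I"
  using add_in[of p q] diff_in[of "p + q" p] by auto

end

section \<open>Alternating trilinear forms\<close>

text \<open>The products of \<open>k\<close> elements of \<open>V\<close>; with linear forms for \<open>V\<close> they span the forms of degree \<open>k\<close>.\<close>

fun prods :: "'a::comm_monoid_mult set \<Rightarrow> nat \<Rightarrow> 'a set" where
  "prods V 0 = {1}"
| "prods V (Suc k) = {l * c | l c. l \<in> V \<and> c \<in> prods V k}"

lemma prods_SucI: "l \<in> V \<Longrightarrow> c \<in> prods V k \<Longrightarrow> l * c \<in> prods V (Suc k)"
  by auto

lemma prods_SucE:
  assumes "x \<in> prods V (Suc k)"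
  obtains l c where "x = l * c" "l \<in> V" "c \<in> prods V k"
  using assms by auto

declare prods.simps(2) [simp del]

text \<open>Think of \<open>f\<close> as a function of \<open>x \<and> y \<and> z\<close>, the alternating polynomial \<open>det (x\<^sub>i(P\<^sub>j))\<close> in three points.
  Multiplying the alternating polynomial of \<open>q1, q2, q3\<close> by the symmetric polynomial
  \<open>\<Sum>\<^sub>\<pi> p\<^sub>1(P\<^bsub>\<pi> 1\<^esub>) p\<^sub>2(P\<^bsub>\<pi> 2\<^esub>) p\<^sub>3(P\<^bsub>\<pi> 3\<^esub>)\<close> gives the sum of alternating polynomials expanded here.\<close>

definition sym3 :: "('a::times \<Rightarrow> 'a \<Rightarrow> 'a \<Rightarrow> 'b::ab_group_add) \<Rightarrow> 'a \<Rightarrow> 'a \<Rightarrow> 'a \<Rightarrow> 'a \<Rightarrow> 'a \<Rightarrow> 'a \<Rightarrow> 'b" where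
  "sym3 f p1 p2 p3 q1 q2 q3 =
     f (p1 * q1) (p2 * q2) (p3 * q3) + f (p1 * q1) (p3 * q2) (p2 * q3) +
     f (p2 * q1) (p1 * q2) (p3 * q3) + f (p2 * q1) (p3 * q2) (p1 * q3) +
     f (p3 * q1) (p1 * q2) (p2 * q3) + f (p3 * q1) (p2 * q2) (p1 * q3)"

text \<open>As the diagonal values at \<open>u\<close> and \<open>v\<close> vanish, those at \<open>u + v\<close> and \<open>u - v\<close> add up to
  \<open>12 s u u v v\<close>. The two pairs of equal arguments are then polarized one after the other.\<close>

lemma quartic_polarization:
  fixes s :: "'a::ab_group_add \<Rightarrow> 'a \<Rightarrow> 'a \<Rightarrow> 'a \<Rightarrow> 'k::field_char_0"
  assumes V: "\<And>u v. u \<in> V \<Longrightarrow> v \<in> V \<Longrightarrow> u + v \<in> V \<and> u - v \<in> V"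
    and add: "\<And>a a' b c d. s (a + a') b c d = s a b c d + s a' b c d"
    and s12: "\<And>a b c d. a \<in> V \<Longrightarrow> b \<in> V \<Longrightarrow> c \<in> V \<Longrightarrow> d \<in> V \<Longrightarrow> s a b c d = s b a c d"
    and s13: "\<And>a b c d. a \<in> V \<Longrightarrow> b \<in> V \<Longrightarrow> c \<in> V \<Longrightarrow> d \<in> V \<Longrightarrow> s a b c d = s c b a d"
    and s34: "\<And>a b c d. a \<in> V \<Longrightarrow> b \<in> V \<Longrightarrow> c \<in> V \<Longrightarrow> d \<in> V \<Longrightarrow> s a b c d = s a b d c"
    and diag: "\<And>a. a \<in> V \<Longrightarrow> s a a a a = 0"
    and in_V: "a \<in> V" "b \<in> V" "c \<in> V" "d \<in> V"
  shows "s a b c d = 0"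
proof -
  have addV: "u + v \<in> V" and diffV: "u - v \<in> V" if "u \<in> V" "v \<in> V" for u v
    using V that by auto
  have dif: "s (a - a') b c d = s a b c d - s a' b c d" for a a' b c d
    using add[of "a - a'" a' b c d] by simp
  have add2: "s b (a + a') c d = s b a c d + s b a' c d"
    if "a \<in> V" "a' \<in> V" "b \<in> V" "c \<in> V" "d \<in> V" for a a' b c d
    using that by (simp add: s12[of b] addV add)
  have dif2: "s b (a - a') c d = s b a c d - s b a' c d"
    if "a \<in> V" "a' \<in> V" "b \<in> V" "c \<in> V" "d \<in> V" for a a' b c d
    using that by (simp add: s12[of b] diffV dif)
  have add3: "s b c (a + a') d = s b c a d + s b c a' d"
    if "a \<in> V" "a' \<in> V" "b \<in> V" "c \<in> V" "d \<in> V" for a a' b c d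
    using that by (simp add: s13[of b] addV add)
  have dif3: "s b c (a - a') d = s b c a d - s b c a' d"
    if "a \<in> V" "a' \<in> V" "b \<in> V" "c \<in> V" "d \<in> V" for a a' b c d
    using that by (simp add: s13[of b] diffV dif)
  have add4: "s b c d (a + a') = s b c d a + s b c d a'"
    if "a \<in> V" "a' \<in> V" "b \<in> V" "c \<in> V" "d \<in> V" for a a' b c d
    using that by (simp add: s34[of b c d] addV add3)
  have dif4: "s b c d (a - a') = s b c d a - s b c d a'"
    if "a \<in> V" "a' \<in> V" "b \<in> V" "c \<in> V" "d \<in> V" for a a' b c d
    using that by (simp add: s34[of b c d] diffV dif3)
  note adds = add add2 add3 add4 dif dif2 dif3 dif4
  have uuvv: "s u u v v = 0" if uv: "u \<in> V" "v \<in> V" for u v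
  proof -
    have e: "s u v u v = s u u v v" "s u v v u = s u u v v" "s v u u v = s u u v v"
      "s v u v u = s u u v v" "s v v u u = s u u v v"
      using uv s12 s13 s34 by metis+
    have "s (u + v) (u + v) (u + v) (u + v) + s (u - v) (u - v) (u - v) (u - v)
        = 2 * s u u u u + 12 * s u u v v + 2 * s v v v v"
      using uv by (simp add: adds addV diffV e)
    then show ?thesis
      using diag uv addV diffV by simp
  qed
  have abcc: "s a b c c = 0" if abc: "a \<in> V" "b \<in> V" "c \<in> V" for a b c
  proof -
    have "s (a + b) (a + b) c c = s a a c c + 2 * s a b c c + s b b c c"
      using abc s12[of b a c c] by (simp add: adds addV)
    then show ?thesis
      using uuvv abc addV by simp
  qed
  have "s a b (c + d) (c + d) = s a b c c + 2 * s a b c d + s a b d d"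
    using in_V s34[of a b d c] by (simp add: adds addV)
  then show ?thesis
    using abcc in_V addV by simp
qed

locale alternating_form =
  fixes f :: "'a::comm_ring_1 \<Rightarrow> 'a \<Rightarrow> 'a \<Rightarrow> 'k::field_char_0"
  assumes add1: "f (x + x') y z = f x y z + f x' y z"
    and swap12: "f y x z = - f x y z"
    and swap23: "f x z y = - f x y z"
begin

lemma add2: "f y (x + x') z = f y x z + f y x' z"
  using swap12 add1 by (metis minus_add_distrib)

lemma add3: "f y z (x + x') = f y z x + f y z x'"
  using swap23 add2 by (metis minus_add_distrib)

lemma diff1: "f (x - x') y z = f x y z - f x' y z"
  using add1[of "x - x'" x' y z] by simp

lemma diff2: "f y (x - x') z = f y x z - f y x' z"
  using add2[of y "x - x'" x' z] by simp

lemma diff3: "f y z (x - x') = f y z x - f y z x'"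
  using add3[of y z "x - x'" x'] by simp

lemmas additive = add1 add2 add3 diff1 diff2 diff3

text \<open>The alternating polynomials in three points of degree \<open>k = j + 3\<close> in each point are spanned by the
  products of symmetric ones of degree one with alternating ones of degree \<open>k - 1\<close>. In dual terms, a
  form that vanishes on these products is zero. It vanishes first on triples with a common linear
  factor, then on triples in which one member is divisible by \<open>l\<^sup>2\<close> and another by \<open>l\<close>. After
  polarization the latter says that exchanging a linear factor of \<open>x\<close> with one of \<open>y\<close> multiplies the form by
  \<open>- 1 / 2\<close>. Exchanging the same two factors back shows that the form equals a quarter of itself.\<close>

lemma vanishes_if_linear_multiples_vanish:
  assumes V: "\<And>u v. u \<in> V \<Longrightarrow> v \<in> V \<Longrightarrow> u + v \<in> V \<and> u - v \<in> V"
    and rel: "\<And>l1 l2 l3 c1 c2 c3. \<lbrakk>l1 \<in> V; l2 \<in> V; l3 \<in> V;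
      c1 \<in> prods V (Suc (Suc j)); c2 \<in> prods V (Suc (Suc j)); c3 \<in> prods V (Suc (Suc j))\<rbrakk>
      \<Longrightarrow> sym3 f l1 l2 l3 c1 c2 c3 = 0"
    and xyz: "x \<in> prods V (Suc (Suc (Suc j)))" "y \<in> prods V (Suc (Suc (Suc j)))"
      "z \<in> prods V (Suc (Suc (Suc j)))"
  shows "f x y z = 0"
proof -
  let ?P = "prods V"
  have common: "f (l * c1) (l * c2) (l * c3) = 0"
    if "l \<in> V" "c1 \<in> ?P (Suc (Suc j))" "c2 \<in> ?P (Suc (Suc j))" "c3 \<in> ?P (Suc (Suc j))" for l c1 c2 c3
    using rel[of l l l c1 c2 c3] that by (simp add: sym3_def)
  \<comment> \<open>The relation for \<open>l, l, m\<close> with \<open>l\<close> dividing the third form: the summand with common factor \<open>l\<close> drops out.\<close>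
  have square: "f (l * c1) (m * c2) (l * (l * e)) = f (l * c2) (m * c1) (l * (l * e))"
    if "l \<in> V" "m \<in> V" "c1 \<in> ?P (Suc (Suc j))" "c2 \<in> ?P (Suc (Suc j))" "e \<in> ?P (Suc j)" for l m c1 c2 e
  proof -
    have "f (l * c1) (l * c2) (m * (l * e)) = 0"
      using common[of l c1 c2 "m * e"] prods_SucI[of m V e "Suc j"] that
      by (simp add: mult.left_commute)
    then have "2 * f (l * c1) (m * c2) (l * (l * e)) + 2 * f (m * c1) (l * c2) (l * (l * e)) = 0"
      using rel[of l l m c1 c2 "l * e"] prods_SucI[of l V e "Suc j"] that
      by (simp add: sym3_def add_ac)
    then have "2 * (f (l * c1) (m * c2) (l * (l * e)) + f (m * c1) (l * c2) (l * (l * e))) = 0"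
      by (simp only: distrib_left)
    then have "f (l * c1) (m * c2) (l * (l * e)) + f (m * c1) (l * c2) (l * (l * e)) = 0"
      by (metis mult_eq_0_iff zero_neq_numeral)
    then show ?thesis
      by (simp add: swap12[of "l * c2" "m * c1"] eq_neg_iff_add_eq_0)
  qed
  \<comment> \<open>The case \<open>c2 = l h\<close> of the preceding relation, one side of which has the common factor \<open>l\<close>.\<close>
  have squares: "f g (l * (l * h)) (l * (l * e)) = 0"
    if "l \<in> V" "g \<in> ?P (Suc (Suc (Suc j)))" "h \<in> ?P (Suc j)" "e \<in> ?P (Suc j)" for l g h e
  proof -
    obtain m c where g: "g = m * c" "m \<in> V" "c \<in> ?P (Suc (Suc j))"
      using \<open>g \<in> ?P (Suc (Suc (Suc j)))\<close> by (rule prods_SucE)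
    have "f (l * c) (m * (l * h)) (l * (l * e)) = 0"
      using common[of l c "m * h" "l * e"] that prods_SucI[of m V h "Suc j"] prods_SucI[of l V e "Suc j"] g
      by (simp add: mult.left_commute)
    then have "f (l * (l * h)) (m * c) (l * (l * e)) = 0"
      using square[of l m c "l * h" e] that g prods_SucI[of l V h "Suc j"] by simp
    then show ?thesis
      using g by (simp add: swap12[of "l * (l * h)"])
  qed
  \<comment> \<open>By \<open>square\<close> applied twice, the value depends only on the product of the first two forms.\<close>
  have exchange: "f (l * (n * x)) (m * (m' * y)) (l * (l * e)) = f (l * (m * x)) (n * (m' * y)) (l * (l * e))"
    if "l \<in> V" "n \<in> V" "m \<in> V" "m' \<in> V" "x \<in> ?P (Suc j)" "y \<in> ?P (Suc j)" "e \<in> ?P (Suc j)"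
    for l n m m' x y e
  proof -
    have "f (l * (n * x)) (m * (m' * y)) (l * (l * e)) = f (l * (m' * y)) (m * (n * x)) (l * (l * e))"
      using that prods_SucI by (intro square) blast+
    also have "\<dots> = f (l * (m' * y)) (n * (m * x)) (l * (l * e))"
      by (simp add: mult.left_commute)
    also have "\<dots> = f (l * (m * x)) (n * (m' * y)) (l * (l * e))"
      using that prods_SucI by (intro square) blast+
    finally show ?thesis .
  qed
  \<comment> \<open>Hence the value is symmetric in \<open>m1, m2, m3, m4\<close>, and it vanishes when these agree, as then
    two of the forms are divisible by the same square.\<close>
  have three: "f (l * (m1 * (m2 * p))) (m3 * (m4 * q)) (l * (l * e)) = 0"
    if "l \<in> V" "e \<in> ?P (Suc j)" "p \<in> ?P j" "q \<in> ?P (Suc j)" "m1 \<in> V" "m2 \<in> V" "m3 \<in> V" "m4 \<in> V"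
    for l e p q m1 m2 m3 m4
  proof -
    define s where "s = (\<lambda>m1 m2 m3 m4. f (l * (m1 * (m2 * p))) (m3 * (m4 * q)) (l * (l * e)))"
    have "s m1 m2 m3 m4 = 0"
    proof (rule quartic_polarization[where V = V and s = s])
      fix a b c d assume V: "a \<in> V" "b \<in> V" "c \<in> V" "d \<in> V"
      show "s a b c d = s b a c d" "s a b c d = s a b d c"
        by (simp_all add: s_def mult.left_commute)
      show "s a b c d = s c b a d"
        unfolding s_def using V that prods_SucI by (intro exchange) blast+
    next
      fix a assume "a \<in> V"
      then have "f (l * (l * e)) (a * (a * (l * p))) (a * (a * q)) = 0"
        using that prods_SucI[of _ V] by (intro squares) blast+
      then show "s a a a a = 0"
        unfolding s_def using swap12 swap23
        by (metis (no_types, lifting) mult.left_commute neg_equal_0_iff_equal)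
    qed (use V that in \<open>auto simp: s_def distrib_left distrib_right add1\<close>)
    then show ?thesis by (simp add: s_def)
  qed
  have cube: "f (l * (l * e)) (l * p) q = 0"
    if lpq: "l \<in> V" "e \<in> ?P (Suc j)" "p \<in> ?P (Suc (Suc j))" "q \<in> ?P (Suc (Suc (Suc j)))" for l e p q
  proof -
    obtain m1 m2 p' where p: "p = m1 * (m2 * p')" "m1 \<in> V" "m2 \<in> V" "p' \<in> ?P j"
      using lpq(3) by (metis prods_SucE)
    obtain m3 m4 q' where q: "q = m3 * (m4 * q')" "m3 \<in> V" "m4 \<in> V" "q' \<in> ?P (Suc j)"
      using lpq(4) by (metis prods_SucE)
    have "f (l * p) q (l * (l * e)) = 0"
      unfolding p(1) q(1) using that p q by (intro three)
    then show ?thesis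
      using swap12 swap23 by (metis neg_equal_0_iff_equal)
  qed
  \<comment> \<open>The full polarization of \<open>cube\<close>, a cubic in \<open>l\<close>, for a fixed third form \<open>z\<close>.\<close>
  have polarized: "f (u * (u' * e)) (v * p) z + f (u * (v * e)) (u' * p) z + f (u' * (v * e)) (u * p) z = 0"
    if H: "u \<in> V" "u' \<in> V" "v \<in> V" "e \<in> ?P (Suc j)" "p \<in> ?P (Suc (Suc j))" for u u' v e p
  proof -
    define c where "c = (\<lambda>a b d. f (a * (b * e)) (d * p) z)"
    have c_add: "c (a + a') b d = c a b d + c a' b d" "c b (a + a') d = c b a d + c b a' d"
       "c b d (a + a') = c b d a + c b d a'" "c (a - a') b d = c a b d - c a' b d"
       "c b (a - a') d = c b a d - c b a' d" "c b d (a - a') = c b d a - c b d a'" for a a' b d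
      by (simp_all add: c_def distrib_left distrib_right left_diff_distrib right_diff_distrib additive)
    have c_comm: "c a b d = c b a d" for a b d
      by (simp add: c_def mult.left_commute)
    have c0: "c l l l = 0" if "l \<in> V" for l
      unfolding c_def using that H xyz(3) by (intro cube)
    have c1: "c a a b + 2 * c a b a = 0" if ab: "a \<in> V" "b \<in> V" for a b
    proof -
      have "c (a + b) (a + b) (a + b) - c (a - b) (a - b) (a - b) - 2 * c b b b
          = 2 * (c a a b + 2 * c a b a)"
        using c_comm[of b a] by (simp add: c_add)
      moreover have "c (a + b) (a + b) (a + b) = 0" "c (a - b) (a - b) (a - b) = 0" "c b b b = 0"
        using c0 V ab by simp_all
      ultimately have "2 * (c a a b + 2 * c a b a) = 0"
        by simp
      then show ?thesis
        by (metis mult_eq_0_iff zero_neq_numeral)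
    qed
    have "(c (u + u') (u + u') v + 2 * c (u + u') v (u + u')) - (c u u v + 2 * c u v u)
        - (c u' u' v + 2 * c u' v u') = 2 * (c u u' v + c u v u' + c u' v u)"
      using c_comm[of u' u] by (simp add: c_add)
    then have "2 * (c u u' v + c u v u' + c u' v u) = 0"
      using c1[OF H(1) H(3)] c1[OF H(2) H(3)] c1[of "u + u'" v] V[OF H(1) H(2)] H by simp
    then have "c u u' v + c u v u' + c u' v u = 0"
      by (metis mult_eq_0_iff zero_neq_numeral)
    then show ?thesis
      by (simp add: c_def)
  qed
  \<comment> \<open>Here \<open>u * c\<close> has at least three linear factors. Any two of the three values obtained by
    exchanging one of them with \<open>v\<close> add up to \<open>- f (u * c) (v * s) z\<close>, so all three agree.\<close>
  have swap: "2 * f (v * c) (u * s) z = - f (u * c) (v * s) z"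
    if H: "u \<in> V" "v \<in> V" "c \<in> ?P (Suc (Suc j))" "s \<in> ?P (Suc (Suc j))" for u v c s
  proof -
    obtain u2 u3 r where c: "c = u2 * (u3 * r)" "u2 \<in> V" "u3 \<in> V" "r \<in> ?P j"
      using H(3) by (metis prods_SucE)
    define X where "X a b d = f (v * (a * (b * r))) (d * s) z" for a b d
    have X: "f (u * c) (v * s) z + X u u2 u3 + X u u3 u2 = 0"
      "f (u * c) (v * s) z + X u u2 u3 + X u2 u3 u = 0"
      "f (u * c) (v * s) z + X u u3 u2 + X u2 u3 u = 0"
      using polarized[OF c(2,3) H(2) prods_SucI[OF H(1) c(4)] H(4)]
        polarized[OF H(1) c(3) H(2) prods_SucI[OF c(2,4)] H(4)]
        polarized[OF H(1) c(2) H(2) prods_SucI[OF c(3,4)] H(4)]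
      by (simp_all only: X_def c(1) mult_ac add_ac)
    have "2 * X u2 u3 u + f (u * c) (v * s) z =
        (f (u * c) (v * s) z + X u u2 u3 + X u2 u3 u) + (f (u * c) (v * s) z + X u u3 u2 + X u2 u3 u)
        - (f (u * c) (v * s) z + X u u2 u3 + X u u3 u2)"
      by simp
    then have "2 * X u2 u3 u + f (u * c) (v * s) z = 0"
      by (simp only: X) simp
    then show ?thesis
      by (simp add: X_def c eq_neg_iff_add_eq_0)
  qed
  obtain u c where x: "x = u * c" "u \<in> V" "c \<in> ?P (Suc (Suc j))"
    using xyz(1) by (rule prods_SucE)
  obtain v s where y: "y = v * s" "v \<in> V" "s \<in> ?P (Suc (Suc j))"
    using xyz(2) by (rule prods_SucE)
  have "4 * f (u * c) (v * s) z = 2 * (2 * f (u * c) (v * s) z)"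
    by simp
  also have "2 * f (u * c) (v * s) z = - f (v * c) (u * s) z"
    using swap x y by blast
  also have "2 * - f (v * c) (u * s) z = - (2 * f (v * c) (u * s) z)"
    by simp
  also have "2 * f (v * c) (u * s) z = - f (u * c) (v * s) z"
    using swap x y by blast
  finally have "4 * f (u * c) (v * s) z = f (u * c) (v * s) z"
    by simp
  then have "3 * f (u * c) (v * s) z = 0"
    by simp
  then show ?thesis
    by (simp add: x y)
qed

end

text \<open>Moving one linear factor at a time from the symmetric to the alternating polynomial
  reduces a symmetric factor of degree \<open>a\<close> to symmetric factors of degree one. The alternating factors
  have degree at least \<open>b \<ge> 2\<close> at every step.\<close>

lemma alternating_form_vanishes:
  fixes f :: "'a::comm_ring_1 \<Rightarrow> 'a \<Rightarrow> 'a \<Rightarrow> 'k::field_char_0"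
  assumes f: "alternating_form f"
    and V: "\<And>u v. u \<in> V \<Longrightarrow> v \<in> V \<Longrightarrow> u + v \<in> V \<and> u - v \<in> V"
    and b: "b \<ge> 2"
    and rel: "\<And>p1 p2 p3 q1 q2 q3. \<lbrakk>p1 \<in> prods V a; p2 \<in> prods V a; p3 \<in> prods V a;
      q1 \<in> prods V b; q2 \<in> prods V b; q3 \<in> prods V b\<rbrakk> \<Longrightarrow> sym3 f p1 p2 p3 q1 q2 q3 = 0"
    and xyz: "x \<in> prods V (a + b)" "y \<in> prods V (a + b)" "z \<in> prods V (a + b)"
  shows "f x y z = 0"
  using b rel xyz
proof (induction a arbitrary: b)
  case 0
  then show ?case
    using "0.prems"(2)[of 1 1 1 x y z] by (simp add: sym3_def)
next
  case (Suc a)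
  interpret alternating_form f by fact
  obtain j where j: "b = Suc (Suc j)"
    using Suc.prems(1) by (metis add_2_eq_Suc le_Suc_ex)
  show ?case
  proof (rule Suc.IH[of "Suc b"])
    fix p1 p2 p3 q1 q2 q3
    assume p: "p1 \<in> prods V a" "p2 \<in> prods V a" "p3 \<in> prods V a"
      and q: "q1 \<in> prods V (Suc b)" "q2 \<in> prods V (Suc b)" "q3 \<in> prods V (Suc b)"
    interpret f': alternating_form "sym3 f p1 p2 p3"
    proof
      show "sym3 f p1 p2 p3 (x + x') y z = sym3 f p1 p2 p3 x y z + sym3 f p1 p2 p3 x' y z" for x x' y z
        by (simp add: sym3_def distrib_left additive)
      show "sym3 f p1 p2 p3 y x z = - sym3 f p1 p2 p3 x y z" for x y z
        by (simp add: sym3_def swap12[of "_ * x" "_ * y"])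
      show "sym3 f p1 p2 p3 x z y = - sym3 f p1 p2 p3 x y z" for x y z
        by (simp add: sym3_def swap23[of _ "_ * y" "_ * z"])
    qed
    show "sym3 f p1 p2 p3 q1 q2 q3 = 0"
    proof (rule f'.vanishes_if_linear_multiples_vanish[OF V])
      fix l1 l2 l3 c1 c2 c3
      assume l: "l1 \<in> V" "l2 \<in> V" "l3 \<in> V"
        and c: "c1 \<in> prods V (Suc (Suc j))" "c2 \<in> prods V (Suc (Suc j))" "c3 \<in> prods V (Suc (Suc j))"
      have pl: "p * l \<in> prods V (Suc a)" if "p \<in> prods V a" "l \<in> V" for p l
        using that prods_SucI[of l V p a] by (simp add: mult.commute)
      note R = Suc.prems(2)[unfolded j, OF pl pl pl c]
      have "sym3 (sym3 f p1 p2 p3) l1 l2 l3 c1 c2 c3 =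
          sym3 f (p1 * l1) (p2 * l2) (p3 * l3) c1 c2 c3 + sym3 f (p1 * l1) (p3 * l2) (p2 * l3) c1 c2 c3 +
          sym3 f (p2 * l1) (p1 * l2) (p3 * l3) c1 c2 c3 + sym3 f (p2 * l1) (p3 * l2) (p1 * l3) c1 c2 c3 +
          sym3 f (p3 * l1) (p1 * l2) (p2 * l3) c1 c2 c3 + sym3 f (p3 * l1) (p2 * l2) (p1 * l3) c1 c2 c3"
        by (simp add: sym3_def mult.assoc)
      also have "\<dots> = 0"
        using R p l by simp
      finally show "sym3 (sym3 f p1 p2 p3) l1 l2 l3 c1 c2 c3 = 0" .
    qed (use q j in auto)
  qed (use Suc.prems in auto)
qed

section \<open>Derivations and Capelli's identity\<close>

definition derivation :: "('x \<Rightarrow> ('x, 'k::comm_ring_1) mpoly) \<Rightarrow> ('x, 'k) mpoly \<Rightarrow> ('x, 'k) mpoly" where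
  "derivation A p = (\<Sum>m\<in>Poly_Mapping.keys p.
     const (Poly_Mapping.lookup p m) * (\<Sum>x\<in>#m. A x * Poly_Mapping.single (m - {#x#}) 1))"

lemma derivation_0 [simp]: "derivation A 0 = 0"
  by (simp add: derivation_def)

lemma derivation_add [simp]: "derivation A (p + q) = derivation A p + derivation A q"
  unfolding derivation_def
  by (rule setsum_keys_plus_distrib, simp, simp only: const_add distrib_right)

lemma derivation_single:
  "derivation A (Poly_Mapping.single m c) = const c * (\<Sum>x\<in>#m. A x * Poly_Mapping.single (m - {#x#}) 1)"
  by (simp add: derivation_def)

lemma derivation_const [simp]: "derivation A (const c) = 0"
  by (simp add: const_def derivation_single)

lemma derivation_mvar [simp]: "derivation A (mvar x) = A x"
  by (simp add: mvar_def derivation_single)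

lemma derivation_uminus [simp]: "derivation A (- p) = - derivation A p"
  using derivation_add[of A p "- p"] by (simp add: eq_neg_iff_add_eq_0 add.commute del: derivation_add)

lemma derivation_diff [simp]: "derivation A (p - q) = derivation A p - derivation A q"
  using derivation_add[of A p "- q"] by simp

lemma derivation_mvar_mult: "derivation A (mvar x * p) = A x * p + mvar x * derivation A p"
proof (induction p rule: poly_mapping_induct_in[OF subset_UNIV, case_names zero single add])
  case (single m c)
  define S where "S = (\<Sum>y\<in>#m. A y * Poly_Mapping.single (m - {#y#}) 1)"
  have "(\<Sum>y\<in>#m. A y * Poly_Mapping.single (add_mset x m - {#y#}) 1)
      = (\<Sum>y\<in>#m. mvar x * (A y * Poly_Mapping.single (m - {#y#}) 1))"
    by (intro arg_cong[of _ _ sum_mset] image_mset_cong)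
       (auto simp: mult.left_commute simp flip: single_add_mset)
  then have "(\<Sum>y\<in>#m. A y * Poly_Mapping.single (add_mset x m - {#y#}) 1) = mvar x * S"
    by (simp add: sum_mset_distrib_left S_def image_mset.compositionality comp_def)
  then have "derivation A (Poly_Mapping.single (add_mset x m) c)
      = const c * (A x * Poly_Mapping.single m 1 + mvar x * S)"
    by (simp add: derivation_single)
  also have "\<dots> = A x * Poly_Mapping.single m c + mvar x * (const c * S)"
    unfolding single_eq_const_mult[of m c] by (simp only: distrib_left mult_ac)
  finally show ?case
    unfolding single_add_mset derivation_single S_def .
qed (simp_all add: distrib_left add_ac)

lemma derivation_mult: "derivation A (p * q) = derivation A p * q + p * derivation A q"
proof -
  have cst: "derivation A (const c * q) = const c * derivation A q" for c q
  proof (induction q rule: poly_mapping_induct_in[OF subset_UNIV, case_names zero single add])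
    case (single m c')
    have "const c * Poly_Mapping.single m c' = Poly_Mapping.single m (c * c')"
      by (simp add: const_def mult_single)
    then show ?case
      by (simp only: derivation_single const_mult mult.assoc)
  qed (simp_all add: distrib_left)
  have "p \<in> polys UNIV"
    by (simp add: polys_iff)
  then show ?thesis
    by (induction p rule: polys_induct)
      (simp_all only: cst derivation_mvar_mult mult.assoc distrib_left distrib_right derivation_add
        derivation_const mult_zero_left add_0_left add_ac)
qed

lemma derivation_of_nat_mult [simp]: "derivation A (of_nat n * p) = of_nat n * derivation A p"
  by (simp add: derivation_mult flip: const_of_nat)

lemma derivation_eq_on:
  assumes "p \<in> polys X" "F 0 = 0"
    and "\<And>p q. F (p + q) = F p + F q" "\<And>c. F (const c) = 0"
    and "\<And>x p. x \<in> X \<Longrightarrow> p \<in> polys X \<Longrightarrow> F (mvar x * p) = A x * p + mvar x * F p"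
  shows "derivation A p = F p"
  using assms(1) by (induction p rule: polys_induct) (simp_all add: assms derivation_mvar_mult)

lemma derivation_linear:
  "derivation (\<lambda>x. A x + B x) p = derivation A p + derivation B p"
  "derivation (\<lambda>x. A x - B x) p = derivation A p - derivation B p"
  "derivation (\<lambda>x. - A x) p = - derivation A p"
  "derivation (\<lambda>x. 0) p = 0"
proof -
  have p: "p \<in> polys UNIV"
    by (simp add: polys_iff)
  show "derivation (\<lambda>x. A x + B x) p = derivation A p + derivation B p"
    by (rule derivation_eq_on[OF p]) (simp_all add: derivation_mult algebra_simps)
  show "derivation (\<lambda>x. A x - B x) p = derivation A p - derivation B p"
    by (rule derivation_eq_on[OF p]) (simp_all add: derivation_mult algebra_simps)
  show "derivation (\<lambda>x. - A x) p = - derivation A p"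
    by (rule derivation_eq_on[OF p]) (simp_all add: derivation_mult algebra_simps)
  show "derivation (\<lambda>x. 0) p = 0"
    by (rule derivation_eq_on[OF p]) simp_all
qed

lemma derivation_polys:
  "p \<in> polys X \<Longrightarrow> (\<And>x. x \<in> X \<Longrightarrow> A x \<in> polys X) \<Longrightarrow> derivation A p \<in> polys X"
  by (induction p rule: polys_induct) (auto simp: derivation_mvar_mult intro: polys_intros)

text \<open>Normally ordered products of derivations: the part of order two (respectively three) of the composed
  differential operator, in which the derivatives act on \<open>p\<close> alone and not on the coefficients \<open>B\<close>, \<open>C\<close>.\<close>

definition normal2 :: "('x \<Rightarrow> ('x, 'k::comm_ring_1) mpoly) \<Rightarrow> ('x \<Rightarrow> ('x, 'k) mpoly) \<Rightarrow> ('x, 'k) mpoly \<Rightarrow> ('x, 'k) mpoly" where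
  "normal2 A B p = derivation A (derivation B p) - derivation (\<lambda>x. derivation A (B x)) p"

definition normal3 :: "('x \<Rightarrow> ('x, 'k::comm_ring_1) mpoly) \<Rightarrow> ('x \<Rightarrow> ('x, 'k) mpoly) \<Rightarrow> ('x \<Rightarrow> ('x, 'k) mpoly) \<Rightarrow> ('x, 'k) mpoly \<Rightarrow> ('x, 'k) mpoly" where
  "normal3 A B C p = derivation A (normal2 B C p)
     - normal2 (\<lambda>x. derivation A (B x)) C p - normal2 B (\<lambda>x. derivation A (C x)) p"

lemma normal2_simps [simp]: "normal2 A B (const c) = 0" "normal2 A B (p + q) = normal2 A B p + normal2 A B q"
  by (simp_all add: normal2_def)

lemma normal3_simps [simp]: "normal3 A B C (const c) = 0" "normal3 A B C (p + q) = normal3 A B C p + normal3 A B C q"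
  by (simp_all add: normal3_def)

lemma normal2_mvar_mult:
  "normal2 A B (mvar x * p) = mvar x * normal2 A B p + (A x * derivation B p + B x * derivation A p)"
  by (simp add: normal2_def derivation_mult algebra_simps)

lemma normal3_mvar_mult:
  "normal3 A B C (mvar x * p) = mvar x * normal3 A B C p +
     (A x * normal2 B C p + B x * normal2 A C p + C x * normal2 A B p)"
  by (simp add: normal3_def normal2_mvar_mult derivation_mult)
     (simp add: normal2_def algebra_simps)

definition alt3 :: "('i \<Rightarrow> 'i \<Rightarrow> 'i \<Rightarrow> 'a::ab_group_add) \<Rightarrow> 'i \<Rightarrow> 'i \<Rightarrow> 'i \<Rightarrow> 'a" where
  "alt3 g p q r = g p q r + g q r p + g r p q - g p r q - g q p r - g r q p"

lemma alt3_add: "alt3 (\<lambda>i j k. g i j k + h i j k) p q r = alt3 g p q r + alt3 h p q r"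
  and alt3_diff: "alt3 (\<lambda>i j k. g i j k - h i j k) p q r = alt3 g p q r - alt3 h p q r"
  and alt3_0 [simp]: "alt3 (\<lambda>i j k. 0) p q r = 0"
  by (simp_all add: alt3_def algebra_simps)

lemma alt3_mult: "alt3 (\<lambda>i j k. u * f i j k) p q r = u * alt3 f p q r"
  for u :: "'a::comm_ring_1"
  by (simp add: alt3_def algebra_simps)

text \<open>A normally ordered operator of order three is determined by its leading coefficients
  \<open>A x * B y * C z\<close>. The product rule strips off one variable at a time, and after three rounds only
  these coefficients are left.\<close>

lemma (in mpoly_ideal) alt3_normal3_in:
  fixes A B C :: "'i \<Rightarrow> 'x \<Rightarrow> ('x, 'k) mpoly"
  assumes base: "\<And>x y z. \<lbrakk>x \<in> X; y \<in> X; z \<in> X\<rbrakk> \<Longrightarrow> alt3 (\<lambda>i j k. A i x * B j y * C k z) a b c \<in> I"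
    and f: "f \<in> polys X"
  shows "alt3 (\<lambda>i j k. normal3 (A i) (B j) (C k) f) a b c \<in> I"
proof -
  define U3 where "U3 x y z = alt3 (\<lambda>i j k. A i x * B j y * C k z) a b c" for x y z
  define U2 where "U2 x y f = alt3 (\<lambda>i j k. A i x * B j y * derivation (C k) f + A i x * C k y * derivation (B j) f
     + B j x * A i y * derivation (C k) f + B j x * C k y * derivation (A i) f
     + C k x * A i y * derivation (B j) f + C k x * B j y * derivation (A i) f) a b c" for x y f
  define U1 where "U1 x f = alt3 (\<lambda>i j k. A i x * normal2 (B j) (C k) f + B j x * normal2 (A i) (C k) f
     + C k x * normal2 (A i) (B j) f) a b c" for x f
  have U2: "U2 x y f \<in> I" if f: "f \<in> polys X" and xy: "x \<in> X" "y \<in> X" for x y f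
    using f
  proof (induction f rule: polys_induct)
    case (const c)
    show ?case by (simp add: U2_def zero_in)
  next
    case (mvar_mult z f)
    have "U2 x y (mvar z * f) = mvar z * U2 x y f +
        f * (U3 x y z + U3 x z y + U3 y x z + U3 z x y + U3 y z x + U3 z y x)"
      unfolding U2_def U3_def alt3_mult[symmetric] alt3_add[symmetric]
      by (simp add: derivation_mult algebra_simps)
    then show ?case
      using mvar_mult xy base by (simp add: U3_def) (intro add_in mult_in polys_intros base)
  next
    case (add f g)
    have "U2 x y (f + g) = U2 x y f + U2 x y g"
      unfolding U2_def alt3_add[symmetric] by (simp add: algebra_simps)
    then show ?case
      using add by (simp add: add_in)
  qed
  have U1: "U1 x f \<in> I" if f: "f \<in> polys X" and x: "x \<in> X" for x f
    using f
  proof (induction f rule: polys_induct)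
    case (const c)
    show ?case by (simp add: U1_def zero_in)
  next
    case (mvar_mult z f)
    have "U1 x (mvar z * f) = mvar z * U1 x f + U2 x z f"
      unfolding U1_def U2_def alt3_mult[symmetric] alt3_add[symmetric]
      by (simp only: normal2_mvar_mult) (simp add: algebra_simps)
    then show ?case
      using mvar_mult x U2 by (simp add: add_in mult_in polys_mvar)
  next
    case (add f g)
    have "U1 x (f + g) = U1 x f + U1 x g"
      unfolding U1_def alt3_add[symmetric] by (simp add: algebra_simps)
    then show ?case
      using add by (simp add: add_in)
  qed
  show ?thesis
    using f
  proof (induction f rule: polys_induct)
    case (const c)
    show ?case by (simp add: zero_in)
  next
    case (mvar_mult z f)
    have "alt3 (\<lambda>i j k. normal3 (A i) (B j) (C k) (mvar z * f)) a b c =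
       mvar z * alt3 (\<lambda>i j k. normal3 (A i) (B j) (C k) f) a b c + U1 z f"
      unfolding U1_def alt3_mult[symmetric] alt3_add[symmetric] by (simp add: normal3_mvar_mult)
    then show ?case
      using mvar_mult U1 by (simp add: add_in mult_in polys_mvar)
  next
    case (add f g)
    then show ?case
      by (simp add: alt3_add add_in)
  qed
qed

text \<open>The values on the variables of the derivation that \<open>x\<^sub>i \<partial>/\<partial>x\<^sub>j\<close> induces on the
  coordinates \<open>z\<^sub>\<gamma>\<close>, which behave like the monomials \<open>x\<^sup>\<gamma>\<close>.\<close>

definition polar :: "'l \<Rightarrow> 'l \<Rightarrow> 'l multiset \<Rightarrow> ('l multiset, 'k::comm_ring_1) mpoly" where
  "polar i j \<gamma> = of_nat (count \<gamma> j) * mvar (add_mset i (\<gamma> - {#j#}))"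

text \<open>In \<open>x\<^sub>i \<partial>\<^sub>k x\<^sub>j \<partial>\<^sub>l = x\<^sub>i x\<^sub>j \<partial>\<^sub>k \<partial>\<^sub>l + [j = k] x\<^sub>i \<partial>\<^sub>l\<close> the first term is symmetric in \<open>i\<close> and \<open>j\<close>,
  so only the contractions remain after antisymmetrization.\<close>

lemma polar_commutation:
  assumes "k \<noteq> l"
  shows "derivation (polar i k) (polar j l \<gamma>) - derivation (polar j k) (polar i l \<gamma>) =
    (if j = k then polar i l \<gamma> else 0) - (if i = k then polar j l \<gamma> else (0 :: ('l multiset, 'k::comm_ring_1) mpoly))"
proof -
  define \<gamma>' where "\<gamma>' = \<gamma> - {#l#}"
  have cnt: "count \<gamma>' k = count \<gamma> k"
    using assms by (simp add: \<gamma>'_def)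
  have e: "of_nat (count \<gamma>' k) * mvar (add_mset i (add_mset j \<gamma>' - {#k#}))
      = (of_nat (count \<gamma>' k) * mvar (add_mset i (add_mset j (\<gamma>' - {#k#}))) :: ('l multiset, 'k) mpoly)" for i j
    by (cases "k \<in># \<gamma>'") (auto simp: not_in_iff)
  have "derivation (polar i k) (mvar (add_mset j \<gamma>')) - derivation (polar j k) (mvar (add_mset i \<gamma>')) =
    (if j = k then mvar (add_mset i \<gamma>') else 0) - (if i = k then mvar (add_mset j \<gamma>') else (0 :: ('l multiset, 'k) mpoly))"
    using e[of i j] e[of j i] by (auto simp: polar_def distrib_right add_mset_commute)
  then have "of_nat (count \<gamma> l) * (derivation (polar i k) (mvar (add_mset j \<gamma>')) - derivation (polar j k) (mvar (add_mset i \<gamma>'))) =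
    of_nat (count \<gamma> l) * ((if j = k then mvar (add_mset i \<gamma>') else 0) - (if i = k then mvar (add_mset j \<gamma>') else (0 :: ('l multiset, 'k) mpoly)))"
    by (rule arg_cong)
  then show ?thesis
    by (simp add: polar_def[of _ l] \<gamma>'_def[symmetric] right_diff_distrib)
qed

abbreviation polarize :: "'l \<Rightarrow> 'l \<Rightarrow> ('l multiset, 'k::comm_ring_1) mpoly \<Rightarrow> ('l multiset, 'k) mpoly" where
  "polarize i j \<equiv> derivation (polar i j)"

text \<open>Capelli's identity in rank three: the normally ordered determinant of the \<open>polarize i j\<close> is the column
  determinant of the same operators with \<open>2\<close>, \<open>1\<close>, \<open>0\<close> added on the diagonal. The right hand side is this
  shifted determinant multiplied out.\<close>

lemma alt3_normal3_polar:
  fixes f :: "('l multiset, 'k::comm_ring_1) mpoly"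
  assumes pqr: "distinct [p, q, r]"
  shows "alt3 (\<lambda>i j k. normal3 (polar i p) (polar j q) (polar k r) f) p q r =
    alt3 (\<lambda>i j k. polarize i p (polarize j q (polarize k r f))) p q r
    + polarize p p (polarize r r f) - polarize r p (polarize p r f)
    + 2 * (polarize q q (polarize r r f) - polarize r q (polarize q r f)) + 2 * polarize r r f"
proof -
  define c where "c i k j l f = derivation (\<lambda>x. polarize i k (polar j l x)) f" for i k j l and f :: "('l multiset, 'k) mpoly"
  have com: "c i k j l f - c j k i l f = (if j = k then polarize i l f else 0) - (if i = k then polarize j l f else 0)"
    if "k \<noteq> l" for i j k l f
  proof -
    have "c i k j l f - c j k i l f =
        derivation (\<lambda>x. polarize i k (polar j l x) - polarize j k (polar i l x)) f"
      by (simp add: c_def derivation_linear)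
    also have "\<dots> = (if j = k then polarize i l f else 0) - (if i = k then polarize j l f else 0)"
      using that by (simp add: polar_commutation derivation_linear)
    finally show ?thesis .
  qed
  have ne: "p \<noteq> q" "p \<noteq> r" "q \<noteq> r" "q \<noteq> p" "r \<noteq> p" "r \<noteq> q"
    using pqr by auto
  have c1: "c p p q q f = c q p p q f - polarize q q f" "c r p q q f = c q p r q f"
     "c r p p q f = c p p r q f + polarize r q f" for f
    using com[of p q p q f] com[of p q q r f] com[of p q r p f] ne by (simp_all add: algebra_simps)
  have c2: "c p p r r f = c r p p r f - polarize r r f" "c q p p r f = c p p q r f + polarize q r f"
     "c r p q r f = c q p r r f" for f
    using com[of p r p r f] com[of p r q p f] com[of p r r q f] ne by (simp_all add: algebra_simps)
  have c3: "c q q r r f = c r q q r f - polarize r r f" "c p q q r f = c q q p r f + polarize p r f"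
     "c r q p r f = c p q r r f" for f
    using com[of q r q r f] com[of q r p q f] com[of q r r p f] ne by (simp_all add: algebra_simps)
  have n3: "normal3 (polar i p) (polar j q) (polar k r) f =
      polarize i p (polarize j q (polarize k r f)) - polarize i p (c j q k r f)
      - c i p j q (polarize k r f) + derivation (\<lambda>x. c i p j q (polar k r x)) f
      - polarize j q (c i p k r f) + derivation (\<lambda>x. polarize j q (polarize i p (polar k r x))) f" for i j k
    by (simp add: normal3_def normal2_def c_def)
  have t2: "alt3 (\<lambda>i j k. polarize i p (c j q k r f)) p q r = - polarize p p (polarize r r f) + polarize r p (polarize p r f)"
    by (simp add: alt3_def c3)
  have t3: "alt3 (\<lambda>i j k. c i p j q (polarize k r f)) p q r = - polarize q q (polarize r r f) + polarize r q (polarize q r f)"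
    by (simp add: alt3_def c1)
  have t5: "alt3 (\<lambda>i j k. polarize j q (c i p k r f)) p q r = - polarize q q (polarize r r f) + polarize r q (polarize q r f)"
    by (simp add: alt3_def c2)
  have qr: "polarize r q (polar q r x) - polarize q q (polar r r x) = (polar r r x :: ('l multiset, 'k) mpoly)" for x
    using polar_commutation[of q r r q x] ne by simp
  have alt_derivation: "alt3 (\<lambda>i j k. derivation (g i j k) f) p q r = derivation (\<lambda>x. alt3 (\<lambda>i j k. g i j k x) p q r) f" for g
    by (simp add: alt3_def derivation_linear)
  have "alt3 (\<lambda>i j k. c i p j q (polar k r x)) p q r = polarize r q (polar q r x) - polarize q q (polar r r x)" for x
    by (simp add: alt3_def c1)
  then have t4: "alt3 (\<lambda>i j k. derivation (\<lambda>x. c i p j q (polar k r x)) f) p q r = polarize r r f"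
    unfolding alt_derivation by (simp add: qr)
  have "alt3 (\<lambda>i j k. polarize j q (polarize i p (polar k r x))) p q r = polarize r q (polar q r x) - (polarize q q (polar r r x) :: ('l multiset, 'k) mpoly)" for x
  proof -
    have "polarize p p (polar r r x) = polarize r p (polar p r x) - (polar r r x :: ('l multiset, 'k) mpoly)"
      "polarize q p (polar p r x) = polarize p p (polar q r x) + (polar q r x :: ('l multiset, 'k) mpoly)"
      "polarize r p (polar q r x) = (polarize q p (polar r r x) :: ('l multiset, 'k) mpoly)"
      using polar_commutation[of p r p r x] polar_commutation[of p r q p x] polar_commutation[of p r r q x] ne
      by (simp_all add: algebra_simps)
    then show ?thesis
      by (simp add: alt3_def)
  qed
  then have t6: "alt3 (\<lambda>i j k. derivation (\<lambda>x. polarize j q (polarize i p (polar k r x))) f) p q r = polarize r r f"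
    unfolding alt_derivation by (simp add: qr)
  show ?thesis
    unfolding n3 alt3_add alt3_diff t2 t3 t4 t5 t6 by (simp add: algebra_simps)
qed

text \<open>In every term of the shifted determinant but the diagonal one, some raising operator can be applied
  first and yields an element of \<open>I\<close>; the diagonal term is \<open>(a + 2)(b + 1) c\<close> times \<open>f\<close>.\<close>

lemma capelli_in_ideal:
  fixes f :: "('l multiset, 'k::field_char_0) mpoly"
  assumes I: "mpoly_ideal X I" and pqr: "distinct [p, q, r]" and f: "f \<in> polys X"
    and minors: "\<And>x y z. \<lbrakk>x \<in> X; y \<in> X; z \<in> X\<rbrakk> \<Longrightarrow>
      alt3 (\<lambda>i j k. polar i p x * polar j q y * polar k r z) p q r \<in> I"
    and closed: "\<And>i j g. \<lbrakk>i \<in> {p, q, r}; j \<in> {p, q, r}; g \<in> I\<rbrakk> \<Longrightarrow> polarize i j g \<in> I"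
    and raise: "polarize p q f \<in> I" "polarize p r f \<in> I" "polarize q r f \<in> I"
    and weight: "polarize p p f = of_nat a * f" "polarize q q f = of_nat b * f" "polarize r r f = of_nat c * f"
  shows "of_nat ((a + 2) * (b + 1) * c) * f \<in> I"
proof -
  interpret mpoly_ideal X I by fact
  have of_nat_in: "of_nat m * g \<in> I" if "g \<in> I" for m g
    using const_mult_in[OF that, of "of_nat m"] by (simp add: const_of_nat)
  define R where "R = polarize q p (polarize r q (polarize p r f)) + polarize r p (polarize p q (polarize q r f))
    - polarize p p (polarize r q (polarize q r f)) - of_nat c * polarize q p (polarize p q f)
    - polarize r p (polarize q q (polarize p r f))
    - polarize r p (polarize p r f) - 2 * polarize r q (polarize q r f)"
  have "R \<in> I"
    unfolding R_def using of_nat_in[of _ 2]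
    by (intro add_in diff_in) (auto intro!: closed raise of_nat_in)
  moreover have "alt3 (\<lambda>i j k. normal3 (polar i p) (polar j q) (polar k r) f) p q r
      = of_nat ((a + 2) * (b + 1) * c) * f + R"
    unfolding alt3_normal3_polar[OF pqr] by (simp add: alt3_def weight R_def) (simp add: algebra_simps)
  moreover have "alt3 (\<lambda>i j k. normal3 (polar i p) (polar j q) (polar k r) f) p q r \<in> I"
    by (rule alt3_normal3_in[OF minors f])
  ultimately show ?thesis
    by (metis add.commute add_in_iff)
qed

section \<open>Minors with rows of degree one\<close>

lemma mpoly_idealI:
  fixes J :: "('x, 'k::field_char_0) mpoly set"
  assumes "J \<subseteq> polys X" "0 \<in> J" "\<And>p q. p \<in> J \<Longrightarrow> q \<in> J \<Longrightarrow> p + q \<in> J"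
    and mult: "\<And>p q. p \<in> polys X \<Longrightarrow> q \<in> J \<Longrightarrow> p * q \<in> J"
  shows "mpoly_ideal X J"
proof -
  interpret R: cring "mpoly_ring X :: ('x, 'k) mpoly ring"
    by (rule cring_mpoly_ring)
  have um: "- q \<in> J" if "q \<in> J" for q
    using mult[OF polys_uminus[OF polys_1] that] by simp
  have minus: "\<ominus>\<^bsub>mpoly_ring X\<^esub> q = - q" if "q \<in> J" for q
    by (rule R.minus_equality) (use that assms(1) um in auto)
  have "ideal J (mpoly_ring X)"
  proof (rule idealI)
    show "ring (mpoly_ring X :: ('x, 'k) mpoly ring)"
      by (rule R.ring_axioms)
    show "subgroup J (add_monoid (mpoly_ring X))"
    proof (rule subgroup.intro)
      show "inv\<^bsub>add_monoid (mpoly_ring X)\<^esub> q \<in> J" if "q \<in> J" for q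
        using um[OF that] minus[OF that] unfolding a_inv_def by simp
    qed (use assms in auto)
    show "x \<otimes>\<^bsub>mpoly_ring X\<^esub> a \<in> J" "a \<otimes>\<^bsub>mpoly_ring X\<^esub> x \<in> J"
      if "a \<in> J" "x \<in> polys X" for a x
      using mult[OF that(2,1)] by (simp_all add: mult.commute)
  qed
  then show ?thesis
    by (rule mpoly_ideal.intro)
qed

text \<open>Testing membership in \<open>I\<close> by linear functionals turns congruences modulo \<open>I\<close> into equations in the
  field, to which the results on alternating forms apply.\<close>

lemma (in mpoly_ideal) separating_functional:
  assumes "x \<notin> I"
  obtains \<phi> :: "('x, 'k) mpoly \<Rightarrow> 'k"
  where "\<And>p q. \<phi> (p + q) = \<phi> p + \<phi> q" "\<And>p. p \<in> I \<Longrightarrow> \<phi> p = 0" "\<phi> x \<noteq> 0"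
proof -
  interpret V: vector_space "\<lambda>(c :: 'k) (p :: ('x, 'k) mpoly). const c * p"
    by unfold_locales (simp_all add: const_add const_mult algebra_simps)
  interpret K: vector_space "(*) :: 'k \<Rightarrow> 'k \<Rightarrow> 'k"
    by unfold_locales (simp_all add: algebra_simps)
  interpret VK: vector_space_pair "\<lambda>(c :: 'k) (p :: ('x, 'k) mpoly). const c * p" "(*) :: 'k \<Rightarrow> 'k \<Rightarrow> 'k" ..
  obtain B where B: "B \<subseteq> I" "V.independent B" "I \<subseteq> V.span B"
    using V.maximal_independent_subset by blast
  have "V.span B \<subseteq> I"
    by (rule V.span_minimal[OF B(1)]) (auto simp: V.subspace_def zero_in add_in const_mult_in)
  then have "x \<notin> V.span B"
    using assms by blast
  then have "V.independent (insert x B)"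
    using B(2) by (simp add: V.independent_insert)
  then obtain \<phi> where lin: "Vector_Spaces.linear (\<lambda>(c :: 'k) (p :: ('x, 'k) mpoly). const c * p) (*) \<phi>"
    and \<phi>: "\<forall>y\<in>insert x B. \<phi> y = (if y = x then 1 else 0)"
    using VK.linear_independent_extend[of "insert x B" "\<lambda>y. if y = x then 1 else 0"] by blast
  interpret \<phi>: Vector_Spaces.linear "\<lambda>(c :: 'k) (p :: ('x, 'k) mpoly). const c * p" "(*)" \<phi>
    by (rule lin)
  show ?thesis
  proof (rule that)
    show "\<phi> (p + q) = \<phi> p + \<phi> q" for p q
      by (rule \<phi>.add)
    show "\<phi> x \<noteq> 0"
      using \<phi> by simp
    show "\<phi> p = 0" if "p \<in> I" for p
    proof (rule VK.linear_eq_0_on_span[OF lin])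
      show "p \<in> V.span B"
        using that B(3) by blast
      show "\<phi> y = 0" if "y \<in> B" for y
        using \<phi> that assms B(1) by auto
    qed
  qed
qed

text \<open>The linear map from polynomials in the letters to linear forms in the \<open>z\<^sub>\<gamma>\<close> that sends each monomial
  \<open>x\<^sup>\<gamma>\<close> to \<open>z\<^sub>\<gamma>\<close>. The catalecticant is the bilinear map \<open>(P, Q) \<mapsto> zlin (P * Q)\<close> on pairs of forms.\<close>

definition zlin :: "('l, 'k::comm_ring_1) mpoly \<Rightarrow> ('l multiset, 'k) mpoly" where
  "zlin p = (\<Sum>m\<in>Poly_Mapping.keys p. const (Poly_Mapping.lookup p m) * mvar m)"

lemma zlin_0 [simp]: "zlin 0 = 0"
  by (simp add: zlin_def)

lemma zlin_single [simp]: "zlin (Poly_Mapping.single m c) = const c * mvar m"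
  by (simp add: zlin_def)

lemma zlin_add [simp]: "zlin (p + q) = zlin p + zlin q"
  unfolding zlin_def by (rule setsum_keys_plus_distrib, simp, simp only: const_add distrib_right)

definition forms :: "nat \<Rightarrow> nat \<Rightarrow> (nat, 'k::comm_ring_1) mpoly set" where
  "forms n k = {p. Poly_Mapping.keys p \<subseteq> msets n k}"

lemma prods_forms: "p \<in> prods (forms n 1) k \<Longrightarrow> p \<in> forms n k"
proof (induction k arbitrary: p)
  case 0
  then show ?case
    by (simp add: forms_def msets_def)
next
  case (Suc k)
  then obtain l c where p: "p = l * c" "l \<in> forms n 1" "c \<in> forms n k"
    by (metis prods_SucE)
  show ?case
    unfolding p(1) using p(2,3) keys_mult[of l c] by (fastforce simp: forms_def msets_def)
qed

lemma mvar_forms: "i \<in> {1..n} \<Longrightarrow> mvar i \<in> forms n 1"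
  by (auto simp: forms_def msets_def mvar_def)

lemma monomial_in_prods:
  "set_mset m \<subseteq> {1..n} \<Longrightarrow> Poly_Mapping.single m 1 \<in> prods (forms n 1) (size m)"
proof (induction m)
  case (add i m)
  then show ?case
    using prods_SucI[OF mvar_forms[of i n] add.IH] by (simp add: single_add_mset)
qed simp

lemma forms_closed: "p \<in> forms n k \<Longrightarrow> q \<in> forms n k \<Longrightarrow> p + q \<in> forms n k \<and> p - q \<in> forms n k"
  using Poly_Mapping.keys_add[of p q] Poly_Mapping.keys_add[of p "- q"] by (force simp: forms_def)

lemma (in mpoly_ideal) linear_extension_in:
  fixes p :: "'m \<Rightarrow>\<^sub>0 'b::comm_monoid_add"
  assumes "Poly_Mapping.keys p \<subseteq> B" "F 0 = 0" "\<And>p q. F (p + q) = F p + F q"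
    and "\<And>b c. b \<in> B \<Longrightarrow> F (Poly_Mapping.single b c) \<in> I"
  shows "F p \<in> I"
  using assms(1) by (induction p rule: poly_mapping_induct_in) (simp_all add: assms zero_in add_in)

text \<open>Multilinearity extends membership of the minors from monomials to arbitrary forms as rows and columns.\<close>

lemma det3_zlin_in:
  fixes P1 P2 P3 Q1 Q2 Q3 :: "(nat, 'k::field_char_0) mpoly"
  assumes "mpoly_ideal Y J"
    and minors: "\<And>a1 a2 a3 b1 b2 b3. \<lbrakk>a1 \<in> A; a2 \<in> A; a3 \<in> A; b1 \<in> B; b2 \<in> B; b3 \<in> B\<rbrakk> \<Longrightarrow>
      det3 cat a1 a2 a3 b1 b2 b3 \<in> J"
    and P: "Poly_Mapping.keys P1 \<subseteq> A" "Poly_Mapping.keys P2 \<subseteq> A" "Poly_Mapping.keys P3 \<subseteq> A"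
    and Q: "Poly_Mapping.keys Q1 \<subseteq> B" "Poly_Mapping.keys Q2 \<subseteq> B" "Poly_Mapping.keys Q3 \<subseteq> B"
  shows "det3 (\<lambda>P Q. zlin (P * Q)) P1 P2 P3 Q1 Q2 Q3 \<in> J"
proof -
  interpret J: mpoly_ideal Y J by fact
  let ?D = "det3 (\<lambda>P Q. zlin (P * Q) :: (nat multiset, 'k) mpoly)"
  let ?s = "Poly_Mapping.single :: _ \<Rightarrow> 'k \<Rightarrow> _"
  have add: "?D (P + P') P2 P3 Q1 Q2 Q3 = ?D P P2 P3 Q1 Q2 Q3 + ?D P' P2 P3 Q1 Q2 Q3"
    "?D P1 (P + P') P3 Q1 Q2 Q3 = ?D P1 P P3 Q1 Q2 Q3 + ?D P1 P' P3 Q1 Q2 Q3"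
    "?D P1 P2 (P + P') Q1 Q2 Q3 = ?D P1 P2 P Q1 Q2 Q3 + ?D P1 P2 P' Q1 Q2 Q3"
    "?D P1 P2 P3 (P + P') Q2 Q3 = ?D P1 P2 P3 P Q2 Q3 + ?D P1 P2 P3 P' Q2 Q3"
    "?D P1 P2 P3 Q1 (P + P') Q3 = ?D P1 P2 P3 Q1 P Q3 + ?D P1 P2 P3 Q1 P' Q3"
    "?D P1 P2 P3 Q1 Q2 (P + P') = ?D P1 P2 P3 Q1 Q2 P + ?D P1 P2 P3 Q1 Q2 P'"
    for P P' P1 P2 P3 Q1 Q2 Q3
    by (simp_all add: det3_def distrib_left distrib_right algebra_simps)
  have zero: "?D 0 P2 P3 Q1 Q2 Q3 = 0" "?D P1 0 P3 Q1 Q2 Q3 = 0" "?D P1 P2 0 Q1 Q2 Q3 = 0"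
    "?D P1 P2 P3 0 Q2 Q3 = 0" "?D P1 P2 P3 Q1 0 Q3 = 0" "?D P1 P2 P3 Q1 Q2 0 = 0" for P1 P2 P3 Q1 Q2 Q3
    by (simp_all add: det3_def)
  have "?D (?s a1 c1) (?s a2 c2) (?s a3 c3) (?s b1 e1) (?s b2 e2) (?s b3 e3) \<in> J"
    if "a1 \<in> A" "a2 \<in> A" "a3 \<in> A" "b1 \<in> B" "b2 \<in> B" "b3 \<in> B" for a1 a2 a3 b1 b2 b3 c1 c2 c3 e1 e2 e3
  proof -
    have "?D (?s a1 c1) (?s a2 c2) (?s a3 c3) (?s b1 e1) (?s b2 e2) (?s b3 e3) =
        const (c1 * c2 * c3 * e1 * e2 * e3) * det3 cat a1 a2 a3 b1 b2 b3"
      by (simp add: det3_def mult_single const_mult cat_def algebra_simps)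
    then show ?thesis
      using J.const_mult_in minors that by simp
  qed
  then have "?D (?s a1 c1) (?s a2 c2) (?s a3 c3) (?s b1 e1) (?s b2 e2) Q3 \<in> J"
    if "a1 \<in> A" "a2 \<in> A" "a3 \<in> A" "b1 \<in> B" "b2 \<in> B" for a1 a2 a3 b1 b2 c1 c2 c3 e1 e2
    using that by (intro J.linear_extension_in[OF Q(3), of "?D _ _ _ _ _"] zero add) auto
  then have "?D (?s a1 c1) (?s a2 c2) (?s a3 c3) (?s b1 e1) Q2 Q3 \<in> J"
    if "a1 \<in> A" "a2 \<in> A" "a3 \<in> A" "b1 \<in> B" for a1 a2 a3 b1 c1 c2 c3 e1
    using that by (intro J.linear_extension_in[OF Q(2), of "\<lambda>Q. ?D _ _ _ _ Q _"] zero add) auto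
  then have "?D (?s a1 c1) (?s a2 c2) (?s a3 c3) Q1 Q2 Q3 \<in> J"
    if "a1 \<in> A" "a2 \<in> A" "a3 \<in> A" for a1 a2 a3 c1 c2 c3
    using that by (intro J.linear_extension_in[OF Q(1), of "\<lambda>Q. ?D _ _ _ Q _ _"] zero add) auto
  then have "?D (?s a1 c1) (?s a2 c2) P3 Q1 Q2 Q3 \<in> J"
    if "a1 \<in> A" "a2 \<in> A" for a1 a2 c1 c2
    using that by (intro J.linear_extension_in[OF P(3), of "\<lambda>Q. ?D _ _ Q _ _ _"] zero add) auto
  then have "?D (?s a1 c1) P2 P3 Q1 Q2 Q3 \<in> J" if "a1 \<in> A" for a1 c1
    using that by (intro J.linear_extension_in[OF P(2), of "\<lambda>Q. ?D _ Q _ _ _ _"] zero add) auto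
  then show ?thesis
    by (intro J.linear_extension_in[OF P(1), of "\<lambda>Q. ?D Q _ _ _ _ _"] zero add) auto
qed

text \<open>For a functional \<open>\<phi>\<close> that vanishes on \<open>I\<close>, the value of \<open>\<phi>\<close> at the minor with rows \<open>p, q, r\<close> and columns
  \<open>x, y, z\<close> is an alternating form in \<open>x, y, z\<close>. Multiplying the columns by \<open>p1, p2, p3\<close> in all six orders
  amounts to multiplying the rows instead, which gives minors with rows of degree \<open>s + 1\<close>; so the
  form vanishes on the products that enter \<open>alternating_form_vanishes\<close>.\<close>

lemma linear_minors_in_ideal:
  fixes I :: "(nat multiset, 'k::field_char_0) mpoly set"
  assumes I: "mpoly_ideal X I"
    and minors: "\<And>a1 a2 a3 b1 b2 b3. \<lbrakk>a1 \<in> msets n (Suc s); a2 \<in> msets n (Suc s); a3 \<in> msets n (Suc s);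
      b1 \<in> msets n u; b2 \<in> msets n u; b3 \<in> msets n u\<rbrakk> \<Longrightarrow> det3 cat a1 a2 a3 b1 b2 b3 \<in> I"
    and u: "u \<ge> 2"
    and pqr: "p \<in> {1..n}" "q \<in> {1..n}" "r \<in> {1..n}"
    and b: "b1 \<in> msets n (s + u)" "b2 \<in> msets n (s + u)" "b3 \<in> msets n (s + u)"
  shows "det3 cat {#p#} {#q#} {#r#} b1 b2 b3 \<in> I"
proof (rule ccontr)
  interpret mpoly_ideal X I by fact
  assume "det3 cat {#p#} {#q#} {#r#} b1 b2 b3 \<notin> I"
  then obtain \<phi> :: "(nat multiset, 'k) mpoly \<Rightarrow> 'k" where \<phi>: "\<And>p q. \<phi> (p + q) = \<phi> p + \<phi> q" "\<And>p. p \<in> I \<Longrightarrow> \<phi> p = 0"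
    and ne: "\<phi> (det3 cat {#p#} {#q#} {#r#} b1 b2 b3) \<noteq> 0"
    by (rule separating_functional) blast
  have \<phi>_minus: "\<phi> (- x) = - \<phi> x" for x
    using \<phi>(1)[of x "- x"] \<phi>(2)[OF zero_in] by (simp add: eq_neg_iff_add_eq_0 add.commute)
  let ?M = "\<lambda>P Q. zlin (P * Q) :: (nat multiset, 'k) mpoly"
  let ?D = "det3 ?M (mvar p) (mvar q) (mvar r)"
  define f where "f x y z = \<phi> (?D x y z)" for x y z
  have "f (Poly_Mapping.single b1 1) (Poly_Mapping.single b2 1) (Poly_Mapping.single b3 1) = 0"
  proof (rule alternating_form_vanishes[where V = "forms n 1" and a = s and b = u])
    show "alternating_form f"
    proof
      show "f (x + x') y z = f x y z + f x' y z" for x x' y z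
        unfolding f_def \<phi>(1)[symmetric] by (simp add: det3_def algebra_simps)
      show "f y x z = - f x y z" "f x z y = - f x y z" for x y z
        unfolding f_def \<phi>_minus[symmetric] by (simp_all add: det3_def algebra_simps)
    qed
    show "l + l' \<in> forms n 1 \<and> l - l' \<in> forms n 1" if "l \<in> forms n 1" "l' \<in> forms n 1"
      for l l' :: "(nat, 'k) mpoly"
      using forms_closed that by blast
    show "Poly_Mapping.single b1 1 \<in> prods (forms n 1) (s + u)"
      "Poly_Mapping.single b2 1 \<in> prods (forms n 1) (s + u)"
      "Poly_Mapping.single b3 1 \<in> prods (forms n 1) (s + u)"
      using monomial_in_prods[of b1 n] monomial_in_prods[of b2 n] monomial_in_prods[of b3 n] b
      by (simp_all add: msets_def)
    fix p1 p2 p3 q1 q2 q3 :: "(nat, 'k) mpoly"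
    assume P: "p1 \<in> prods (forms n 1) s" "p2 \<in> prods (forms n 1) s" "p3 \<in> prods (forms n 1) s"
      and Q: "q1 \<in> prods (forms n 1) u" "q2 \<in> prods (forms n 1) u" "q3 \<in> prods (forms n 1) u"
    have mv: "mvar i * p \<in> forms n (Suc s)" if "i \<in> {1..n}" "p \<in> prods (forms n 1) s" for i p
      using that by (intro prods_forms prods_SucI mvar_forms)
    have D: "det3 ?M (mvar p * x1) (mvar q * x2) (mvar r * x3) q1 q2 q3 \<in> I"
      if "x1 \<in> prods (forms n 1) s" "x2 \<in> prods (forms n 1) s" "x3 \<in> prods (forms n 1) s" for x1 x2 x3
      using that mv pqr prods_forms[OF Q(1)] prods_forms[OF Q(2)] prods_forms[OF Q(3)]
      by (intro det3_zlin_in[where A = "msets n (Suc s)" and B = "msets n u", OF I minors])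
         (auto simp: forms_def)
    have "sym3 f p1 p2 p3 q1 q2 q3 = \<phi> (sym3 ?D p1 p2 p3 q1 q2 q3)"
      by (simp add: sym3_def f_def \<phi>(1))
    also have "sym3 ?D p1 p2 p3 q1 q2 q3 =
       det3 ?M (mvar p * p1) (mvar q * p2) (mvar r * p3) q1 q2 q3 + det3 ?M (mvar p * p1) (mvar q * p3) (mvar r * p2) q1 q2 q3 +
       det3 ?M (mvar p * p2) (mvar q * p1) (mvar r * p3) q1 q2 q3 + det3 ?M (mvar p * p2) (mvar q * p3) (mvar r * p1) q1 q2 q3 +
       det3 ?M (mvar p * p3) (mvar q * p1) (mvar r * p2) q1 q2 q3 + det3 ?M (mvar p * p3) (mvar q * p2) (mvar r * p1) q1 q2 q3"
      unfolding sym3_def det3_def by (simp only: mult.assoc) (simp add: algebra_simps)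
    also have "\<phi> \<dots> = 0"
      using D P by (intro \<phi>(2) add_in) blast+
    finally show "sym3 f p1 p2 p3 q1 q2 q3 = 0" .
  qed (use u in auto)
  moreover have "?D (Poly_Mapping.single b1 1) (Poly_Mapping.single b2 1) (Poly_Mapping.single b3 1)
      = det3 cat {#p#} {#q#} {#r#} b1 b2 b3"
    by (simp add: det3_def mvar_def mult_single cat_def)
  ultimately show False
    using ne by (simp add: f_def)
qed

section \<open>The ideal of secant lines and its invariance under polarization\<close>

text \<open>The restriction of a polynomial to a polynomial curve \<open>U\<close>.\<close>

definition psubst :: "('x \<Rightarrow> 'k::field_char_0 poly) \<Rightarrow> ('x, 'k) mpoly \<Rightarrow> 'k poly" where
  "psubst U p = (\<Sum>m\<in>Poly_Mapping.keys p. smult (Poly_Mapping.lookup p m) (\<Prod>x\<in>#m. U x))"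

lemma psubst_0 [simp]: "psubst U 0 = 0"
  by (simp add: psubst_def)

lemma psubst_single: "psubst U (Poly_Mapping.single m c) = smult c (\<Prod>x\<in>#m. U x)"
  by (simp add: psubst_def)

lemma psubst_const [simp]: "psubst U (const c) = [:c:]"
  by (simp add: const_def psubst_single)

lemma psubst_add [simp]: "psubst U (p + q) = psubst U p + psubst U q"
  unfolding psubst_def by (rule setsum_keys_plus_distrib) (simp_all add: smult_add_left)

lemma psubst_mvar_mult [simp]: "psubst U (mvar x * p) = U x * psubst U p"
proof (induction p rule: poly_mapping_induct_in[OF subset_UNIV, case_names zero single add])
  case (single m c)
  then show ?case
    by (simp add: psubst_single flip: single_add_mset)
qed (auto simp: distrib_left)

lemma poly_psubst:
  assumes "p \<in> polys X" "\<And>x. x \<in> X \<Longrightarrow> poly (U x) e = u x"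
  shows "poly (psubst U p) e = mpoly_eval u p"
  using assms(1) by (induction p rule: polys_induct) (simp_all add: assms(2))

text \<open>The chain rule along a curve with tangent vector \<open>A\<close>.\<close>

lemma poly_pderiv_psubst:
  assumes "p \<in> polys X" "\<And>x. x \<in> X \<Longrightarrow> poly (U x) e = u x"
    and "\<And>x. x \<in> X \<Longrightarrow> poly (pderiv (U x)) e = mpoly_eval u (A x)"
  shows "poly (pderiv (psubst U p)) e = mpoly_eval u (derivation A p)"
  using assms(1)
proof (induction p rule: polys_induct)
  case (mvar_mult x p)
  then show ?case
    using poly_psubst[OF mvar_mult(2), of U e u] assms(2,3)
    by (simp only: psubst_mvar_mult derivation_mvar_mult pderiv_mult) simp
qed (simp_all add: pderiv_add)

lemma poly_prod_mset_image: "poly (\<Prod>k\<in>#\<gamma>. A k) e = (\<Prod>k\<in>#\<gamma>. poly (A k) e)"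
  by (induction \<gamma>) simp_all

text \<open>Points on the line through the points \<open>a\<^sup>\<gamma>\<close> and \<open>b\<^sup>\<gamma>\<close> of the Veronese cone; degenerate choices of
  \<open>s, t, a, b\<close> are included.\<close>

definition sec_pt :: "'k::field_char_0 \<Rightarrow> 'k \<Rightarrow> ('l \<Rightarrow> 'k) \<Rightarrow> ('l \<Rightarrow> 'k) \<Rightarrow> 'l multiset \<Rightarrow> 'k" where
  "sec_pt s t a b \<gamma> = s * (\<Prod>k\<in>#\<gamma>. a k) + t * (\<Prod>k\<in>#\<gamma>. b k)"

definition sec_ideal :: "'l multiset set \<Rightarrow> ('l multiset, 'k::field_char_0) mpoly set" where
  "sec_ideal X = {f \<in> polys X. \<forall>s t a b. mpoly_eval (sec_pt s t a b) f = 0}"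

lemma mpoly_ideal_sec_ideal: "mpoly_ideal X (sec_ideal X)"
  by (rule mpoly_idealI) (auto simp: sec_ideal_def intro: polys_intros)

text \<open>At these points the catalecticant matrix is a sum of two matrices of rank at most one.\<close>

lemma det3_cat_in_sec_ideal:
  assumes "\<And>i j. i \<in> {a1, a2, a3} \<Longrightarrow> j \<in> {b1, b2, b3} \<Longrightarrow> i + j \<in> X"
  shows "det3 cat a1 a2 a3 b1 b2 b3 \<in> (sec_ideal X :: (nat multiset, 'k::field_char_0) mpoly set)"
proof -
  have "det3 cat a1 a2 a3 b1 b2 b3 \<in> (polys X :: (nat multiset, 'k) mpoly set)"
    unfolding det3_def cat_def by (intro polys_intros assms) auto
  moreover have "mpoly_eval (sec_pt s t a b) (det3 cat a1 a2 a3 b1 b2 b3) = 0" for s t :: 'k and a b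
    by (simp add: det3_def cat_def sec_pt_def algebra_simps)
  ultimately show ?thesis
    by (simp add: sec_ideal_def)
qed

lemma replace_in_msets:
  assumes "\<alpha> \<in> msets n k" "i \<in> {1..n}" "j \<in># \<alpha>"
  shows "add_mset i (\<alpha> - {#j#}) \<in> msets n k"
proof -
  have "set_mset (\<alpha> - {#j#}) \<subseteq> set_mset \<alpha>"
    by (auto dest: in_diffD)
  then show ?thesis
    using assms by (simp add: msets_def size_Suc_Diff1 subset_iff)
qed

lemma polar_polys:
  assumes "\<gamma> \<in> msets n d" "i \<in> {1..n}"
  shows "polar i j \<gamma> \<in> polys (msets n d)"
proof (cases "j \<in># \<gamma>")
  case True
  then have "const (of_nat (count \<gamma> j)) * mvar (add_mset i (\<gamma> - {#j#})) \<in> polys (msets n d)"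
    using replace_in_msets[OF assms] by (intro polys_mult polys_const polys_mvar)
  then show ?thesis
    by (simp add: polar_def const_of_nat)
next
  case False
  then show ?thesis
    by (simp add: polar_def not_in_iff polys_0)
qed

lemma polarize_polys:
  "f \<in> polys (msets n d) \<Longrightarrow> i \<in> {1..n} \<Longrightarrow> polarize i j f \<in> polys (msets n d)"
  by (rule derivation_polys) (auto intro: polar_polys)

lemma poly_pderiv_prod_mset:
  fixes a :: "'l \<Rightarrow> 'k::field_char_0" and i j :: 'l
  defines "A \<equiv> (\<lambda>k. [:a k, if k = j then a i else 0:])"
  shows "poly (pderiv (\<Prod>k\<in>#\<gamma>. A k)) 0 = of_nat (count \<gamma> j) * (\<Prod>k\<in>#add_mset i (\<gamma> - {#j#}). a k)"
proof (induction \<gamma>)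
  case (add k \<gamma>)
  have "poly (\<Prod>k\<in>#\<gamma>. A k) 0 = (\<Prod>k\<in>#\<gamma>. a k)"
    by (simp add: poly_prod_mset_image A_def)
  moreover have "a k * (of_nat (count \<gamma> j) * prod_mset (image_mset a (\<gamma> - {#j#})))
      = of_nat (count \<gamma> j) * prod_mset (image_mset a (add_mset k \<gamma> - {#j#}))"
    by (cases "j \<in># \<gamma>") (auto simp: not_in_iff)
  moreover have "poly (pderiv (\<Prod>k\<in>#add_mset k \<gamma>. A k)) 0 =
      poly (A k) 0 * poly (pderiv (\<Prod>k\<in>#\<gamma>. A k)) 0 + poly (pderiv (A k)) 0 * poly (\<Prod>k\<in>#\<gamma>. A k) 0"
    by (simp only: image_mset_add_mset prod_mset.add_mset pderiv_mult poly_add poly_mult) (simp only: mult.commute)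
  moreover have "poly (A k) 0 = a k" "poly (pderiv (A k)) 0 = (if k = j then a i else 0)"
    by (simp_all add: A_def pderiv_pCons)
  ultimately show ?case
    using add by (auto simp: algebra_simps)
qed simp

text \<open>A polynomial of the ideal vanishes along the curve obtained by moving the \<open>j\<close>-th coordinates of \<open>a\<close> and \<open>b\<close>
  with velocities \<open>a i\<close> and \<open>b i\<close>; its derivative at the starting point is the value of \<open>polarize i j f\<close>.\<close>

lemma polarize_sec_ideal:
  assumes f: "f \<in> sec_ideal (msets n d)" and i: "i \<in> {1..n}"
  shows "polarize i j f \<in> sec_ideal (msets n d)"
proof -
  have fX: "f \<in> polys (msets n d)"
    using f by (simp add: sec_ideal_def)
  have "mpoly_eval (sec_pt s t a b) (polarize i j f) = 0" for s t a b
  proof -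
    define L where "L c k = [:c k, if k = j then c i else 0:]" for c :: "nat \<Rightarrow> 'a" and k
    define U where "U \<gamma> = smult s (\<Prod>k\<in>#\<gamma>. L a k) + smult t (\<Prod>k\<in>#\<gamma>. L b k)" for \<gamma>
    have "poly (psubst U f) e = 0" for e
    proof -
      have "poly (psubst U f) e = mpoly_eval (sec_pt s t (\<lambda>k. poly (L a k) e) (\<lambda>k. poly (L b k) e)) f"
        by (rule poly_psubst[OF fX]) (simp add: U_def sec_pt_def poly_prod_mset_image)
      then show ?thesis
        using f by (simp add: sec_ideal_def)
    qed
    then have "psubst U f = 0"
      using poly_all_0_iff_0 by blast
    moreover have "poly (pderiv (psubst U f)) 0 = mpoly_eval (sec_pt s t a b) (polarize i j f)"
    proof (rule poly_pderiv_psubst[OF fX])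
      fix \<gamma> assume "\<gamma> \<in> msets n d"
      show "poly (U \<gamma>) 0 = sec_pt s t a b \<gamma>"
        by (simp add: U_def sec_pt_def poly_prod_mset_image L_def)
      show "poly (pderiv (U \<gamma>)) 0 = mpoly_eval (sec_pt s t a b) (polar i j \<gamma>)"
        using poly_pderiv_prod_mset[of a j i \<gamma>] poly_pderiv_prod_mset[of b j i \<gamma>]
        by (simp add: U_def L_def polar_def sec_pt_def pderiv_add pderiv_smult algebra_simps flip: const_of_nat)
    qed
    ultimately show ?thesis
      by simp
  qed
  then show ?thesis
    using polarize_polys[OF fX i] by (simp add: sec_ideal_def)
qed

lemma msets_add: "\<alpha> \<in> msets n a \<Longrightarrow> \<beta> \<in> msets n b \<Longrightarrow> \<alpha> + \<beta> \<in> msets n (a + b)"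
  by (auto simp: msets_def)

lemma minors_polys:
  "minors 3 (msets n a) (msets n b) cat \<subseteq> (polys (msets n (a + b)) :: (nat multiset, 'k::comm_ring_1) mpoly set)"
proof
  fix p :: "(nat multiset, 'k) mpoly"
  assume "p \<in> minors 3 (msets n a) (msets n b) cat"
  then obtain a1 a2 a3 b1 b2 b3 where "p = det3 cat a1 a2 a3 b1 b2 b3"
    "{a1, a2, a3} \<subseteq> msets n a" "{b1, b2, b3} \<subseteq> msets n b"
    by (rule minors_3E)
  then show "p \<in> polys (msets n (a + b))"
    by (auto simp: det3_def cat_def intro!: polys_intros msets_add)
qed

locale catalecticant =
  fixes n a b :: nat and I :: "(nat multiset, 'k::field_char_0) mpoly set"
  assumes I_eq: "I = cat_ideal 3 a b n"
begin

sublocale mpoly_ideal "msets n (a + b)" I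
proof (rule mpoly_ideal.intro)
  show "ideal I (mpoly_ring (msets n (a + b)))"
    unfolding I_eq cat_ideal_def
    by (rule ring.genideal_ideal[OF cring.axioms(1)[OF cring_mpoly_ring] minors_polys])
qed

lemma minors_subset: "minors 3 (msets n a) (msets n b) cat \<subseteq> I"
  unfolding I_eq cat_ideal_def
  by (rule ring.genideal_self[OF cring.axioms(1)[OF cring_mpoly_ring] minors_polys])

lemma minimal:
  assumes "mpoly_ideal (msets n (a + b)) J" "minors 3 (msets n a) (msets n b) cat \<subseteq> J"
  shows "I \<subseteq> J"
  unfolding I_eq cat_ideal_def
  by (rule ring.genideal_minimal[OF cring.axioms(1)[OF cring_mpoly_ring] mpoly_ideal.ideal[OF assms(1)] assms(2)])

lemma det3_cat_in:
  assumes "a1 \<in> msets n a" "a2 \<in> msets n a" "a3 \<in> msets n a" "b1 \<in> msets n b" "b2 \<in> msets n b" "b3 \<in> msets n b"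
  shows "det3 cat a1 a2 a3 b1 b2 b3 \<in> I"
proof (cases "distinct [a1, a2, a3] \<and> distinct [b1, b2, b3]")
  case True
  then have "det3 cat a1 a2 a3 b1 b2 b3 \<in> minors 3 (msets n a) (msets n b) (cat :: _ \<Rightarrow> _ \<Rightarrow> (nat multiset, 'k) mpoly)"
    using assms by (intro minors_3I) auto
  then show ?thesis
    using minors_subset by blast
next
  case False
  then have "det3 cat a1 a2 a3 b1 b2 b3 = (0 :: (nat multiset, 'k) mpoly)"
    by auto
  then show ?thesis
    by (simp add: zero_in)
qed

lemma subset_sec_ideal: "I \<subseteq> sec_ideal (msets n (a + b))"
proof (rule minimal[OF mpoly_ideal_sec_ideal], rule subsetI)
  fix p :: "(nat multiset, 'k) mpoly"
  assume "p \<in> minors 3 (msets n a) (msets n b) cat"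
  then obtain a1 a2 a3 b1 b2 b3 where p: "p = det3 cat a1 a2 a3 b1 b2 b3"
    "{a1, a2, a3} \<subseteq> msets n a" "{b1, b2, b3} \<subseteq> msets n b"
    by (rule minors_3E)
  show "p \<in> sec_ideal (msets n (a + b))"
    unfolding p(1) by (rule det3_cat_in_sec_ideal) (use p in \<open>auto intro!: msets_add\<close>)
qed

lemma of_nat_mult_in: "p \<in> I \<Longrightarrow> of_nat m * p \<in> I"
  using const_mult_in[of p "of_nat m"] by (simp add: const_of_nat)

text \<open>The derivative of a minor is a combination of the minors in which one row or one column has one
  letter \<open>j\<close> replaced by \<open>i\<close>; a repeated row or column makes such a minor zero.\<close>

lemma polarize_in:
  assumes f: "f \<in> I" and i: "i \<in> {1..n}"
  shows "polarize i j f \<in> I"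
proof -
  let ?J = "{g \<in> I. polarize i j g \<in> I}"
  have "mpoly_ideal (msets n (a + b)) ?J"
  proof (rule mpoly_idealI)
    show "p * q \<in> ?J" if "p \<in> polys (msets n (a + b))" "q \<in> ?J" for p q
    proof -
      have "polarize i j p * q + p * polarize i j q \<in> I"
        using that by (intro add_in mult_in polarize_polys i) auto
      then show ?thesis
        using that by (simp add: derivation_mult mult_in)
    qed
  qed (simp_all add: zero_in add_in subset_iff subset_polys)
  moreover have "minors 3 (msets n a) (msets n b) cat \<subseteq> ?J"
  proof
    fix p :: "(nat multiset, 'k) mpoly"
    assume pm: "p \<in> minors 3 (msets n a) (msets n b) cat"
    then obtain a1 a2 a3 b1 b2 b3 where p: "p = det3 cat a1 a2 a3 b1 b2 b3"
      "{a1, a2, a3} \<subseteq> msets n a" "{b1, b2, b3} \<subseteq> msets n b"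
      by (rule minors_3E)
    define s where "s \<alpha> = add_mset i (\<alpha> - {#j#})" for \<alpha>
    have pol: "polarize i j (cat \<alpha> \<beta>) =
       of_nat (count \<alpha> j) * cat (s \<alpha>) \<beta> + of_nat (count \<beta> j) * (cat \<alpha> (s \<beta>) :: (nat multiset, 'k) mpoly)" for \<alpha> \<beta>
    proof -
      have e1: "of_nat (count \<alpha> j) * mvar (add_mset i (\<alpha> + \<beta> - {#j#})) = of_nat (count \<alpha> j) * (cat (s \<alpha>) \<beta> :: (nat multiset, 'k) mpoly)"
        by (cases "j \<in># \<alpha>") (auto simp: cat_def s_def not_in_iff)
      have e2: "of_nat (count \<beta> j) * mvar (add_mset i (\<alpha> + \<beta> - {#j#})) = of_nat (count \<beta> j) * (cat \<alpha> (s \<beta>) :: (nat multiset, 'k) mpoly)"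
        by (cases "j \<in># \<beta>") (auto simp: cat_def s_def not_in_iff)
      have "polarize i j (cat \<alpha> \<beta> :: (nat multiset, 'k) mpoly) = of_nat (count \<alpha> j) * mvar (add_mset i (\<alpha> + \<beta> - {#j#}))
          + of_nat (count \<beta> j) * mvar (add_mset i (\<alpha> + \<beta> - {#j#}))"
        by (simp add: cat_def polar_def distrib_right)
      then show ?thesis
        unfolding e1 e2 .
    qed
    let ?D = "det3 cat :: _ \<Rightarrow> _ \<Rightarrow> _ \<Rightarrow> _ \<Rightarrow> _ \<Rightarrow> _ \<Rightarrow> (nat multiset, 'k) mpoly"
    have in_a: "a1 \<in> msets n a" "a2 \<in> msets n a" "a3 \<in> msets n a"
      and in_b: "b1 \<in> msets n b" "b2 \<in> msets n b" "b3 \<in> msets n b"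
      using p(2,3) by auto
    have row: "of_nat (count \<alpha> j) * F (s \<alpha>) \<in> I"
      if "\<alpha> \<in> msets n k" "\<And>\<beta>. \<beta> \<in> msets n k \<Longrightarrow> F \<beta> \<in> I" for \<alpha> k and F :: "_ \<Rightarrow> (nat multiset, 'k) mpoly"
      using that(2) replace_in_msets[OF that(1) i, of j]
      by (cases "j \<in># \<alpha>") (auto simp: not_in_iff zero_in s_def intro: of_nat_mult_in)
    have "polarize i j p =
       of_nat (count a1 j) * ?D (s a1) a2 a3 b1 b2 b3 + of_nat (count a2 j) * ?D a1 (s a2) a3 b1 b2 b3
       + of_nat (count a3 j) * ?D a1 a2 (s a3) b1 b2 b3 + of_nat (count b1 j) * ?D a1 a2 a3 (s b1) b2 b3
       + of_nat (count b2 j) * ?D a1 a2 a3 b1 (s b2) b3 + of_nat (count b3 j) * ?D a1 a2 a3 b1 b2 (s b3)"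
      unfolding p(1) det3_def by (simp add: derivation_mult pol algebra_simps)
    also have "\<dots> \<in> I"
      by (intro add_in row[OF in_a(1), of "\<lambda>x. ?D x a2 a3 b1 b2 b3"] row[OF in_a(2), of "\<lambda>x. ?D a1 x a3 b1 b2 b3"]
        row[OF in_a(3), of "\<lambda>x. ?D a1 a2 x b1 b2 b3"] row[OF in_b(1), of "\<lambda>x. ?D a1 a2 a3 x b2 b3"]
        row[OF in_b(2), of "\<lambda>x. ?D a1 a2 a3 b1 x b3"] row[OF in_b(3), of "\<lambda>x. ?D a1 a2 a3 b1 b2 x"]
        det3_cat_in in_a in_b)
    finally have "polarize i j p \<in> I" .
    then show "p \<in> ?J"
      using pm minors_subset by blast
  qed
  ultimately show ?thesis
    using minimal f by blast
qed

lemma linear_minors_in: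
  assumes ab: "a \<ge> 1" "b \<ge> 2"
    and pqr: "p \<in> {1..n}" "q \<in> {1..n}" "r \<in> {1..n}"
    and b: "b1 \<in> msets n (a + b - 1)" "b2 \<in> msets n (a + b - 1)" "b3 \<in> msets n (a + b - 1)"
  shows "det3 cat {#p#} {#q#} {#r#} b1 b2 b3 \<in> I"
proof -
  obtain s where s: "a = Suc s"
    using ab(1) by (metis Suc_le_D One_nat_def)
  show ?thesis
    using linear_minors_in_ideal[OF mpoly_ideal_axioms, of n s b p q r b1 b2 b3] det3_cat_in ab pqr b s by simp
qed

text \<open>The leading coefficients of the Capelli determinant are multiples of minors of \<open>Cat(1, a + b - 1)\<close>.\<close>

lemma capelli_base:
  assumes ab: "a \<ge> 1" "b \<ge> 2" and pqr: "p \<in> {1..n}" "q \<in> {1..n}" "r \<in> {1..n}"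
    and xyz: "x \<in> msets n (a + b)" "y \<in> msets n (a + b)" "z \<in> msets n (a + b)"
  shows "alt3 (\<lambda>i j k. polar i p x * polar j q y * polar k r z) p q r \<in> I"
proof (cases "p \<in># x \<and> q \<in># y \<and> r \<in># z")
  case True
  have "alt3 (\<lambda>i j k. polar i p x * polar j q y * polar k r z) p q r =
      of_nat (count x p * count y q * count z r) *
      (det3 cat {#p#} {#q#} {#r#} (x - {#p#}) (y - {#q#}) (z - {#r#}) :: (nat multiset, 'k) mpoly)"
    by (simp add: alt3_def polar_def det3_def cat_def algebra_simps)
  moreover have "w - {#l#} \<in> msets n (a + b - 1)" if "l \<in># w" "w \<in> msets n (a + b)" for l w
  proof -
    have "set_mset (w - {#l#}) \<subseteq> set_mset w"
      by (auto dest: in_diffD)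
    then show ?thesis
      using that by (simp add: msets_def size_Diff_singleton subset_iff)
  qed
  then have "det3 cat {#p#} {#q#} {#r#} (x - {#p#}) (y - {#q#}) (z - {#r#}) \<in> I"
    using True xyz by (intro linear_minors_in ab pqr) auto
  ultimately show ?thesis
    by (simp only: of_nat_mult_in)
next
  case False
  then show ?thesis
    by (auto simp: alt3_def polar_def not_in_iff zero_in)
qed

end

section \<open>Highest weight vectors and reduction to two letters\<close>

text \<open>The weight of a monomial in the \<open>z\<^sub>\<gamma>\<close> is the multiset of all letters occurring in it.\<close>

definition weight_in :: "'l multiset \<Rightarrow> ('l multiset, 'k::comm_ring_1) mpoly \<Rightarrow> bool" where
  "weight_in \<nu> f \<longleftrightarrow> (\<forall>M\<in>Poly_Mapping.keys f. \<Sum>\<^sub># M = \<nu>)"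

lemma weight_in_add: "weight_in \<nu> p \<Longrightarrow> weight_in \<nu> q \<Longrightarrow> weight_in \<nu> (p + q)"
  using Poly_Mapping.keys_add[of p q] by (auto simp: weight_in_def)

lemma weight_in_mult: "weight_in \<mu> p \<Longrightarrow> weight_in \<nu> q \<Longrightarrow> weight_in (\<mu> + \<nu>) (p * q)"
  using keys_mult[of p q] by (fastforce simp: weight_in_def)

lemma weight_in_const_mult: "weight_in \<nu> q \<Longrightarrow> weight_in \<nu> (const c * q)"
  using keys_mult[of "const c" q] by (fastforce simp: weight_in_def const_def split: if_splits)

lemma weight_in_simps [simp]: "weight_in \<nu> 0" "weight_in \<nu> (Poly_Mapping.single M c) \<longleftrightarrow> c = 0 \<or> \<Sum>\<^sub># M = \<nu>"
  by (auto simp: weight_in_def)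

lemma weight_in_mvar: "weight_in \<gamma> (mvar \<gamma>)"
  by (simp add: mvar_def)

lemma weight_in_polar: "weight_in (add_mset i (\<gamma> - {#j#})) (polar i j \<gamma>)"
  unfolding polar_def const_of_nat[symmetric] by (intro weight_in_const_mult weight_in_mvar)

lemma polarize_single:
  "(j \<in># \<Sum>\<^sub># M \<longrightarrow> weight_in (add_mset i (\<Sum>\<^sub># M - {#j#})) (polarize i j (Poly_Mapping.single M c)))
    \<and> (j \<notin># \<Sum>\<^sub># M \<longrightarrow> polarize i j (Poly_Mapping.single M c) = 0)"
proof (induction M)
  case empty
  show ?case by (simp flip: const_def)
next
  case (add \<gamma> M)
  let ?s = "Poly_Mapping.single M c"
  let ?w = "add_mset i (\<gamma> + \<Sum>\<^sub># M - {#j#})"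
  have eq: "polarize i j (Poly_Mapping.single (add_mset \<gamma> M) c) = polar i j \<gamma> * ?s + mvar \<gamma> * polarize i j ?s"
    by (simp add: single_add_mset derivation_mult)
  have "weight_in ?w (polar i j \<gamma> * ?s)" if "j \<in># \<gamma>"
  proof -
    have "add_mset i (\<gamma> - {#j#}) + \<Sum>\<^sub># M = ?w"
      using that by simp
    then show ?thesis
      using weight_in_mult[OF weight_in_polar[of i \<gamma> j], of "\<Sum>\<^sub># M" ?s] by simp
  qed
  moreover have z: "polar i j \<gamma> = (0 :: ('a multiset, 'b) mpoly)" if "j \<notin># \<gamma>"
    using that by (simp add: polar_def not_in_iff)
  ultimately have 1: "weight_in ?w (polar i j \<gamma> * ?s)"
    by (cases "j \<in># \<gamma>") simp_all
  have "weight_in ?w (mvar \<gamma> * polarize i j ?s)" if "j \<in># \<Sum>\<^sub># M"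
  proof -
    have "\<gamma> + add_mset i (\<Sum>\<^sub># M - {#j#}) = ?w"
      using that by simp
    then show ?thesis
      using weight_in_mult[OF weight_in_mvar[of \<gamma>], of _ "polarize i j ?s"] add that by metis
  qed
  then have 2: "weight_in ?w (mvar \<gamma> * polarize i j ?s)"
    using add by (cases "j \<in># \<Sum>\<^sub># M") simp_all
  show ?case
    unfolding eq using weight_in_add[OF 1 2] z add by auto
qed

lemma weight_in_induct [consumes 1, case_names zero single add]:
  assumes "weight_in \<nu> f" "P 0" "\<And>M c. \<Sum>\<^sub># M = \<nu> \<Longrightarrow> P (Poly_Mapping.single M c)"
    "\<And>p q. P p \<Longrightarrow> P q \<Longrightarrow> P (p + q)"
  shows "P f"
proof -
  have "Poly_Mapping.keys f \<subseteq> {M. \<Sum>\<^sub># M = \<nu>}"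
    using assms(1) by (auto simp: weight_in_def)
  then show ?thesis
    by (induction f rule: poly_mapping_induct_in) (auto intro: assms(2-))
qed

lemma weight_in_polarize:
  "weight_in \<nu> f \<Longrightarrow> j \<in># \<nu> \<Longrightarrow> weight_in (add_mset i (\<nu> - {#j#})) (polarize i j f)"
proof (induction f rule: weight_in_induct)
  case (single M c)
  then show ?case
    using polarize_single[of j M i c] by auto
qed (simp_all add: weight_in_add)

lemma polarize_eq_0:
  "weight_in \<nu> f \<Longrightarrow> j \<notin># \<nu> \<Longrightarrow> polarize i j f = 0"
proof (induction f rule: weight_in_induct)
  case (single M c)
  then show ?case
    using polarize_single[of j M i c] by auto
qed simp_all

lemma lookup_const_mult: "Poly_Mapping.lookup (const c * p) M = c * Poly_Mapping.lookup p M"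
proof (induction p rule: poly_mapping_induct_in[OF subset_UNIV, case_names zero single add])
  case (single M' c')
  then show ?case
    by (simp add: const_def mult_single lookup_single when_def)
qed (simp_all add: distrib_left lookup_add)

lemma polarize_diag_single:
  "polarize i i (Poly_Mapping.single M c) = of_nat (count (\<Sum>\<^sub># M) i) * Poly_Mapping.single M c"
proof (induction M)
  case empty
  show ?case by (simp flip: const_def)
next
  case (add \<gamma> M)
  have "polar i i \<gamma> = of_nat (count \<gamma> i) * (mvar \<gamma> :: ('a multiset, 'b) mpoly)"
    by (cases "i \<in># \<gamma>") (auto simp: polar_def not_in_iff)
  then show ?case
    using add by (simp add: single_add_mset derivation_mult algebra_simps)
qed

lemma lookup_polarize_diag:
  "Poly_Mapping.lookup (polarize i i f) M = of_nat (count (\<Sum>\<^sub># M) i) * Poly_Mapping.lookup f M"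
proof (induction f rule: poly_mapping_induct_in[OF subset_UNIV, case_names zero single add])
  case (single M' c)
  then show ?case
    unfolding polarize_diag_single const_of_nat[symmetric] lookup_const_mult
    by (auto simp: lookup_single when_def)
qed (simp_all add: distrib_left lookup_add)

lemma polarize_diag:
  "weight_in \<nu> f \<Longrightarrow> polarize i i f = of_nat (count \<nu> i) * f"
  by (induction f rule: weight_in_induct) (simp_all add: polarize_diag_single distrib_left)

text \<open>If two weights occur in \<open>f\<close> and differ at \<open>i\<close>, then subtracting from \<open>H i f\<close> its eigenvalue on either
  weight space removes that weight. If both results were in \<open>I\<close>, so would be their difference, a
  nonzero multiple of \<open>f\<close>.\<close>

lemma (in mpoly_ideal) weight_vector_outside:
  fixes J :: "('x, 'k) mpoly set" and H :: "'i \<Rightarrow> ('x, 'k) mpoly \<Rightarrow> ('x, 'k) mpoly"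
    and wt :: "'x multiset \<Rightarrow> 'i multiset"
  assumes J: "mpoly_ideal X J"
    and H: "\<And>i f. i \<in> L \<Longrightarrow> f \<in> J \<Longrightarrow> H i f \<in> J"
    and lookup_H: "\<And>i f M. Poly_Mapping.lookup (H i f) M = of_nat (count (wt M) i) * Poly_Mapping.lookup f M"
    and wt: "\<And>M. set_mset M \<subseteq> X \<Longrightarrow> set_mset (wt M) \<subseteq> L"
    and f: "f \<in> J" "f \<notin> I"
  shows "\<exists>g \<nu>. g \<in> J \<and> g \<notin> I \<and> (\<forall>M\<in>Poly_Mapping.keys g. wt M = \<nu>)"
  using f
proof (induction "card (wt ` Poly_Mapping.keys f)" arbitrary: f rule: less_induct)
  case less
  interpret J: mpoly_ideal X J by fact
  show ?case
  proof (cases "\<exists>M1\<in>Poly_Mapping.keys f. \<exists>M2\<in>Poly_Mapping.keys f. wt M1 \<noteq> wt M2")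
    case False
    then show ?thesis
      using less.prems by metis
  next
    case True
    then obtain M1 M2 where M: "M1 \<in> Poly_Mapping.keys f" "M2 \<in> Poly_Mapping.keys f" "wt M1 \<noteq> wt M2"
      by blast
    then obtain i where i: "count (wt M1) i \<noteq> count (wt M2) i"
      by (auto simp: multiset_eq_iff)
    have "f \<in> polys X"
      using J.subset_polys less.prems by blast
    then have "set_mset (wt M1) \<subseteq> L" "set_mset (wt M2) \<subseteq> L"
      using M wt by (auto simp: polys_iff)
    moreover have "i \<in># wt M1 \<or> i \<in># wt M2"
      using i by (auto simp: not_in_iff)
    ultimately have iL: "i \<in> L"
      by blast
    define g where "g c = H i f - const (of_nat c) * f" for c :: nat
    have smaller: "card (wt ` Poly_Mapping.keys (g (count (wt M) i))) < card (wt ` Poly_Mapping.keys f)"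
      if "M \<in> Poly_Mapping.keys f" for M
    proof -
      have look: "Poly_Mapping.lookup (g (count (wt M) i)) N =
        (of_nat (count (wt N) i) - of_nat (count (wt M) i)) * Poly_Mapping.lookup f N" for N
        by (simp add: g_def lookup_minus lookup_H lookup_const_mult left_diff_distrib)
      have "wt ` Poly_Mapping.keys (g (count (wt M) i)) \<subseteq> wt ` Poly_Mapping.keys f - {wt M}"
        by (auto simp: in_keys_iff look)
      then have "wt ` Poly_Mapping.keys (g (count (wt M) i)) \<subset> wt ` Poly_Mapping.keys f"
        using that by blast
      then show ?thesis
        by (intro psubset_card_mono) auto
    qed
    have g_J: "g c \<in> J" for c
      unfolding g_def using less.prems H iL by (intro J.diff_in J.const_mult_in) auto
    show ?thesis
    proof (cases "g (count (wt M1) i) \<in> I \<and> g (count (wt M2) i) \<in> I")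
      case False
      then show ?thesis
        using less.hyps[OF smaller[OF M(1)] g_J] less.hyps[OF smaller[OF M(2)] g_J] by blast
    next
      case True
      have "g (count (wt M1) i) - g (count (wt M2) i) = const (of_nat (count (wt M2) i) - of_nat (count (wt M1) i)) * f"
        by (simp add: g_def const_diff algebra_simps)
      then have "const (of_nat (count (wt M2) i) - of_nat (count (wt M1) i)) * f \<in> I"
        using True diff_in by metis
      then have "f \<in> I"
        using i by (subst (asm) const_mult_in_iff) auto
      then show ?thesis
        using less.prems by blast
    qed
  qed
qed

text \<open>Raising operators replace a letter by a smaller one, so they decrease the sum of the letters of the weight.
  By induction on this sum, a weight vector of the secant ideal may be assumed to be a highest weight
  vector modulo \<open>I\<close>, and the Capelli determinant excludes any letter beyond two from its weight.\<close>

lemma (in catalecticant) sec_ideal_subset: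
  assumes ab: "a \<ge> 1" "b \<ge> 2" and n: "n \<ge> 2"
    and binary: "\<And>f. \<lbrakk>f \<in> sec_ideal (msets n (a + b)); f \<in> polys (msets 2 (a + b))\<rbrakk> \<Longrightarrow> f \<in> I"
  shows "sec_ideal (msets n (a + b)) \<subseteq> I"
proof
  let ?X = "msets n (a + b)"
  let ?J = "sec_ideal ?X :: (nat multiset, 'k) mpoly set"
  interpret J: mpoly_ideal ?X ?J
    by (rule mpoly_ideal_sec_ideal)
  have hwv: "f \<in> I" if "weight_in \<nu> f" "f \<in> ?J" for \<nu> f
    using that
  proof (induction "\<Sum>\<^sub># \<nu>" arbitrary: \<nu> f rule: less_induct)
    case less
    have fX: "f \<in> polys ?X"
      by (rule J.subset_polys[OF less.prems(2)])
    have raise: "polarize i j f \<in> I" if "i < j" "i \<in> {1..n}" for i j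
    proof (cases "j \<in># \<nu>")
      case True
      then obtain \<nu>' where "\<nu> = add_mset j \<nu>'"
        by (metis multi_member_split)
      then have "\<Sum>\<^sub># (add_mset i (\<nu> - {#j#})) < \<Sum>\<^sub># \<nu>"
        using that by simp
      then show ?thesis
        using less.hyps weight_in_polarize[OF less.prems(1) True] polarize_sec_ideal[OF less.prems(2) that(2)] by blast
    next
      case False
      then show ?thesis
        using polarize_eq_0[OF less.prems(1)] by (simp add: zero_in)
    qed
    have wt: "\<Sum>\<^sub># M = \<nu>" if "M \<in> Poly_Mapping.keys f" for M
      using less.prems(1) that unfolding weight_in_def by blast
    have letters: "set_mset \<gamma> \<subseteq> set_mset \<nu>" if "M \<in> Poly_Mapping.keys f" "\<gamma> \<in># M" for M \<gamma>
      using wt[OF that(1)] that(2) by auto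
    have vars: "\<gamma> \<in> ?X" if "M \<in> Poly_Mapping.keys f" "\<gamma> \<in># M" for M \<gamma>
      using fX that unfolding polys_iff by blast
    show ?case
    proof (cases "set_mset \<nu> \<subseteq> {1..2}")
      case True
      have "\<gamma> \<in> msets 2 (a + b)" if "M \<in> Poly_Mapping.keys f" "\<gamma> \<in># M" for M \<gamma>
        using letters[OF that] vars[OF that] True unfolding msets_def by blast
      then have "f \<in> polys (msets 2 (a + b))"
        unfolding polys_iff by blast
      then show ?thesis
        using binary less.prems by blast
    next
      case False
      show ?thesis
      proof (cases "f = 0")
        case False
        then obtain M where M: "M \<in> Poly_Mapping.keys f"
          by fastforce
        have \<nu>: "set_mset \<nu> \<subseteq> {1..n}"
          using wt[OF M] vars[OF M] unfolding msets_def by auto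
        obtain k where k: "k \<in># \<nu>" "k \<notin> {1..2}"
          using \<open>\<not> set_mset \<nu> \<subseteq> {1..2}\<close> by blast
        with \<nu> have kn: "k \<in> {1..n}" "k > 2"
          by (auto simp: subset_iff)
        have pqr: "1 \<in> {1..n}" "2 \<in> {1..n}"
          using n by auto
        have "of_nat ((count \<nu> 1 + 2) * (count \<nu> 2 + 1) * count \<nu> k) * f \<in> I"
        proof (rule capelli_in_ideal[OF mpoly_ideal_axioms])
          show "distinct [1, 2, k]"
            using kn by auto
          show "f \<in> polys ?X" by fact
          show "alt3 (\<lambda>i j ka. polar i 1 x * polar j 2 y * polar ka k z) 1 2 k \<in> I"
            if "x \<in> ?X" "y \<in> ?X" "z \<in> ?X" for x y z
            using that by (intro capelli_base ab pqr kn)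
          show "polarize i j g \<in> I" if "i \<in> {1, 2, k}" "j \<in> {1, 2, k}" "g \<in> I" for i j g
            using that pqr kn by (intro polarize_in) auto
          show "polarize 1 2 f \<in> I" "polarize 1 k f \<in> I" "polarize 2 k f \<in> I"
            using kn pqr by (auto intro!: raise)
        qed (rule polarize_diag[OF less.prems(1)])+
        moreover have "(count \<nu> 1 + 2) * (count \<nu> 2 + 1) * count \<nu> k \<noteq> 0"
          using k by simp
        ultimately show ?thesis
          by (rule of_nat_mult_in_iff[THEN iffD1, rotated])
      qed (simp add: zero_in)
    qed
  qed
  fix f assume f: "f \<in> ?J"
  show "f \<in> I"
  proof (rule ccontr)
    assume out: "f \<notin> I"
    have "\<exists>g \<nu>. g \<in> ?J \<and> g \<notin> I \<and> (\<forall>M\<in>Poly_Mapping.keys g. \<Sum>\<^sub># M = \<nu>)"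
    proof (rule weight_vector_outside[OF mpoly_ideal_sec_ideal _ _ _ f out])
      show "polarize i i f \<in> ?J" if "i \<in> {1..n}" "f \<in> ?J" for i f
        using that polarize_sec_ideal by blast
      show "set_mset (\<Sum>\<^sub># M) \<subseteq> {1..n}" if "set_mset M \<subseteq> ?X" for M
      proof -
        have "set_mset \<gamma> \<subseteq> {1..n}" if "\<gamma> \<in># M" for \<gamma>
          using \<open>set_mset M \<subseteq> ?X\<close> that unfolding msets_def by blast
        then show ?thesis
          unfolding in_Union_mset_iff subset_iff by blast
      qed
    qed (rule lookup_polarize_diag)
    then show False
      using hwv unfolding weight_in_def by blast
  qed
qed

section \<open>Clustered multisets\<close>

text \<open>The index multisets of the monomials divisible by no main diagonal of a \<open>3 \<times> 3\<close> minor of a Hankel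
  matrix: chains of three indices with gaps of at least two are excluded, so the multiset splits into
  two parts each of which uses at most two consecutive numbers.\<close>

definition clustered :: "nat multiset \<Rightarrow> bool" where
  "clustered J \<longleftrightarrow> (\<forall>x\<in>#J. \<forall>y\<in>#J. \<forall>z\<in>#J. \<not> (x + 2 \<le> y \<and> y + 2 \<le> z))"

text \<open>A multiset that uses two consecutive numbers is determined by its size and sum.\<close>

lemma balanced_eq:
  fixes R :: "nat multiset"
  assumes "\<forall>y\<in>#R. \<forall>z\<in>#R. z < y + 2" and R: "R \<noteq> {#}"
  shows "R = replicate_mset (size R - \<Sum>\<^sub># R mod size R) (\<Sum>\<^sub># R div size R)
           + replicate_mset (\<Sum>\<^sub># R mod size R) (Suc (\<Sum>\<^sub># R div size R))"
proof -
  define j where "j = Min (set_mset R)"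
  have j: "j \<in># R" "\<forall>x\<in>#R. j \<le> x"
    using R by (auto simp: j_def)
  have el: "x = j \<or> x = Suc j" if "x \<in># R" for x
    using assms(1) j that by (metis add_2_eq_Suc' le_antisym less_Suc_eq_le not_less_eq_eq)
  have split: "R = replicate_mset (count R j) j + replicate_mset (count R (Suc j)) (Suc j)"
  proof (rule multiset_eqI)
    fix x
    show "count R x = count (replicate_mset (count R j) j + replicate_mset (count R (Suc j)) (Suc j)) x"
      using el[of x] by (cases "x \<in># R") (auto simp: not_in_iff)
  qed
  define \<beta> where "\<beta> = count R (Suc j)"
  have size: "size R = count R j + \<beta>"
    using arg_cong[OF split, of size] by (simp add: \<beta>_def)
  have sum: "\<Sum>\<^sub># R = \<beta> + j * size R"
    using arg_cong[OF split, of sum_mset] size by (simp add: \<beta>_def algebra_simps)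
  have "\<beta> < size R"
    using j(1) size by simp
  then have "\<Sum>\<^sub># R div size R = j" "\<Sum>\<^sub># R mod size R = \<beta>"
    unfolding sum using R by simp_all
  moreover have "size R - \<beta> = count R j"
    using size by simp
  ultimately show ?thesis
    using split by (simp add: \<beta>_def)
qed

lemma balanced_unique:
  fixes R R' :: "nat multiset"
  assumes "\<forall>y\<in>#R. \<forall>z\<in>#R. z < y + 2" "\<forall>y\<in>#R'. \<forall>z\<in>#R'. z < y + 2"
    and "size R = size R'" "\<Sum>\<^sub># R = \<Sum>\<^sub># R'"
  shows "R = R'"
proof (cases "R = {#}")
  case True
  then show ?thesis using assms by simp
next
  case False
  then have "R' \<noteq> {#}"
    using assms(3) by auto
  then show ?thesis
    using balanced_eq[OF assms(1) False] balanced_eq[OF assms(2)] assms(3,4) by metis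
qed

lemma sum_mset_lower_bound:
  fixes N :: "nat multiset"
  assumes "\<forall>x\<in>#N. i \<le> x"
  shows "\<Sum>\<^sub># N + count N i \<ge> Suc i * size N"
    and "\<Sum>\<^sub># N + count N i = Suc i * size N \<Longrightarrow> set_mset N \<subseteq> {i, Suc i}"
proof -
  have "\<Sum>\<^sub># N + count N i \<ge> Suc i * size N \<and> (\<Sum>\<^sub># N + count N i = Suc i * size N \<longrightarrow> set_mset N \<subseteq> {i, Suc i})"
    using assms
  proof (induction N)
    case (add x N)
    then show ?case
      by (cases "x = i") auto
  qed simp
  then show "\<Sum>\<^sub># N + count N i \<ge> Suc i * size N"
    "\<Sum>\<^sub># N + count N i = Suc i * size N \<Longrightarrow> set_mset N \<subseteq> {i, Suc i}"
    by auto
qed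

text \<open>The lower cluster of \<open>J\<close> consists of the elements \<open>i\<close> and \<open>i + 1\<close>. As \<open>J'\<close> contains at most as many copies
  of the minimum \<open>i\<close>, a part \<open>N\<close> of \<open>J'\<close> with the size and sum of this cluster must be equal to it, and what is
  left of \<open>J\<close> and \<open>J'\<close> is balanced with the same size and sum.\<close>

lemma clustered_unique:
  fixes J J' N :: "nat multiset"
  defines "i \<equiv> Min (set_mset J)"
  assumes cl: "clustered J" "clustered J'" and J: "J \<noteq> {#}"
    and eq: "size J = size J'" "\<Sum>\<^sub># J = \<Sum>\<^sub># J'"
    and J'_min: "\<forall>x\<in>#J'. i \<le> x" and cnt: "count J' i \<le> count J i"
    and cnt': "count J' i = count J i \<Longrightarrow> count J' (Suc i) \<le> count J (Suc i)"
    and N: "N \<subseteq># J'" "size N = count J i + count J (Suc i)"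
      "\<Sum>\<^sub># N = i * size N + count J (Suc i)"
  shows "J = J'"
proof -
  have i: "i \<in># J" "\<forall>x\<in>#J. i \<le> x"
    using J by (auto simp: i_def)
  have N_min: "\<forall>x\<in>#N. i \<le> x"
    using J'_min set_mset_mono[OF N(1)] by (simp add: subset_iff)
  have cN: "count N x \<le> count J' x" for x
    using N(1) by (rule mset_subset_eq_count)
  have "count N i \<ge> count J i"
    using sum_mset_lower_bound(1)[OF N_min] N(2,3) by simp
  then have cNi: "count N i = count J i" "count J' i = count J i"
    using cN[of i] cnt by linarith+
  then have "set_mset N \<subseteq> {i, Suc i}"
    using sum_mset_lower_bound(2)[OF N_min] N(2,3) by simp
  then have N_split: "N = replicate_mset (count N i) i + replicate_mset (count N (Suc i)) (Suc i)"
    by (intro multiset_eqI) (auto simp: not_in_iff subset_iff)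
  have "size N = count N i + count N (Suc i)"
    using arg_cong[OF N_split, of size] by simp
  then have cNi': "count N (Suc i) = count J (Suc i)"
    using N(2) cNi by simp
  then have cJ': "count J' (Suc i) = count J (Suc i)"
    using cN[of "Suc i"] cnt' cNi by simp
  have N_J: "N \<subseteq># J"
  proof (rule mset_subset_eqI)
    fix x show "count N x \<le> count J x"
      by (subst N_split) (auto simp: cNi cNi')
  qed
  have rest: "\<forall>y\<in>#K - N. \<forall>z\<in>#K - N. z < y + 2"
    if K: "clustered K" "i \<in># K" "\<forall>x\<in>#K. i \<le> x" "count K i = count N i" "count K (Suc i) = count N (Suc i)" for K
  proof (intro ballI)
    fix y z assume yz: "y \<in># K - N" "z \<in># K - N"
    then have "y \<noteq> i" "y \<noteq> Suc i"
      using K(4,5) by (auto simp: in_diff_count)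
    moreover have "y \<in># K" "z \<in># K"
      using yz by (auto dest: in_diffD)
    ultimately have "i + 2 \<le> y"
      using K(3) by (metis Suc_leI add_2_eq_Suc' le_neq_implies_less)
    then show "z < y + 2"
      using K(1,2) \<open>y \<in># K\<close> \<open>z \<in># K\<close> unfolding clustered_def by (meson not_le)
  qed
  have "i \<in># J'"
    using cNi i by (metis count_greater_zero_iff)
  have "J - N = J' - N"
  proof (rule balanced_unique)
    show "\<forall>y\<in>#J - N. \<forall>z\<in>#J - N. z < y + 2"
      using rest[OF cl(1) i] cNi cNi' by simp
    show "\<forall>y\<in>#J' - N. \<forall>z\<in>#J' - N. z < y + 2"
      using rest[OF cl(2) \<open>i \<in># J'\<close> J'_min] cNi cNi' cJ' by simp
    show "size (J - N) = size (J' - N)"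
      using N_J N(1) eq(1) by (simp add: size_Diff_submset)
    show "\<Sum>\<^sub># (J - N) = \<Sum>\<^sub># (J' - N)"
      using N_J N(1) eq(2) by (simp add: sum_mset_diff)
  qed
  then show ?thesis
    using N_J N(1) by (metis subset_mset.diff_add)
qed

text \<open>The coefficient counts the ways to choose one summand in each factor.\<close>

lemma coeff_prod_two_monoms:
  fixes e e' :: "'x \<Rightarrow> nat"
  defines "U \<equiv> (\<lambda>x. monom 1 (e x) + monom 1 (e' x) :: 'k::field_char_0 poly)"
  shows "\<exists>c. coeff (\<Prod>x\<in>#M. U x) E = of_nat c \<and>
    (c > 0 \<longleftrightarrow> (\<exists>N. N \<subseteq># M \<and> (\<Sum>x\<in>#N. e x) + (\<Sum>x\<in>#M - N. e' x) = E))"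
proof (induction M arbitrary: E)
  case empty
  show ?case
    by (cases "E = 0") (auto intro: exI[of _ "if E = 0 then 1 else 0"])
next
  case (add x M)
  let ?Q = "\<lambda>M E. \<exists>N. N \<subseteq># M \<and> (\<Sum>x\<in>#N. e x) + (\<Sum>x\<in>#M - N. e' x) = E"
  have shift: "\<exists>c. (if E < k then 0 else coeff (\<Prod>x\<in>#M. U x) (E - k)) = of_nat c \<and>
      (c > 0 \<longleftrightarrow> k \<le> E \<and> ?Q M (E - k))" for k
  proof (cases "E < k")
    case True
    then show ?thesis by (intro exI[of _ 0]) auto
  next
    case False
    then show ?thesis using add.IH[of "E - k"] by auto
  qed
  obtain c1 where c1: "(if E < e x then 0 else coeff (\<Prod>x\<in>#M. U x) (E - e x)) = of_nat c1"
    "c1 > 0 \<longleftrightarrow> e x \<le> E \<and> ?Q M (E - e x)"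
    using shift by blast
  obtain c2 where c2: "(if E < e' x then 0 else coeff (\<Prod>x\<in>#M. U x) (E - e' x)) = of_nat c2"
    "c2 > 0 \<longleftrightarrow> e' x \<le> E \<and> ?Q M (E - e' x)"
    using shift by blast
  have "coeff (\<Prod>x\<in>#add_mset x M. U x) E = of_nat (c1 + c2)"
    using c1(1) c2(1) by (simp add: U_def distrib_right coeff_monom_mult not_less split: if_splits)
  moreover have "?Q (add_mset x M) E \<longleftrightarrow> (e x \<le> E \<and> ?Q M (E - e x)) \<or> (e' x \<le> E \<and> ?Q M (E - e' x))"
  proof
    assume "?Q (add_mset x M) E"
    then obtain N where N: "N \<subseteq># add_mset x M" "(\<Sum>x\<in>#N. e x) + (\<Sum>x\<in>#add_mset x M - N. e' x) = E"
      by blast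
    show "(e x \<le> E \<and> ?Q M (E - e x)) \<or> (e' x \<le> E \<and> ?Q M (E - e' x))"
    proof (cases "x \<in># N")
      case True
      then obtain N1 where N1: "N = add_mset x N1"
        by (metis multi_member_split)
      then have "N1 \<subseteq># M" "E = e x + ((\<Sum>x\<in>#N1. e x) + (\<Sum>x\<in>#M - N1. e' x))"
        using N by auto
      then show ?thesis
        by (intro disjI1) auto
    next
      case False
      have "count N y \<le> count M y" for y
        using mset_subset_eq_count[OF N(1), of y] False by (cases "y = x") (auto simp: not_in_iff)
      then have NM: "N \<subseteq># M"
        by (rule mset_subset_eqI)
      then have "add_mset x M - N = add_mset x (M - N)"
        by (auto simp: multiset_eq_iff Suc_diff_le mset_subset_eq_count)
      then have "E = e' x + ((\<Sum>x\<in>#N. e x) + (\<Sum>x\<in>#M - N. e' x))"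
        using N(2) by simp
      then show ?thesis
        using NM by (intro disjI2) auto
    qed
  next
    assume "(e x \<le> E \<and> ?Q M (E - e x)) \<or> (e' x \<le> E \<and> ?Q M (E - e' x))"
    then show "?Q (add_mset x M) E"
    proof
      assume "e x \<le> E \<and> ?Q M (E - e x)"
      then obtain N where "N \<subseteq># M" "(\<Sum>x\<in>#N. e x) + (\<Sum>x\<in>#M - N. e' x) = E - e x" "e x \<le> E"
        by blast
      then show ?thesis
        by (intro exI[of _ "add_mset x N"]) auto
    next
      assume "e' x \<le> E \<and> ?Q M (E - e' x)"
      then obtain N where N: "N \<subseteq># M" "(\<Sum>x\<in>#N. e x) + (\<Sum>x\<in>#M - N. e' x) = E - e' x" "e' x \<le> E"
        by blast
      then have "add_mset x M - N = add_mset x (M - N)"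
        by (auto simp: multiset_eq_iff Suc_diff_le mset_subset_eq_count)
      moreover have "N \<subseteq># add_mset x M"
        using N(1) by (rule subset_mset.trans) simp
      ultimately show ?thesis
        using N(2,3) by (intro exI[of _ N]) simp
    qed
  qed
  ultimately show ?case
    using c1(2) c2(2) by (intro exI[of _ "c1 + c2"]) auto
qed

lemma digits_unique:
  fixes B :: nat
  assumes "p0 < B" "p1 < B" "p2 < B" "q0 < B" "q1 < B" "q2 < B"
    and "p0 + B * (p1 + B * (p2 + B * p3)) = q0 + B * (q1 + B * (q2 + B * q3))"
  shows "p0 = q0" "p1 = q1" "p2 = q2" "p3 = q3"
proof -
  have dm: "(p + B * x) mod B = p" "(p + B * x) div B = x" if "p < B" for p x
    using that by simp_all
  have digit: "p = q \<and> x = y" if "p < B" "q < B" "p + B * x = q + B * y" for p q x y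
    using dm[OF that(1), of x] dm[OF that(2), of y] that(3) by simp
  show "p0 = q0" "p1 = q1" "p2 = q2" "p3 = q3"
    using assms digit by blast+
qed

section \<open>Binary forms\<close>

text \<open>The monomial \<open>x\<^sub>1\<^bsup>d - i\<^esup> x\<^sub>2\<^bsup>i\<^esup>\<close>; \<open>index\<close> recovers \<open>i\<close>.\<close>

definition binary :: "nat \<Rightarrow> nat \<Rightarrow> nat multiset" where
  "binary d i = replicate_mset (d - i) 1 + replicate_mset i 2"

abbreviation index :: "nat multiset \<Rightarrow> nat" where
  "index \<gamma> \<equiv> count \<gamma> 2"

lemma binary_index:
  assumes "\<gamma> \<in> msets 2 d"
  shows "binary d (index \<gamma>) = \<gamma>" "index \<gamma> \<le> d"
proof -
  have split: "\<gamma> = replicate_mset (count \<gamma> 1) 1 + replicate_mset (count \<gamma> 2) 2"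
  proof (rule multiset_eqI)
    fix x
    have "x = 1 \<or> x = 2" if "x \<in># \<gamma>"
      using assms that by (auto simp: msets_def subset_iff)
    then show "count \<gamma> x = count (replicate_mset (count \<gamma> 1) 1 + replicate_mset (count \<gamma> 2) 2) x"
      by (cases "x \<in># \<gamma>") (auto simp: not_in_iff)
  qed
  have "size \<gamma> = count \<gamma> 1 + count \<gamma> 2"
    using arg_cong[OF split, of size] by simp
  then have d: "d = count \<gamma> 1 + count \<gamma> 2"
    using assms by (simp add: msets_def)
  show "binary d (index \<gamma>) = \<gamma>"
    unfolding binary_def d using split by simp
  show "index \<gamma> \<le> d"
    using d by simp
qed

lemma index_binary [simp]: "index (binary d i) = i"
  by (simp add: binary_def)

lemma binary_in_msets: "n \<ge> 2 \<Longrightarrow> i \<le> d \<Longrightarrow> binary d i \<in> msets n d"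
  by (auto simp: binary_def msets_def)

lemma binary_add: "i \<le> a \<Longrightarrow> j \<le> b \<Longrightarrow> binary a i + binary b j = binary (a + b) (i + j)"
  by (auto simp: binary_def multiset_eq_iff)

lemma image_index_inj:
  assumes "set_mset M \<subseteq> msets 2 d" "set_mset M' \<subseteq> msets 2 d" "image_mset index M = image_mset index M'"
  shows "M = M'"
proof -
  have "image_mset (binary d) (image_mset index M) = M" if "set_mset M \<subseteq> msets 2 d" for M
  proof -
    have "image_mset (\<lambda>\<gamma>. binary d (index \<gamma>)) M = image_mset (\<lambda>\<gamma>. \<gamma>) M"
      by (rule image_mset_cong) (use that binary_index in blast)
    then show ?thesis
      by (simp add: image_mset.compositionality comp_def)
  qed
  then show ?thesis
    using assms by metis
qed

lemma prod_mset_index: "(\<Prod>k\<in>#\<gamma>. if k = (2::nat) then c else 1) = (c :: 'k::comm_monoid_mult) ^ index \<gamma>"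
  by (induction \<gamma>) auto

lemma sum_mset_affine: "(\<Sum>\<gamma>\<in>#N. c + m * index \<gamma>) = c * size N + m * \<Sum>\<^sub># (image_mset index N)" for c m :: nat
  by (induction N) (auto simp: algebra_simps)

text \<open>Restrict \<open>g\<close> to the curve of secant points with coefficients \<open>X\<close> and \<open>X\<^sup>B\<close> on the points \<open>(1, X\<^bsup>B\<^sup>2\<^esup>)\<close>
  and \<open>(1, X\<^bsup>B\<^sup>3\<^esup>)\<close> of the rational normal curve. A monomial becomes a sum over all its splittings into two
  parts, and for large \<open>B\<close> the exponent of a summand records the sizes and index sums of both parts.
  Among the monomials of \<open>g\<close> with given size and index sum choose one with the smallest minimal index,
  the most copies of it, and then the most copies of its successor: by \<open>clustered_unique\<close> no
  other monomial of \<open>g\<close> contributes to the exponent of its splitting into lower and upper cluster.\<close>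

lemma clustered_independent:
  fixes g :: "(nat multiset, 'k::field_char_0) mpoly"
  assumes g: "g \<in> polys (msets 2 d)"
    and cl: "\<And>M. M \<in> Poly_Mapping.keys g \<Longrightarrow> clustered (image_mset index M)"
    and vanish: "\<And>s t a b. mpoly_eval (sec_pt s t a b) g = 0"
  shows "g = 0"
proof (rule ccontr)
  assume "g \<noteq> 0"
  let ?S = "Poly_Mapping.keys g"
  let ?J = "image_mset index :: nat multiset multiset \<Rightarrow> nat multiset"
  obtain M0 where M0: "M0 \<in> ?S"
    using \<open>g \<noteq> 0\<close> by fastforce
  define T where "T = {M \<in> ?S. size M = size M0 \<and> \<Sum>\<^sub># (?J M) = \<Sum>\<^sub># (?J M0)}"
  define lo where "lo M = Min (set_mset (?J M))" for M
  define key where "key M = (lo M, size M - count (?J M) (lo M), size M - count (?J M) (Suc (lo M)))" for M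
  have "wf (inv_image (less_than <*lex*> less_than <*lex*> less_than) key)"
    by (intro wf_inv_image wf_lex_prod wf_less_than)
  moreover have "M0 \<in> T"
    using M0 by (simp add: T_def)
  ultimately obtain M where M: "M \<in> T"
    and minimal: "\<And>M'. M' \<in> T \<Longrightarrow> (key M', key M) \<notin> less_than <*lex*> less_than <*lex*> less_than"
    by (rule wfE_min) (auto simp: in_inv_image)
  define N0 where "N0 = filter_mset (\<lambda>\<gamma>. index \<gamma> = lo M \<or> index \<gamma> = Suc (lo M)) M"
  have MS: "M \<in> ?S"
    using M by (simp add: T_def)
  have in_Y: "set_mset M' \<subseteq> msets 2 d" if "M' \<in> ?S" for M'
    using g that by (simp add: polys_iff)
  have N0: "N0 \<subseteq># M"
    by (simp add: N0_def)
  have unique: "M' = M"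
    if M': "M' \<in> ?S" "size M' = size M" "\<Sum>\<^sub># (?J M') = \<Sum>\<^sub># (?J M)"
      and N: "N \<subseteq># M'" "size N = size N0" "\<Sum>\<^sub># (?J N) = \<Sum>\<^sub># (?J N0)" for M' N
  proof (cases "M = {#}")
    case True
    then show ?thesis using M' by simp
  next
    case False
    have M'T: "M' \<in> T"
      using M' M by (auto simp: T_def)
    have J: "?J M \<noteq> {#}" "?J M' \<noteq> {#}"
      using False M'(2) by auto
    have cnt_le: "count (?J M') x \<le> size M" "count (?J M) x \<le> size M" for x
      using count_le_size[of "?J M'" x] count_le_size[of "?J M" x] M'(2) by simp_all
    have lo: "lo M' \<in># ?J M'" "\<forall>x\<in>#?J M'. lo M' \<le> x" "lo M \<in># ?J M" "\<forall>x\<in>#?J M. lo M \<le> x"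
      using J by (auto simp: lo_def simp del: set_image_mset intro!: Min_in Min_le)
    have k1: "lo M \<le> lo M'"
      using minimal[OF M'T] by (auto simp: key_def)
    have k2: "count (?J M') (lo M) \<le> count (?J M) (lo M)" if "lo M' = lo M"
      using minimal[OF M'T] that cnt_le[of "lo M"] M'(2) by (auto simp: key_def)
    have k3: "count (?J M') (Suc (lo M)) \<le> count (?J M) (Suc (lo M))"
      if "lo M' = lo M" "count (?J M') (lo M) = count (?J M) (lo M)"
      using minimal[OF M'T] that cnt_le[of "Suc (lo M)"] M'(2) by (auto simp: key_def)
    have c0: "count (?J M') (lo M) = 0" if "lo M' \<noteq> lo M"
      using lo(2) k1 that by (metis le_antisym not_in_iff)
    have c1: "count (?J M) (lo M) > 0"
      using lo(3) by simp
    have sizeN0: "size N0 = count (?J M) (lo M) + count (?J M) (Suc (lo M))"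
      and sumN0: "\<Sum>\<^sub># (?J N0) = lo M * size N0 + count (?J M) (Suc (lo M))"
    proof -
      have "size (filter_mset (\<lambda>\<gamma>. index \<gamma> = i \<or> index \<gamma> = Suc i) K) = count (?J K) i + count (?J K) (Suc i) \<and>
        \<Sum>\<^sub># (?J (filter_mset (\<lambda>\<gamma>. index \<gamma> = i \<or> index \<gamma> = Suc i) K)) =
          i * size (filter_mset (\<lambda>\<gamma>. index \<gamma> = i \<or> index \<gamma> = Suc i) K) + count (?J K) (Suc i)" for i and K :: "nat multiset multiset"
        by (induction K) auto
      then show "size N0 = count (?J M) (lo M) + count (?J M) (Suc (lo M))"
        "\<Sum>\<^sub># (?J N0) = lo M * size N0 + count (?J M) (Suc (lo M))"
        unfolding N0_def by blast+
    qed
    have "?J M = ?J M'"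
    proof (rule clustered_unique[where N = "?J N"])
      show "clustered (?J M)" "clustered (?J M')"
        using cl MS M'(1) by blast+
      show "\<forall>x\<in>#?J M'. Min (set_mset (?J M)) \<le> x"
        using lo(2) k1 unfolding lo_def by (meson order_trans)
      show "count (?J M') (Min (set_mset (?J M))) \<le> count (?J M) (Min (set_mset (?J M)))"
        using k2 c0 unfolding lo_def by (metis le0)
      show "count (?J M') (Suc (Min (set_mset (?J M)))) \<le> count (?J M) (Suc (Min (set_mset (?J M))))"
        if "count (?J M') (Min (set_mset (?J M))) = count (?J M) (Min (set_mset (?J M)))"
        using that k3 c0 c1 unfolding lo_def by (metis less_irrefl)
      show "?J N \<subseteq># ?J M'"
        using N(1) by (rule image_mset_subseteq_mono)
      show "size (?J N) = count (?J M) (Min (set_mset (?J M))) + count (?J M) (Suc (Min (set_mset (?J M))))"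
        using sizeN0 N(2) unfolding lo_def by simp
      show "\<Sum>\<^sub># (?J N) = Min (set_mset (?J M)) * size (?J N) + count (?J M) (Suc (Min (set_mset (?J M))))"
        using sumN0 N(2,3) unfolding lo_def by simp
    qed (use J M' in simp_all)
    then show ?thesis
      using image_index_inj[OF in_Y[OF MS] in_Y[OF M'(1)]] by simp
  qed
  have split: "size K = size A + size (K - A)" "\<Sum>\<^sub># (?J K) = \<Sum>\<^sub># (?J A) + \<Sum>\<^sub># (?J (K - A))"
    if sub: "A \<subseteq># K" for A K
  proof -
    obtain L where "K = A + L"
      using sub by (rule mset_subset_eq_exists_conv[THEN iffD1, THEN exE])
    then show "size K = size A + size (K - A)" "\<Sum>\<^sub># (?J K) = \<Sum>\<^sub># (?J A) + \<Sum>\<^sub># (?J (K - A))"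
      by simp_all
  qed
  define B where "B = Suc (\<Sum>M\<in>?S. size M + \<Sum>\<^sub># (?J M))"
  have B: "size N < B \<and> \<Sum>\<^sub># (?J N) < B" if "N \<subseteq># M'" "M' \<in> ?S" for N M'
  proof -
    have "size M' + \<Sum>\<^sub># (?J M') \<le> (\<Sum>M\<in>?S. size M + \<Sum>\<^sub># (?J M))"
      using that(2) by (intro member_le_sum) auto
    moreover have "size N \<le> size M'"
      using that(1) by (rule size_mset_mono)
    moreover have "\<Sum>\<^sub># (?J N) \<le> \<Sum>\<^sub># (?J M')"
      using split[OF that(1)] by simp
    ultimately show ?thesis
      by (simp add: B_def)
  qed
  define e where "e \<gamma> = 1 + B ^ 2 * index \<gamma>" for \<gamma> :: "nat multiset"
  define e' where "e' \<gamma> = B + B ^ 3 * index \<gamma>" for \<gamma> :: "nat multiset"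
  define U where "U \<gamma> = (monom 1 (e \<gamma>) + monom 1 (e' \<gamma>) :: 'k poly)" for \<gamma>
  have "poly (psubst U g) x = 0" for x
  proof -
    have "poly (psubst U g) x = mpoly_eval (sec_pt x (x ^ B) (\<lambda>k. if k = 2 then x ^ (B ^ 2) else 1)
        (\<lambda>k. if k = 2 then x ^ (B ^ 3) else 1)) g"
      by (rule poly_psubst[OF g])
         (simp add: U_def sec_pt_def prod_mset_index e_def e'_def poly_monom power_add power_mult)
    then show ?thesis
      using vanish by simp
  qed
  then have zero: "psubst U g = 0"
    using poly_all_0_iff_0 by blast
  define E where "E = (\<Sum>\<gamma>\<in>#N0. e \<gamma>) + (\<Sum>\<gamma>\<in>#M - N0. e' \<gamma>)"
  have expand: "(\<Sum>\<gamma>\<in>#N. e \<gamma>) + (\<Sum>\<gamma>\<in>#N'. e' \<gamma>) =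
     size N + B * (size N' + B * (\<Sum>\<^sub># (?J N) + B * \<Sum>\<^sub># (?J N')))" for N N'
  proof -
    have "1 * s + B ^ 2 * p + (B * s' + B ^ 3 * p') = s + B * (s' + B * (p + B * p'))" for s p s' p' :: nat
      by (simp add: power2_eq_square power3_eq_cube algebra_simps)
    then show ?thesis
      unfolding e_def e'_def sum_mset_affine .
  qed
  have coeff: "coeff (\<Prod>\<gamma>\<in>#M'. U \<gamma>) E = 0" if M': "M' \<in> ?S" "M' \<noteq> M" for M'
  proof (rule ccontr)
    assume ne: "coeff (\<Prod>\<gamma>\<in>#M'. U \<gamma>) E \<noteq> 0"
    obtain c where c: "coeff (\<Prod>\<gamma>\<in>#M'. U \<gamma>) E = of_nat c"
      "c > 0 \<longleftrightarrow> (\<exists>N. N \<subseteq># M' \<and> (\<Sum>x\<in>#N. e x) + (\<Sum>x\<in>#M' - N. e' x) = E)"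
      unfolding U_def using coeff_prod_two_monoms[of e e' M' E] by blast
    with ne have "c > 0"
      by (intro gr0I) auto
    then obtain N where N: "N \<subseteq># M'" "(\<Sum>x\<in>#N. e x) + (\<Sum>x\<in>#M' - N. e' x) = E"
      using c(2) by blast
    have sub: "M' - N \<subseteq># M'" "M - N0 \<subseteq># M"
      by simp_all
    note eqs = digits_unique[OF _ _ _ _ _ _ N(2)[unfolded E_def expand]]
    have eq: "size N = size N0" "size (M' - N) = size (M - N0)" "\<Sum>\<^sub># (?J N) = \<Sum>\<^sub># (?J N0)"
      "\<Sum>\<^sub># (?J (M' - N)) = \<Sum>\<^sub># (?J (M - N0))"
      using B[OF N(1) M'(1)] B[OF sub(1) M'(1)] B[OF N0 MS] B[OF sub(2) MS] by (intro eqs; blast)+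
    have "size M' = size M" "\<Sum>\<^sub># (?J M') = \<Sum>\<^sub># (?J M)"
      using split[OF N(1)] split[OF N0] eq by simp_all
    then have "M' = M"
      by (rule unique[OF M'(1) _ _ N(1) eq(1,3)])
    then show False
      using M'(2) by simp
  qed
  obtain c where c: "coeff (\<Prod>\<gamma>\<in>#M. U \<gamma>) E = of_nat c" "c > 0"
    unfolding U_def using coeff_prod_two_monoms[of e e' M E] N0 by (auto simp: E_def)
  have "0 = coeff (psubst U g) E"
    by (simp add: zero)
  also have "\<dots> = (\<Sum>M'\<in>?S. Poly_Mapping.lookup g M' * coeff (\<Prod>\<gamma>\<in>#M'. U \<gamma>) E)"
    by (simp add: psubst_def coeff_sum)
  also have "\<dots> = (\<Sum>M'\<in>{M}. Poly_Mapping.lookup g M' * coeff (\<Prod>\<gamma>\<in>#M'. U \<gamma>) E)"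
    using MS coeff by (intro sum.mono_neutral_right) auto
  also have "\<dots> = Poly_Mapping.lookup g M * of_nat c"
    by (simp add: c)
  finally show False
    using MS c(2) by (simp add: in_keys_iff)
qed

lemma rearrangement2:
  fixes u1 u2 w1 w2 :: nat
  assumes "u1 < u2" "w1 < w2"
  shows "(u1 + w2)^2 + (u2 + w1)^2 < (u1 + w1)^2 + (u2 + w2)^2"
proof -
  obtain p where p: "u2 = Suc (u1 + p)"
    using assms(1) less_imp_Suc_add by blast
  obtain r where r: "w2 = Suc (w1 + r)"
    using assms(2) less_imp_Suc_add by blast
  have "(u1 + w1)^2 + (u2 + w2)^2 = (u1 + w2)^2 + (u2 + w1)^2 + 2 * (Suc p * Suc r)"
    unfolding p r by (simp add: power2_eq_square algebra_simps)
  then show ?thesis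
    by simp
qed

text \<open>Of all terms of a Hankel minor, the main diagonal has the largest sum of squares of indices.\<close>

lemma rearrangement3:
  fixes u1 u2 u3 w1 w2 w3 :: nat
  assumes u: "u1 < u2" "u2 < u3" and w: "w1 < w2" "w2 < w3"
  shows "(u1 + w2)^2 + (u2 + w3)^2 + (u3 + w1)^2 < (u1 + w1)^2 + (u2 + w2)^2 + (u3 + w3)^2"
    "(u1 + w3)^2 + (u2 + w1)^2 + (u3 + w2)^2 < (u1 + w1)^2 + (u2 + w2)^2 + (u3 + w3)^2"
    "(u1 + w1)^2 + (u2 + w3)^2 + (u3 + w2)^2 < (u1 + w1)^2 + (u2 + w2)^2 + (u3 + w3)^2"
    "(u1 + w2)^2 + (u2 + w1)^2 + (u3 + w3)^2 < (u1 + w1)^2 + (u2 + w2)^2 + (u3 + w3)^2"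
    "(u1 + w3)^2 + (u2 + w2)^2 + (u3 + w1)^2 < (u1 + w1)^2 + (u2 + w2)^2 + (u3 + w3)^2"
proof -
  have u': "u1 < u3" and w': "w1 < w3"
    using u w by simp_all
  show "(u1 + w2)^2 + (u2 + w3)^2 + (u3 + w1)^2 < (u1 + w1)^2 + (u2 + w2)^2 + (u3 + w3)^2"
    using rearrangement2[OF u' w(1)] rearrangement2[OF u(2) w(2)] by linarith
  show "(u1 + w3)^2 + (u2 + w1)^2 + (u3 + w2)^2 < (u1 + w1)^2 + (u2 + w2)^2 + (u3 + w3)^2"
    using rearrangement2[OF u(1) w'] rearrangement2[OF u(2) w(2)] by linarith
  show "(u1 + w1)^2 + (u2 + w3)^2 + (u3 + w2)^2 < (u1 + w1)^2 + (u2 + w2)^2 + (u3 + w3)^2"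
    using rearrangement2[OF u(2) w(2)] by linarith
  show "(u1 + w2)^2 + (u2 + w1)^2 + (u3 + w3)^2 < (u1 + w1)^2 + (u2 + w2)^2 + (u3 + w3)^2"
    using rearrangement2[OF u(1) w(1)] by linarith
  show "(u1 + w3)^2 + (u2 + w2)^2 + (u3 + w1)^2 < (u1 + w1)^2 + (u2 + w2)^2 + (u3 + w3)^2"
    using rearrangement2[OF u' w'] by linarith
qed

text \<open>Every chain with gaps of at least two is the main diagonal of some minor; for both dimensions at least two
  the row and column indices can be chosen from the top down, each row index as small as the columns allow.\<close>

lemma split_indices:
  fixes i j k a b :: nat
  assumes "i + 2 \<le> j" "j + 2 \<le> k" "k \<le> a + b" "a \<ge> 2" "b \<ge> 2"
  obtains u1 u2 u3 w1 w2 w3 where "u1 < u2" "u2 < u3" "u3 \<le> a" "w1 < w2" "w2 < w3" "w3 \<le> b"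
    "i = u1 + w1" "j = u2 + w2" "k = u3 + w3"
proof -
  define u3 where "u3 = max 2 (k - b)"
  define w3 where "w3 = k - u3"
  define u2 where "u2 = max 1 (j + 1 - w3)"
  define w2 where "w2 = j - u2"
  define u1 where "u1 = i + 1 - w2"
  define w1 where "w1 = i - u1"
  have 3: "u3 \<le> a" "w3 \<le> b" "k = u3 + w3" "u3 \<ge> 2" "w3 \<ge> 2"
    using assms by (auto simp: u3_def w3_def max_def)
  have 2: "u2 < u3" "w2 < w3" "j = u2 + w2" "u2 \<ge> 1" "w2 \<ge> 1"
    using assms 3 by (auto simp: u2_def w2_def max_def)
  have 1: "u1 < u2" "w1 < w2" "i = u1 + w1"
    using assms 2 by (auto simp: u1_def w1_def)
  show ?thesis
    using 1 2 3 by (intro that) auto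
qed

context catalecticant
begin

text \<open>Congruent modulo \<open>I\<close> to a combination of clustered monomials.\<close>

definition reducible :: "(nat multiset, 'k) mpoly \<Rightarrow> bool" where
  "reducible p \<longleftrightarrow> (\<exists>g \<in> polys (msets 2 (a + b)).
     (\<forall>N\<in>Poly_Mapping.keys g. clustered (image_mset index N)) \<and> p - g \<in> I)"

lemma reducible_in: "p \<in> I \<Longrightarrow> reducible p"
  unfolding reducible_def by (intro bexI[of _ 0]) (simp_all add: polys_0)

lemma reducible_add:
  assumes "reducible p" "reducible q"
  shows "reducible (p + q)"
proof -
  obtain g h where g: "g \<in> polys (msets 2 (a + b))" "\<forall>N\<in>Poly_Mapping.keys g. clustered (image_mset index N)" "p - g \<in> I"
    and h: "h \<in> polys (msets 2 (a + b))" "\<forall>N\<in>Poly_Mapping.keys h. clustered (image_mset index N)" "q - h \<in> I"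
    using assms unfolding reducible_def by blast
  have "p + q - (g + h) \<in> I"
    using add_in[OF g(3) h(3)] by (simp add: algebra_simps)
  moreover have "\<forall>N\<in>Poly_Mapping.keys (g + h). clustered (image_mset index N)"
    using g(2) h(2) Poly_Mapping.keys_add[of g h] by blast
  ultimately show ?thesis
    unfolding reducible_def using polys_add[OF g(1) h(1)] by blast
qed

lemma reducible_const_mult:
  assumes "reducible p"
  shows "reducible (const c * p)"
proof -
  obtain g where g: "g \<in> polys (msets 2 (a + b))" "\<forall>N\<in>Poly_Mapping.keys g. clustered (image_mset index N)" "p - g \<in> I"
    using assms unfolding reducible_def by blast
  have "const c * p - const c * g \<in> I"
    using const_mult_in[OF g(3), of c] by (simp add: algebra_simps)
  moreover have "\<forall>N\<in>Poly_Mapping.keys (const c * g). clustered (image_mset index N)"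
    using g(2) keys_mult[of "const c" g] by (fastforce simp: const_def split: if_splits)
  ultimately show ?thesis
    unfolding reducible_def using polys_mult[OF polys_const g(1)] by blast
qed

lemma reducible_diff: "reducible p \<Longrightarrow> reducible q \<Longrightarrow> reducible (p - q)"
  using reducible_add[of p "const (- 1) * q"] reducible_const_mult[of q "- 1"] by (simp add: const_uminus)

text \<open>Straightening: a monomial that is not clustered is divisible by the main diagonal of a minor, and the
  other terms of the minor have a smaller sum of squares of indices.\<close>

lemma reducible_monomial:
  assumes ab: "a \<ge> 2" "b \<ge> 2" and n: "n \<ge> 2"
    and M: "set_mset M \<subseteq> msets 2 (a + b)"
  shows "reducible (Poly_Mapping.single M 1)"
  using M
proof (induction "\<Sum>\<gamma>\<in>#M. (index \<gamma>)\<^sup>2" arbitrary: M rule: less_induct)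
  case less
  show ?case
  proof (cases "clustered (image_mset index M)")
    case True
    then show ?thesis
      unfolding reducible_def using less.prems
      by (intro bexI[of _ "Poly_Mapping.single M 1"]) (simp_all add: zero_in polys_single)
  next
    case False
    then obtain \<gamma>1 \<gamma>2 \<gamma>3 where \<gamma>: "\<gamma>1 \<in># M" "\<gamma>2 \<in># M" "\<gamma>3 \<in># M"
      "index \<gamma>1 + 2 \<le> index \<gamma>2" "index \<gamma>2 + 2 \<le> index \<gamma>3"
      unfolding clustered_def by auto
    then have ne: "\<gamma>1 \<noteq> \<gamma>2" "\<gamma>1 \<noteq> \<gamma>3" "\<gamma>2 \<noteq> \<gamma>3"
      by auto
    define R where "R = M - {#\<gamma>1#} - {#\<gamma>2#} - {#\<gamma>3#}"
    have MR: "M = add_mset \<gamma>1 (add_mset \<gamma>2 (add_mset \<gamma>3 R))"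
    proof -
      have "\<gamma>2 \<in># M - {#\<gamma>1#}" "\<gamma>3 \<in># M - {#\<gamma>1#} - {#\<gamma>2#}"
        using \<gamma>(1-3) ne by (auto simp: in_diff_count)
      then show ?thesis
        unfolding R_def using \<gamma>(1) by (simp only: insert_DiffM)
    qed
    have R: "set_mset R \<subseteq> msets 2 (a + b)"
      and \<gamma>_in: "\<gamma>1 \<in> msets 2 (a + b)" "\<gamma>2 \<in> msets 2 (a + b)" "\<gamma>3 \<in> msets 2 (a + b)"
      using less.prems by (simp_all add: MR)
    obtain u1 u2 u3 w1 w2 w3 where u: "u1 < u2" "u2 < u3" "u3 \<le> a" and w: "w1 < w2" "w2 < w3" "w3 \<le> b"
      and uw: "index \<gamma>1 = u1 + w1" "index \<gamma>2 = u2 + w2" "index \<gamma>3 = u3 + w3"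
      by (rule split_indices[OF \<gamma>(4,5) binary_index(2)[OF \<gamma>_in(3)] ab])
    define m where "m x y z = Poly_Mapping.single (add_mset (binary (a + b) x) (add_mset (binary (a + b) y)
       (add_mset (binary (a + b) z) R))) (1 :: 'k)" for x y z
    have small: "reducible (m x y z)"
      if "x\<^sup>2 + y\<^sup>2 + z\<^sup>2 < (u1 + w1)\<^sup>2 + (u2 + w2)\<^sup>2 + (u3 + w3)\<^sup>2" "x \<le> a + b" "y \<le> a + b" "z \<le> a + b" for x y z
      unfolding m_def using that R uw
      by (intro less.hyps) (simp_all add: MR binary_in_msets)
    define D where "D = det3 cat (binary a u1) (binary a u2) (binary a u3) (binary b w1) (binary b w2) (binary b w3)
        * Poly_Mapping.single R (1 :: 'k)"
    have M_eq: "Poly_Mapping.single M 1 = m (u1 + w1) (u2 + w2) (u3 + w3)"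
      unfolding m_def MR uw[symmetric] using binary_index(1) \<gamma>_in by simp
    have D_eq: "D = m (u1 + w1) (u2 + w2) (u3 + w3) + m (u1 + w2) (u2 + w3) (u3 + w1) + m (u1 + w3) (u2 + w1) (u3 + w2)
        - m (u1 + w1) (u2 + w3) (u3 + w2) - m (u1 + w2) (u2 + w1) (u3 + w3) - m (u1 + w3) (u2 + w2) (u3 + w1)"
      using u w by (simp add: D_def det3_def cat_def m_def binary_add single_add_mset algebra_simps)
    have D_in: "D \<in> I"
    proof -
      have "set_mset R \<subseteq> msets n (a + b)"
        using R n unfolding msets_def by fastforce
      then have "Poly_Mapping.single R 1 * det3 cat (binary a u1) (binary a u2) (binary a u3) (binary b w1) (binary b w2) (binary b w3) \<in> I"
        using u w n by (intro mult_in polys_single det3_cat_in binary_in_msets) auto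
      then show ?thesis
        by (simp add: D_def mult.commute)
    qed
    have split: "Poly_Mapping.single M 1 = D - m (u1 + w2) (u2 + w3) (u3 + w1) - m (u1 + w3) (u2 + w1) (u3 + w2)
        + m (u1 + w1) (u2 + w3) (u3 + w2) + m (u1 + w2) (u2 + w1) (u3 + w3) + m (u1 + w3) (u2 + w2) (u3 + w1)"
      by (simp add: M_eq D_eq)
    show ?thesis
      unfolding split using u w
      by (intro reducible_add reducible_diff reducible_in[OF D_in] small rearrangement3) auto
  qed
qed

lemma binary_sec_ideal_subset:
  assumes ab: "a \<ge> 2" "b \<ge> 2" and n: "n \<ge> 2"
    and f: "f \<in> sec_ideal (msets n (a + b))" "f \<in> polys (msets 2 (a + b))"
  shows "f \<in> I"
proof -
  have "Poly_Mapping.keys f \<subseteq> {M. set_mset M \<subseteq> msets 2 (a + b)}"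
    using f(2) by (auto simp: polys_iff)
  then have "reducible f"
  proof (induction f rule: poly_mapping_induct_in)
    case (single M c)
    then show ?case
      using reducible_const_mult[OF reducible_monomial[OF ab n], of M c] by (simp flip: single_eq_const_mult)
  qed (auto intro: reducible_in zero_in reducible_add)
  then obtain g where g: "g \<in> polys (msets 2 (a + b))" "\<forall>N\<in>Poly_Mapping.keys g. clustered (image_mset index N)" "f - g \<in> I"
    unfolding reducible_def by blast
  have "mpoly_eval (sec_pt s t c e) g = 0" for s t c e
  proof -
    have "mpoly_eval (sec_pt s t c e) (f - g) = 0" "mpoly_eval (sec_pt s t c e) f = 0"
      using subset_sec_ideal g(3) f(1) by (auto simp: sec_ideal_def)
    then show ?thesis
      by simp
  qed
  then have "g = 0"
    using clustered_independent[OF g(1)] g(2) by blast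
  then show ?thesis
    using g(3) by simp
qed

lemma eq_sec_ideal:
  assumes "a \<ge> 2" "b \<ge> 2" "n \<ge> 2"
  shows "I = sec_ideal (msets n (a + b))"
  using subset_sec_ideal sec_ideal_subset binary_sec_ideal_subset assms by (metis One_nat_def Suc_1 Suc_leD equalityI)

end

section \<open>Secant lines of the Veronese variety\<close>

lemma veronese_vec_eq:
  assumes "\<gamma> \<in> msets n d"
  shows "veronese_vec n d c \<gamma> = (\<Prod>k\<in>#\<gamma>. c k)"
proof -
  have "(\<Prod>k\<in>#\<gamma>. c k) = (\<Prod>k\<in>set_mset \<gamma>. c k ^ count \<gamma> k)"
    by (rule image_prod_mset_multiplicity)
  also have "\<dots> = (\<Prod>k=1..n. c k ^ count \<gamma> k)"
    using assms by (intro prod.mono_neutral_left) (auto simp: msets_def not_in_iff)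
  finally show ?thesis
    using assms by (simp add: veronese_vec_def)
qed

lemma veronese_vec_in_coord_space: "veronese_vec n d c \<in> coord_space (msets n d)"
  by (simp add: veronese_vec_def coord_space_def)

lemma mpoly_eval_veronese:
  assumes "f \<in> polys (msets n d)"
  shows "mpoly_eval (fscale s (veronese_vec n d c) + fscale t (veronese_vec n d e)) f = mpoly_eval (sec_pt s t c e) f"
  by (rule mpoly_eval_cong[OF assms]) (simp add: fscale_def sec_pt_def veronese_vec_eq)

text \<open>The union whose Zariski closure is the secant line variety.\<close>

definition secant_points :: "nat \<Rightarrow> nat \<Rightarrow> (nat multiset \<Rightarrow> 'k::field) set set" where
  "secant_points n d = (\<Union>T\<in>{T. T \<subseteq> veronese_image n d \<and> card T = 2}. proj_span (msets n d) T)"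

lemma span_secant_line:
  "fvs.span (\<Union>{fvs.span {v}, fvs.span {w}}) = {fscale s v + fscale t w | s t. True}"
proof -
  have "fvs.span (\<Union>{fvs.span {v}, fvs.span {w}}) = {x + y | x y. x \<in> fvs.span {v} \<and> y \<in> fvs.span {w}}"
    by (simp add: fvs.span_Un fvs.span_span)
  also have "\<dots> = {fscale s v + fscale t w | s t. True}"
    by (auto simp: fvs.span_singleton)
  finally show ?thesis .
qed

lemma secant_pointsE:
  assumes "L \<in> secant_points n d" "u \<in> L"
  obtains s t c e where "u = fscale s (veronese_vec n d c) + fscale t (veronese_vec n d e)"
proof -
  obtain T where T: "T \<subseteq> veronese_image n d" "card T = 2" "L \<subseteq> fvs.span (\<Union>T)"
    using assms by (auto simp: secant_points_def proj_span_def)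
  obtain P Q where PQ: "T = {P, Q}"
    using T(2) by (auto simp: card_2_iff)
  obtain c where c: "P = fvs.span {veronese_vec n d c}"
    using T(1) PQ by (auto simp: veronese_image_def)
  obtain e where e: "Q = fvs.span {veronese_vec n d e}"
    using T(1) PQ by (auto simp: veronese_image_def)
  have "u \<in> fvs.span (\<Union>{fvs.span {veronese_vec n d c}, fvs.span {veronese_vec n d e}})"
    using T(3) assms(2) unfolding PQ c e by blast
  then show ?thesis
    unfolding span_secant_line using that by blast
qed

text \<open>The coordinates at \<open>1\<^sup>d\<close> and \<open>1\<^bsup>d-1\<^esup> 2\<close> already determine the ratio of the first two coordinates of the point.\<close>

lemma veronese_vec_not_proportional:
  fixes a b :: "nat \<Rightarrow> 'k::field"
  assumes n: "n \<ge> 2" and d: "d \<ge> 1" and ab: "a 1 \<noteq> 0" "a 1 * b 2 \<noteq> a 2 * b 1"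
  shows "veronese_vec n d a \<notin> fvs.span {veronese_vec n d b}"
proof
  assume "veronese_vec n d a \<in> fvs.span {veronese_vec n d b}"
  then obtain k where k: "veronese_vec n d a = fscale k (veronese_vec n d b)"
    by (auto simp: fvs.span_singleton)
  obtain d' where d': "d = Suc d'"
    using d by (metis Suc_le_D One_nat_def)
  have eq: "(\<Prod>i\<in>#\<gamma>. a i) = k * (\<Prod>i\<in>#\<gamma>. b i)" if "\<gamma> \<in> msets n d" for \<gamma>
    using fun_cong[OF k, of \<gamma>] that by (simp add: fscale_def veronese_vec_eq)
  have "add_mset 1 (replicate_mset d' 1) \<in> msets n d" "add_mset 2 (replicate_mset d' 1) \<in> msets n d"
    using n by (auto simp: msets_def d')
  from this[THEN eq] have 1: "a 1 * a 1 ^ d' = k * (b 1 * b 1 ^ d')" and 2: "a 2 * a 1 ^ d' = k * (b 2 * b 1 ^ d')"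
    by simp_all
  have "a 1 ^ d' * (a 2 * b 1) = (a 2 * a 1 ^ d') * b 1"
    by (simp add: ac_simps)
  also have "\<dots> = (k * (b 1 * b 1 ^ d')) * b 2"
    unfolding 2 by (simp add: ac_simps)
  also have "\<dots> = a 1 ^ d' * (a 1 * b 2)"
    unfolding 1[symmetric] by (simp add: ac_simps)
  finally show False
    using ab by simp
qed

lemma eval_generic_secant_point:
  fixes f :: "(nat multiset, 'k::field_char_0) mpoly"
  assumes n: "n \<ge> 2" and d: "d \<ge> 1"
    and f: "f \<in> polys (msets n d)" "\<And>L. L \<in> secant_points n d \<Longrightarrow> vanishes_at f L"
    and ab: "s \<noteq> 0" "a 1 \<noteq> 0" "a 1 * b 2 \<noteq> a 2 * b 1"
  shows "mpoly_eval (sec_pt s t a b) f = 0"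
proof -
  define a' where "a' k = (if k \<in> {1..n} then a k else 0)" for k
  define b' where "b' k = (if k \<in> {1..n} then b k else 0)" for k
  have cs: "a' \<in> coord_space {1..n}" "b' \<in> coord_space {1..n}"
    by (auto simp: coord_space_def a'_def b'_def)
  have ab': "a' 1 \<noteq> 0" "a' 1 * b' 2 \<noteq> a' 2 * b' 1"
    using ab n by (auto simp: a'_def b'_def)
  then have "a' \<noteq> 0" "b' \<noteq> 0"
    by auto
  define v where "v = veronese_vec n d a'"
  define w where "w = veronese_vec n d b'"
  have v: "v \<notin> fvs.span {w}"
    unfolding v_def w_def by (rule veronese_vec_not_proportional[OF n d ab'])
  then have ne: "fvs.span {v} \<noteq> fvs.span {w}"
    using fvs.span_base[of v "{v}"] by blast
  define u where "u = fscale s v + fscale t w"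
  have "u \<noteq> 0"
  proof
    assume "u = 0"
    have "v \<gamma> = (- t / s) * w \<gamma>" for \<gamma>
    proof -
      have "s * v \<gamma> + t * w \<gamma> = 0"
        using fun_cong[OF \<open>u = 0\<close>, of \<gamma>] by (simp add: u_def fscale_def)
      then show ?thesis
        using ab(1) by (simp add: field_simps eq_neg_iff_add_eq_0)
    qed
    then have "v = fscale (- t / s) w"
      by (simp add: fscale_def fun_eq_iff)
    then have "v \<in> fvs.span {w}"
      unfolding fvs.span_singleton by (rule range_eqI)
    then show False
      using v by blast
  qed
  have "u \<in> coord_space (msets n d)"
    using veronese_vec_in_coord_space[of n d a'] veronese_vec_in_coord_space[of n d b']
    by (simp add: u_def v_def w_def coord_space_def fscale_def)
  then have "fvs.span {u} \<in> proj_space (msets n d)"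
    using \<open>u \<noteq> 0\<close> by (auto simp: proj_space_def)
  moreover have "fvs.span {u} \<subseteq> fvs.span (\<Union>{fvs.span {v}, fvs.span {w}})"
  proof (rule fvs.span_minimal)
    show "{u} \<subseteq> fvs.span (\<Union>{fvs.span {v}, fvs.span {w}})"
      unfolding span_secant_line u_def by blast
  qed (rule fvs.subspace_span)
  ultimately have "fvs.span {u} \<in> proj_span (msets n d) {fvs.span {v}, fvs.span {w}}"
    by (simp add: proj_span_def)
  moreover have "{fvs.span {v}, fvs.span {w}} \<subseteq> veronese_image n d"
    using cs \<open>a' \<noteq> 0\<close> \<open>b' \<noteq> 0\<close> by (auto simp: veronese_image_def v_def w_def)
  moreover have "card {fvs.span {v}, fvs.span {w}} = 2"
    using ne by simp
  ultimately have "fvs.span {u} \<in> secant_points n d"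
    unfolding secant_points_def by blast
  then have "mpoly_eval u f = 0"
    using f(2) \<open>u \<noteq> 0\<close> fvs.span_base[of u "{u}"] unfolding vanishes_at_def by blast
  then have "mpoly_eval (sec_pt s t a' b') f = 0"
    unfolding u_def v_def w_def mpoly_eval_veronese[OF f(1)] .
  moreover have "mpoly_eval (sec_pt s t a' b') f = mpoly_eval (sec_pt s t a b) f"
  proof (rule mpoly_eval_cong[OF f(1)])
    fix \<gamma> assume "\<gamma> \<in> msets n d"
    then have "image_mset a' \<gamma> = image_mset a \<gamma>" "image_mset b' \<gamma> = image_mset b \<gamma>"
      by (auto intro!: image_mset_cong simp: a'_def b'_def msets_def subset_iff)
    then show "sec_pt s t a' b' \<gamma> = sec_pt s t a b \<gamma>"
      by (simp add: sec_pt_def)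
  qed
  ultimately show ?thesis
    by simp
qed

text \<open>An arbitrary point \<open>s a\<^sup>\<gamma> + t b\<^sup>\<gamma>\<close> need not lie on a secant line, for instance when \<open>a\<close> and \<open>b\<close> are proportional.
  Adding \<open>x\<close> to \<open>s\<close>, to the first coordinate of \<open>a\<close> and to the second coordinate of \<open>b\<close> moves it to a point
  of a secant line whenever \<open>x\<close> is no root of the polynomial \<open>Q\<close>, and polynomials over an infinite
  field extend the vanishing to \<open>x = 0\<close>.\<close>

lemma vanishing_on_secant_points:
  fixes f :: "(nat multiset, 'k::field_char_0) mpoly"
  assumes n: "n \<ge> 2" and d: "d \<ge> 1"
    and f: "f \<in> polys (msets n d)" "\<And>L. L \<in> secant_points n d \<Longrightarrow> vanishes_at f L"
  shows "f \<in> sec_ideal (msets n d)"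
proof -
  have "mpoly_eval (sec_pt s t a b) f = 0" for s t a b
  proof -
    define A where "A k = [:a k, if k = 1 then 1 else 0:]" for k
    define B where "B k = [:b k, if k = 2 then 1 else 0:]" for k
    define U where "U \<gamma> = [:s, 1:] * (\<Prod>k\<in>#\<gamma>. A k) + smult t (\<Prod>k\<in>#\<gamma>. B k)" for \<gamma>
    define Q where "Q = [:s, 1:] * (A 1 * (A 1 * B 2 - A 2 * B 1))"
    have eval: "poly (psubst U f) x = mpoly_eval (sec_pt (s + x) t (\<lambda>k. poly (A k) x) (\<lambda>k. poly (B k) x)) f" for x
      by (rule poly_psubst[OF f(1)]) (simp add: U_def sec_pt_def poly_prod_mset_image distrib_right)
    have Q_eval: "poly Q x = (s + x) * (poly (A 1) x * (poly (A 1) x * poly (B 2) x - poly (A 2) x * poly (B 1) x))" for x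
      by (simp add: Q_def algebra_simps)
    have "poly (Q * psubst U f) x = 0" for x
    proof (cases "poly Q x = 0")
      case False
      then have "s + x \<noteq> 0" "poly (A 1) x \<noteq> 0" "poly (A 1) x * poly (B 2) x \<noteq> poly (A 2) x * poly (B 1) x"
        unfolding Q_eval by (simp_all only: mult_eq_0_iff de_Morgan_disj right_minus_eq simp_thms)
      note generic = this
      have "mpoly_eval (sec_pt (s + x) t (\<lambda>k. poly (A k) x) (\<lambda>k. poly (B k) x)) f = 0"
      proof (rule eval_generic_secant_point[OF n d f(1)])
        show "vanishes_at f L" if "L \<in> secant_points n d" for L
          using that by (rule f(2))
      qed (rule generic)+
      then show ?thesis
        by (simp add: eval)
    qed simp
    then have "Q * psubst U f = 0"
      by (intro poly_all_0_iff_0[THEN iffD1] allI)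
    moreover have "Q \<noteq> 0"
      by (simp add: Q_def A_def B_def)
    ultimately have "poly (psubst U f) 0 = 0"
      by simp
    then show ?thesis
      unfolding eval by (simp add: A_def B_def)
  qed
  then show ?thesis
    using f(1) by (simp add: sec_ideal_def)
qed

lemma mpoly_ideal_vanishing_ideal: "mpoly_ideal X (vanishing_ideal X Y)"
  by (rule mpoly_idealI) (auto simp: vanishing_ideal_def vanishes_at_def intro: polys_intros)

lemma homogeneous_det3_cat: "homogeneous (det3 cat a1 a2 a3 b1 b2 b3 :: (nat multiset, 'k::comm_ring_1) mpoly)"
proof -
  define H :: "nat \<Rightarrow> (nat multiset, 'k) mpoly set" where "H e = {p. \<forall>m\<in>Poly_Mapping.keys p. size m = e}" for e
  have mult: "p * q \<in> H (e + e')" if p: "p \<in> H e" and q: "q \<in> H e'" for p q e e'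
  proof -
    have "size m = e + e'" if m: "m \<in> Poly_Mapping.keys (p * q)" for m
    proof -
      obtain x y where "m = x + y" "x \<in> Poly_Mapping.keys p" "y \<in> Poly_Mapping.keys q"
        using keys_mult[of p q] m by blast
      then show ?thesis
        using p q by (simp add: H_def)
    qed
    then show ?thesis
      by (simp add: H_def)
  qed
  have add: "p + q \<in> H e" if "p \<in> H e" "q \<in> H e" for p q e
    using that Poly_Mapping.keys_add[of p q] unfolding H_def by blast
  have diff: "p - q \<in> H e" if "p \<in> H e" "q \<in> H e" for p q e
  proof -
    have "- q \<in> H e"
      using that(2) by (simp add: H_def)
    then show ?thesis
      using add[OF that(1), of "- q"] by simp
  qed
  have cat: "cat \<alpha> \<beta> \<in> H 1" for \<alpha> \<beta>
    by (simp add: cat_def mvar_def H_def)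
  have "cat \<alpha>1 \<beta>1 * cat \<alpha>2 \<beta>2 * cat \<alpha>3 \<beta>3 \<in> H (1 + 1 + 1)" for \<alpha>1 \<alpha>2 \<alpha>3 \<beta>1 \<beta>2 \<beta>3
    by (intro mult cat)
  then have "det3 cat a1 a2 a3 b1 b2 b3 \<in> H (1 + 1 + 1)"
    unfolding det3_def by (intro add diff)
  then show ?thesis
    by (auto simp: homogeneous_def H_def)
qed

theorem corollary5p2:
  fixes n d t :: nat
  assumes "n \<ge> 2" and "d \<ge> 4" and "2 \<le> t" and "t \<le> d - 2"
  shows "(cat_ideal 3 t (d - t) n :: (nat multiset, 'k::field_char_0) mpoly set) =
           vanishing_ideal (msets n d) (secant_line_variety n d)"
proof -
  define I :: "(nat multiset, 'k) mpoly set" where "I = cat_ideal 3 t (d - t) n"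
  interpret catalecticant n t "d - t" I
    by unfold_locales (rule I_def)
  have td: "t + (d - t) = d"
    using assms by simp
  let ?X = "msets n d"
  let ?V = "secant_line_variety n d :: (nat multiset \<Rightarrow> 'k) set set"
  let ?M = "minors 3 (msets n t) (msets n (d - t)) cat :: (nat multiset, 'k) mpoly set"
  have V: "?V = zariski_closure ?X (secant_points n d)"
    by (simp add: secant_line_variety_def secant_points_def)
  have I_eq: "I = sec_ideal ?X"
    using eq_sec_ideal assms td by simp
  have M_polys: "?M \<subseteq> polys ?X"
    using minors_polys[of n t "d - t"] td by simp
  have "?M \<subseteq> vanishing_ideal ?X ?V"
  proof
    fix p assume p: "p \<in> ?M"
    define Z where "Z = {L \<in> proj_space ?X. \<forall>p\<in>?M. vanishes_at p L}"
    have hom: "homogeneous q" if q: "q \<in> ?M" for q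
    proof -
      obtain a1 a2 a3 b1 b2 b3 where "q = det3 cat a1 a2 a3 b1 b2 b3"
        using q by (rule minors_3E)
      then show ?thesis
        by (simp add: homogeneous_det3_cat)
    qed
    have "zariski_closed ?X Z"
      unfolding zariski_closed_def Z_def by (intro exI[of _ ?M] conjI ballI M_polys hom refl)
    moreover have "secant_points n d \<subseteq> Z"
    proof
      fix L :: "(nat multiset \<Rightarrow> 'k) set" assume L: "L \<in> secant_points n d"
      have "mpoly_eval u q = 0" if q: "q \<in> ?M" and u: "u \<in> L" for q u
      proof -
        obtain s t' c e where u_eq: "u = fscale s (veronese_vec n d c) + fscale t' (veronese_vec n d e)"
          by (rule secant_pointsE[OF L u])
        have "q \<in> sec_ideal ?X"
          using subsetD[OF minors_subset q] unfolding I_eq .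
        then show ?thesis
          unfolding u_eq by (simp add: sec_ideal_def mpoly_eval_veronese)
      qed
      moreover have "L \<in> proj_space ?X"
        using L by (auto simp: secant_points_def proj_span_def)
      ultimately show "L \<in> Z"
        by (simp add: Z_def vanishes_at_def)
    qed
    ultimately have "?V \<subseteq> Z"
      unfolding V zariski_closure_def by (intro Inter_lower CollectI conjI)
    then have "vanishes_at p L" if "L \<in> ?V" for L
      using that p unfolding Z_def by blast
    then show "p \<in> vanishing_ideal ?X ?V"
      using subsetD[OF M_polys p] by (simp add: vanishing_ideal_def)
  qed
  then have "I \<subseteq> vanishing_ideal ?X ?V"
    using minimal[of "vanishing_ideal ?X ?V"] mpoly_ideal_vanishing_ideal[of ?X ?V] td by simp
  moreover have "vanishing_ideal ?X ?V \<subseteq> sec_ideal ?X"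
  proof
    fix f assume f: "f \<in> vanishing_ideal ?X ?V"
    have Y: "secant_points n d \<subseteq> ?V"
      unfolding V zariski_closure_def by (rule Inter_greatest) simp
    show "f \<in> sec_ideal ?X"
    proof (rule vanishing_on_secant_points)
      show "f \<in> polys ?X"
        using f by (simp add: vanishing_ideal_def)
      show "vanishes_at f L" if "L \<in> secant_points n d" for L
        using f subsetD[OF Y that] by (simp add: vanishing_ideal_def)
    qed (use assms in simp_all)
  qed
  ultimately show ?thesis
    unfolding I_def[symmetric] using I_eq by (intro equalityI) simp_all
qed

end
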